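(* Let $\alpha,\beta$ be real numbers strictly greater than $-1$, let $j,k\in\mathbb{N}$, let $\theta,\eta\in\mathscr{C}^\infty_c(\mathbb{C})$, and for $s\in\mathbb{C}^*$ put $$F_{\alpha,\beta,j,k}(s):=\frac{1}{2i\pi}\int_{\mathbb{C}}\theta(s-u)\,\eta(u)\,|s-u|^{2\alpha}(\log|s-u|^2)^j\,|u|^{2\beta}(\log|u|^2)^k\,du\wedge d\bar u.$$ Then there exist functions $(\zeta_l)_{l\in[0,L]}$ and $\xi$ in $\mathscr{C}^\infty_c(\mathbb{C})$ such that $$F_{\alpha,\beta,j,k}(s)=\sum_{l=0}^L\zeta_l(s)\,|s|^{2(\alpha+\beta+1)}(\log|s|^2)^l+\xi(s),$$ where - $L=j+k$ if $\alpha,\beta,\alpha+\beta+1\notin\mathbb{N}$; - $L=j+k+1$ if $\alpha,\beta\notin\mathbb{N}$ and $\alpha+\beta+1\in\mathbb{N}$; - $L=j+k-1$ if $\alpha$ or $\beta$ (or both) is an integer. Moreover one has $L=-1$ as soon as $\alpha\in\mathbb{N}$ and $j=0$ or, symmetrically, as soon as $\beta\in\mathbb{N}$ and $k=0$.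
   Context: $\mathbb{N}=\{0,1,2,\dots\}$. When $L=-1$ the sum is empty, i.e. the function equals $\xi\in\mathscr{C}^\infty_c(\mathbb{C})$ on $\mathbb{C}^*$; the final sentence means that in those cases the sum can be taken empty. *)

theory Defs
  imports "HOL-Analysis.Analysis"
begin

text \<open>
  \<open>Cn n f\<close>: \<open>f\<close> is of class \<open>C\<^sup>n\<close> on \<open>\<complex> = \<real>\<^sup>2\<close> in the real sense. The predicate
  \<open>differentiable\<close> and \<open>frechet_derivative\<close> refer to real-linear derivatives, so this is
  not holomorphy; all iterated directional derivatives exist and are continuous.
\<close>

primrec Cn :: "nat \<Rightarrow> (complex \<Rightarrow> complex) \<Rightarrow> bool" where
  "Cn 0 f \<longleftrightarrow> continuous_on UNIV f"
| "Cn (Suc n) f \<longleftrightarrow> (\<forall>z. f differentiable (at z)) \<and>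
     (\<forall>v. Cn n (\<lambda>z. frechet_derivative f (at z) v))"

definition Cinf_compact :: "(complex \<Rightarrow> complex) set" where
  "Cinf_compact = {f. (\<forall>n. Cn n f) \<and> compact (closure (support_on UNIV f))}"

text \<open>
  With \<open>u = x + i y\<close> one has \<open>du \<and> d(cnj u) = -2 i dx \<and> dy\<close>, and \<open>\<complex>\<close> carries its standard
  orientation, under which \<open>dx \<and> dy\<close> is the Lebesgue measure.
\<close>

definition integral_du_dubar :: "(complex \<Rightarrow> complex) \<Rightarrow> complex" where
  "integral_du_dubar g = - 2 * \<i> * (LINT u|lborel. g u)"

text \<open>
  The conventions \<open>0 powr a = 0\<close> and \<open>ln 0 = 0\<close> only affect the integrand
  at the two points \<open>u = 0\<close> and \<open>u = s\<close>, a null set.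
\<close>

definition F_conv ::
  "(complex \<Rightarrow> complex) \<Rightarrow> (complex \<Rightarrow> complex) \<Rightarrow> real \<Rightarrow> real \<Rightarrow> nat \<Rightarrow> nat \<Rightarrow> complex \<Rightarrow> complex"
where
  "F_conv \<theta> \<eta> \<alpha> \<beta> j k s = 1 / (2 * \<i> * complex_of_real pi) *
     integral_du_dubar (\<lambda>u. \<theta> (s - u) * \<eta> u *
       complex_of_real (cmod (s - u) powr (2 * \<alpha>) * ln ((cmod (s - u))\<^sup>2) ^ j *
                        cmod u powr (2 * \<beta>) * ln ((cmod u)\<^sup>2) ^ k))"

text \<open>The upper bound \<open>L\<close> is an integer so that \<open>L = -1\<close> yields the empty sum.\<close>

definition has_log_expansion :: "(complex \<Rightarrow> complex) \<Rightarrow> real \<Rightarrow> int \<Rightarrow> bool" where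
  "has_log_expansion F \<gamma> L \<longleftrightarrow>
     (\<exists>(\<zeta> :: nat \<Rightarrow> complex \<Rightarrow> complex) \<xi>.
        (\<forall>l. int l \<le> L \<longrightarrow> \<zeta> l \<in> Cinf_compact) \<and> \<xi> \<in> Cinf_compact \<and>
        (\<forall>s. s \<noteq> 0 \<longrightarrow>
           F s = (\<Sum>l | int l \<le> L. \<zeta> l s *
                    complex_of_real (cmod s powr (2 * \<gamma>) * ln ((cmod s)\<^sup>2) ^ l)) + \<xi> s))"

end

theory Submission
  imports Defs
begin

text \<open>
  Write \<open>K\<^bsub>a,b,\<alpha>,j\<^esub>(z) = z\<^sup>a (cnj z)\<^sup>b |z|\<^bsup>2\<alpha>\<^esup> (log |z|\<^sup>2)\<^sup>j\<close>. Replacing \<open>\<theta>\<close> and \<open>\<eta>\<close> by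
  Taylor polynomials at \<open>0\<close> times a radial cutoff changes the convolution by a function of class
  \<open>C\<^sup>N\<close>, because a remainder vanishing to high order makes one factor \<open>C\<^sup>N\<close>. So the singular part
  is carried by the model convolutions \<open>H\<^sub>j\<^sub>k\<close> of cut-off kernels \<open>K\<^bsub>a,b,\<alpha>,j\<^esub>\<close> and \<open>K\<^bsub>c,d,\<beta>,k\<^esub>\<close>.
  Such an \<open>H\<^sub>j\<^sub>k\<close> is exactly equivariant under rotations, and with the Euler field \<open>R\<close> and
  \<open>\<kappa> = a + b + c + d + 2(\<alpha> + \<beta> + 1)\<close> scaling gives
  \<open>(R - \<kappa>) H\<^sub>j\<^sub>k = 2j H\<^bsub>j-1,k\<^esub> + 2k H\<^bsub>j,k-1\<^esub> + smooth\<close>.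
  Solving this equation along rays produces one more logarithm than the right-hand side has, where
  the smooth term counts as singular without logarithm if \<open>\<alpha> + \<beta> + 1 \<in> \<nat>\<close> (resonance) and
  does not count otherwise. If \<open>\<alpha> \<in> \<nat>\<close> and \<open>j = 0\<close>, the
  first factor is smooth and so is \<open>H\<^sub>0\<^sub>k\<close>. Induction on \<open>j + k\<close> yields the values of \<open>L\<close>.
  Finally the coefficients, known as formal Taylor series, are realised by smooth functions
  \<open>\<zeta>\<^sub>l\<close> with Borel's lemma, and the remaining difference is \<open>C\<^sup>N\<close> for every \<open>N\<close>.
\<close>

section \<open>Real-differentiable function classes\<close>

text \<open>An ordinary derivative of the convolution falls on one factor and lowers its exponent,
  possibly below the threshold of integrability. The Euler field avoids this: scaling
  \<open>s\<close> and \<open>u\<close> together differentiates both factors along rays, and each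
  kernel is an eigenfunction up to terms with fewer logarithms. The price is that only radial
  derivatives are controlled; exact equivariance supplies the angular information and leaves a
  single integration constant per model. This is why the cutoff has to be radial. The convolution
  need not converge at \<open>s = 0\<close>, so expansions are stated off the origin, and smooth
  parts are fixed there by continuity. Resonance is a matter of parity: a polynomial component of
  degree \<kappa> with the equivariance of the model satisfies
  \<open>\<kappa> = a + b + c + d\<close> mod 2, which makes \<alpha> + \<beta> + 1 an integer. If
  that sum and one of \<alpha>, \<beta> are integers, both are, so the models are smooth whenever
  \<open>j = 0\<close> or \<open>k = 0\<close>; this late start of the induction is what lowers
  \<open>L\<close> to \<open>j + k - 1\<close>.\<close>

definition Dv :: "complex \<Rightarrow> (complex \<Rightarrow> complex) \<Rightarrow> complex \<Rightarrow> complex" where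
  "Dv v f z = frechet_derivative f (at z) v"

definition smooth :: "(complex \<Rightarrow> complex) \<Rightarrow> bool" where
  "smooth f \<longleftrightarrow> (\<forall>n. Cn n f)"

definition bdd_supp :: "(complex \<Rightarrow> complex) \<Rightarrow> bool" where
  "bdd_supp f \<longleftrightarrow> (\<exists>R. \<forall>z. R < norm z \<longrightarrow> f z = 0)"

section \<open>Calculus of the classes C^n\<close>

lemma CnI:
  assumes "\<And>z. (f has_derivative f' z) (at z)" "\<And>v. Cn n (\<lambda>z. f' z v)"
  shows "Cn (Suc n) f"
proof -
  have "frechet_derivative f (at z) = f' z" for z
    using frechet_derivative_at[OF assms(1)] by simp
  then show ?thesis
    using assms by (auto simp: differentiable_def)
qed

lemma Cn_SucD:
  assumes "Cn (Suc n) f"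
  shows "(f has_derivative (\<lambda>v. Dv v f z)) (at z)" "Cn n (Dv v f)"
  using assms by (auto simp: Dv_def[abs_def] frechet_derivative_works)

lemma Dv_eq: "(f has_derivative f') (at z) \<Longrightarrow> Dv v f z = f' v"
  using frechet_derivative_at unfolding Dv_def by metis

lemma Cn_continuous: "Cn n f \<Longrightarrow> continuous_on UNIV f"
proof (cases n)
  case (Suc m)
  then show "Cn n f \<Longrightarrow> ?thesis"
    by (auto simp: continuous_on_eq_continuous_at intro: differentiable_imp_continuous_within)
qed simp

lemma Cn_SucD2: "Cn (Suc n) f \<Longrightarrow> Cn n f"
proof (induction n arbitrary: f)
  case 0
  then show ?case using Cn_continuous by (metis Cn.simps(1))
next
  case (Suc n)
  show ?case
    by (rule CnI[OF Cn_SucD(1)[OF Suc.prems]]) (rule Suc.IH[OF Cn_SucD(2)[OF Suc.prems]])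
qed

lemma Cn_mono: "Cn n f \<Longrightarrow> m \<le> n \<Longrightarrow> Cn m f"
  by (induction n) (auto simp: le_Suc_eq intro: Cn_SucD2 simp del: Cn.simps)

lemma Cn_const [simp]: "Cn n (\<lambda>z. c)"
proof (induction n arbitrary: c)
  case (Suc n)
  show ?case by (rule CnI[where f' = "\<lambda>_ _. 0"]) (use Suc in auto)
qed simp

lemma Cn_add: "Cn n f \<Longrightarrow> Cn n g \<Longrightarrow> Cn n (\<lambda>z. f z + g z)"
proof (induction n arbitrary: f g)
  case 0
  then show ?case by (auto intro: continuous_intros)
next
  case (Suc n)
  show ?case
    by (rule CnI[OF has_derivative_add[OF Cn_SucD(1)[OF Suc.prems(1)] Cn_SucD(1)[OF Suc.prems(2)]]])
       (rule Suc.IH[OF Cn_SucD(2)[OF Suc.prems(1)] Cn_SucD(2)[OF Suc.prems(2)]])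
qed

lemma Cn_mult: "Cn n f \<Longrightarrow> Cn n g \<Longrightarrow> Cn n (\<lambda>z. f z * g z)"
proof (induction n arbitrary: f g)
  case 0
  then show ?case by (auto intro: continuous_intros)
next
  case (Suc n)
  show ?case
    by (rule CnI[OF has_derivative_mult[OF Cn_SucD(1)[OF Suc.prems(1)] Cn_SucD(1)[OF Suc.prems(2)]]])
       (intro Cn_add Suc.IH Cn_SucD(2)[OF Suc.prems(1)] Cn_SucD(2)[OF Suc.prems(2)]
          Cn_SucD2[OF Suc.prems(1)] Cn_SucD2[OF Suc.prems(2)])
qed

lemma Cn_bounded_linear:
  assumes "bounded_linear f"
  shows "Cn n f"
proof (cases n)
  case 0
  then show ?thesis using assms by (simp add: linear_continuous_on)
next
  case (Suc m)
  show ?thesis unfolding Suc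
    by (rule CnI[OF bounded_linear_imp_has_derivative[OF assms]]) simp
qed

lemma Cn_id [simp]: "Cn n (\<lambda>z. z)" and Cn_cnj [simp]: "Cn n cnj" "Cn n (\<lambda>z. cnj z)"
  by (auto intro!: Cn_bounded_linear bounded_linear_ident bounded_linear_cnj)

lemma Cn_cmult: "Cn n f \<Longrightarrow> Cn n (\<lambda>z. c * f z)"
  by (intro Cn_mult Cn_const)

lemma Cn_uminus: "Cn n f \<Longrightarrow> Cn n (\<lambda>z. - f z)"
  using Cn_cmult[of n f "-1"] by simp

lemma Cn_diff: "Cn n f \<Longrightarrow> Cn n g \<Longrightarrow> Cn n (\<lambda>z. f z - g z)"
  using Cn_add[OF _ Cn_uminus] by fastforce

lemma Cn_power: "Cn n f \<Longrightarrow> Cn n (\<lambda>z. f z ^ k)"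
  by (induction k) (auto intro: Cn_mult)

lemma Cn_sum: "(\<And>i. i \<in> I \<Longrightarrow> Cn n (f i)) \<Longrightarrow> Cn n (\<lambda>z. \<Sum>i\<in>I. f i z)"
  by (induction I rule: infinite_finite_induct) (auto intro: Cn_add)

lemma Cn_inverse:
  assumes "Cn n f" "\<And>z. f z \<noteq> 0"
  shows "Cn n (\<lambda>z. inverse (f z))"
  using assms(1)
proof (induction n)
  case 0
  then show ?case using assms(2) by (auto intro: continuous_intros)
next
  case (Suc n)
  show ?case
    by (rule CnI[OF Deriv.has_derivative_inverse[OF assms(2) Cn_SucD(1)[OF Suc.prems]]])
       (intro Cn_uminus Cn_mult Suc.IH Cn_SucD(2)[OF Suc.prems] Cn_SucD2[OF Suc.prems])
qed

lemma Cn_divide: "Cn n f \<Longrightarrow> Cn n g \<Longrightarrow> (\<And>z. g z \<noteq> 0) \<Longrightarrow> Cn n (\<lambda>z. f z / g z)"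
  unfolding divide_inverse by (intro Cn_mult Cn_inverse)

lemma Cn_compose_mult: "Cn n f \<Longrightarrow> Cn n (\<lambda>z. f (c * z))"
proof (induction n arbitrary: f)
  case 0
  then have "continuous_on UNIV f" by simp
  then show ?case by (auto intro!: continuous_on_compose2[of UNIV f] continuous_intros)
next
  case (Suc n)
  show ?case
  proof (rule CnI)
    fix z
    show "((\<lambda>z. f (c * z)) has_derivative (\<lambda>v. Dv (c * v) f (c * z))) (at z)"
      by (rule has_derivative_compose[OF _ Cn_SucD(1)[OF Suc.prems]])
         (auto intro!: derivative_eq_intros)
    show "Cn n (\<lambda>z. Dv (c * v) f (c * z))" for v
      by (rule Suc.IH[OF Cn_SucD(2)[OF Suc.prems]])
  qed
qed

lemma smooth_Cn: "smooth f \<Longrightarrow> Cn n f"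
  by (simp add: smooth_def)

lemma smooth_Dv: "smooth f \<Longrightarrow> smooth (Dv v f)"
  unfolding smooth_def using Cn_SucD(2) by blast

lemma smooth_intros:
  "smooth (\<lambda>z. c)" "smooth (\<lambda>z. z)" "smooth (\<lambda>z. cnj z)"
  "smooth f \<Longrightarrow> smooth g \<Longrightarrow> smooth (\<lambda>z. f z + g z)"
  "smooth f \<Longrightarrow> smooth g \<Longrightarrow> smooth (\<lambda>z. f z - g z)"
  "smooth f \<Longrightarrow> smooth g \<Longrightarrow> smooth (\<lambda>z. f z * g z)"
  "smooth f \<Longrightarrow> smooth (\<lambda>z. f z ^ k)"
  "(\<And>i. i \<in> I \<Longrightarrow> smooth (h i)) \<Longrightarrow> smooth (\<lambda>z. \<Sum>i\<in>I. h i z)"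
  unfolding smooth_def by (auto intro: Cn_add Cn_diff Cn_mult Cn_power Cn_sum)

lemma bounded_linear_real_imag:
  fixes f :: "complex \<Rightarrow> complex"
  assumes "bounded_linear f"
  shows "f v = of_real (Re v) * f 1 + of_real (Im v) * f \<i>"
proof -
  interpret bounded_linear f by (rule assms)
  have "f v = f (Re v *\<^sub>R 1 + Im v *\<^sub>R \<i>)"
    by (rule arg_cong[of _ _ f]) (simp add: complex_eq_iff)
  then show ?thesis unfolding add scaleR by (simp add: scaleR_conv_of_real)
qed

lemma Cn_deriv_bounded_linear: "Cn (Suc n) f \<Longrightarrow> bounded_linear (\<lambda>v. Dv v f z)"
  by (rule has_derivative_bounded_linear[OF Cn_SucD(1)])

lemma Dv_scale:
  assumes "Cn (Suc n) f"
  shows "Dv (of_real x * v) f z = of_real x * Dv v f z"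
  using bounded_linear.linear[OF Cn_deriv_bounded_linear[OF assms], THEN linear_scale, of x v z]
  by (simp add: scaleR_conv_of_real)

lemma Cn_deriv_decomp:
  assumes "Cn (Suc n) f"
  shows "Dv v f z = of_real (Re v) * Dv 1 f z + of_real (Im v) * Dv \<i> f z"
  by (rule bounded_linear_real_imag[OF Cn_deriv_bounded_linear[OF assms]])

lemma norm_Dv_le:
  assumes "Cn (Suc n) f"
  shows "norm (Dv v f z) \<le> norm v * (norm (Dv 1 f z) + norm (Dv \<i> f z))"
proof -
  have "norm (Dv v f z) \<le> \<bar>Re v\<bar> * norm (Dv 1 f z) + \<bar>Im v\<bar> * norm (Dv \<i> f z)"
    unfolding Cn_deriv_decomp[OF assms, of v z] by (rule norm_triangle_le) (simp add: norm_mult)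
  also have "\<dots> \<le> norm v * norm (Dv 1 f z) + norm v * norm (Dv \<i> f z)"
    by (intro add_mono mult_right_mono abs_Re_le_cmod abs_Im_le_cmod) auto
  finally show ?thesis by (simp add: algebra_simps)
qed

text \<open>Real-linearity of the derivative reduces every direction to \<open>1\<close> and
  \<open>\<i>\<close>, the two directions that \<open>Dv_bounded\<close> controls.\<close>

lemma CnI2:
  assumes "\<And>z. (f has_derivative f' z) (at z)" "Cn n (\<lambda>z. f' z 1)" "Cn n (\<lambda>z. f' z \<i>)"
  shows "Cn (Suc n) f"
proof (rule CnI[OF assms(1)])
  fix v
  have "f' z v = of_real (Re v) * f' z 1 + of_real (Im v) * f' z \<i>" for z
    by (rule bounded_linear_real_imag[OF has_derivative_bounded_linear[OF assms(1)]])
  then show "Cn n (\<lambda>z. f' z v)"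
    using assms(2,3) by (auto intro!: Cn_add Cn_cmult)
qed

lemma bdd_supp_Dv:
  assumes "bdd_supp f"
  shows "bdd_supp (Dv v f)"
proof -
  from assms obtain R where R: "\<And>z. R < norm z \<Longrightarrow> f z = 0" by (auto simp: bdd_supp_def)
  have "Dv v f z = 0" if z: "R < norm z" for z
  proof -
    have "(f has_derivative (\<lambda>_. 0)) (at z)"
      by (rule has_derivative_transform_within_open[of "\<lambda>_. 0" _ _ _ "{z. R < norm z}"])
         (use R z in \<open>auto intro!: open_Collect_less continuous_intros\<close>)
    then show ?thesis by (simp add: Dv_eq)
  qed
  then show ?thesis unfolding bdd_supp_def by blast
qed

lemma bdd_supp_mult: "bdd_supp f \<Longrightarrow> bdd_supp (\<lambda>z. f z * g z)" "bdd_supp f \<Longrightarrow> bdd_supp (\<lambda>z. g z * f z)"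
  unfolding bdd_supp_def by fastforce+

lemma bdd_supp_bounded:
  assumes "bdd_supp f" "continuous_on UNIV f"
  shows "\<exists>B\<ge>0. \<forall>z. norm (f z) \<le> B"
proof -
  from assms obtain R where R: "\<And>z. R < norm z \<Longrightarrow> f z = 0" by (auto simp: bdd_supp_def)
  have "compact (f ` cball 0 R)"
    by (intro compact_continuous_image continuous_on_subset[OF assms(2)]) auto
  then obtain B where B: "\<And>z. z \<in> cball 0 R \<Longrightarrow> norm (f z) \<le> B"
    using compact_imp_bounded bounded_iff by (metis imageI)
  have "norm (f z) \<le> max 0 B" for z
    using R[of z] B[of z] by (cases "R < norm z") (auto simp: le_max_iff_disj)
  then show ?thesis by (intro exI[of _ "max 0 B"]) auto
qed

lemma Cinf_compact_iff: "f \<in> Cinf_compact \<longleftrightarrow> smooth f \<and> bdd_supp f"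
proof -
  have "compact (closure (support_on UNIV f)) \<longleftrightarrow> bdd_supp f"
  proof -
    have "bounded (support_on UNIV f) \<longleftrightarrow> bdd_supp f"
      unfolding bounded_iff bdd_supp_def support_on_def by (auto simp: not_less[symmetric])
    then show ?thesis by (simp add: compact_closure)
  qed
  then show ?thesis by (simp add: Cinf_compact_def smooth_def)
qed

text \<open>Dominated convergence applied to the remainder quotient along sequences.
  Differentiability and the bounds are asked only almost everywhere in \<open>u\<close>, because the
  convolution integrand is singular at two values of \<open>u\<close>. The parameter lives in a
  normed space so that it can be a point of the plane or a dilation factor.\<close>

lemma has_derivative_integral_dominated:
  fixes f :: "'a::real_normed_vector \<Rightarrow> 'b \<Rightarrow> complex"
  assumes d: "d > 0"
    and int: "\<And>x. x \<in> ball x0 d \<Longrightarrow> integrable M (f x)"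
    and der: "AE u in M. ((\<lambda>x. f x u) has_derivative (f' u)) (at x0)"
    and meas: "\<And>v. (\<lambda>u. f' u v) \<in> borel_measurable M"
    and w: "integrable M w"
    and Lip: "\<And>x. x \<in> ball x0 d \<Longrightarrow> AE u in M. norm (f x u - f x0 u) \<le> w u * norm (x - x0)"
    and bd: "\<And>v. AE u in M. norm (f' u v) \<le> w u * norm v"
  shows "((\<lambda>x. LINT u|M. f x u) has_derivative (\<lambda>v. LINT u|M. f' u v)) (at x0)"
proof -
  have int': "integrable M (\<lambda>u. f' u v)" for v
  proof (rule Bochner_Integration.integrable_bound[OF integrable_mult_left[OF w, of "norm v"]])
    show "AE u in M. norm (f' u v) \<le> norm (w u * norm v)"
      using bd[of v] by eventually_elim (unfold real_norm_def, erule order_trans[OF _ abs_ge_self])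
  qed (rule meas)
  have bl: "AE u in M. bounded_linear (f' u)"
    using der by eventually_elim (rule has_derivative_bounded_linear)
  have lin: "bounded_linear (\<lambda>v. LINT u|M. f' u v)"
  proof (rule bounded_linear_intro[where K = "LINT u|M. w u"])
    fix x y
    have "AE u in M. f' u (x + y) = f' u x + f' u y"
      using bl by eventually_elim (rule linear_simps)
    then have "(LINT u|M. f' u (x + y)) = (LINT u|M. f' u x + f' u y)"
      by (intro integral_cong_AE borel_measurable_add meas)
    then show "(LINT u|M. f' u (x + y)) = (LINT u|M. f' u x) + (LINT u|M. f' u y)"
      using int' by simp
  next
    fix r x
    have "AE u in M. f' u (r *\<^sub>R x) = r *\<^sub>R f' u x"
      using bl by eventually_elim (rule linear_simps)
    then have "(LINT u|M. f' u (r *\<^sub>R x)) = (LINT u|M. r *\<^sub>R f' u x)"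
      by (intro integral_cong_AE borel_measurable_scaleR borel_measurable_const meas)
    then show "(LINT u|M. f' u (r *\<^sub>R x)) = r *\<^sub>R (LINT u|M. f' u x)"
      by simp
  next
    fix x
    have "norm (LINT u|M. f' u x) \<le> (LINT u|M. w u * norm x)"
      by (rule order_trans[OF integral_norm_bound integral_mono_AE]) (use int' w bd in auto)
    then show "norm (LINT u|M. f' u x) \<le> norm x * (LINT u|M. w u)"
      by (simp add: mult.commute)
  qed
  show ?thesis
    unfolding has_derivative_at2
  proof (intro conjI lin)
    have "(\<lambda>y. (1 / norm (y - x0)) *\<^sub>R ((LINT u|M. f y u) - ((LINT u|M. f x0 u) + (LINT u|M. f' u (y - x0))))) \<midarrow>x0\<rightarrow> 0"
      unfolding tendsto_at_iff_sequentially comp_def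
    proof (intro allI impI)
      fix X assume X: "\<forall>i. X i \<in> UNIV - {x0}" "X \<longlonglongrightarrow> x0"
      then have "\<forall>\<^sub>F i in sequentially. X i \<in> ball x0 d"
        using d by (intro topological_tendstoD[OF X(2)]) auto
      then obtain N where N: "\<And>i. i \<ge> N \<Longrightarrow> X i \<in> ball x0 d"
        by (auto simp: eventually_sequentially)
      define Y where "Y i = X (i + N)" for i
      have Y: "Y i \<in> ball x0 d" "Y i \<noteq> x0" for i
        using N X by (auto simp: Y_def)
      have Ylim: "Y \<longlonglongrightarrow> x0" using X(2) unfolding Y_def by (rule LIMSEQ_ignore_initial_segment)
      \<comment> \<open>The dominating function is \<open>2 * w\<close>: one \<open>w\<close> from
        the Lipschitz bound, one from the bound on \<open>f'\<close>.\<close>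
      define q where "q i u = (1 / norm (Y i - x0)) *\<^sub>R (f (Y i) u - (f x0 u + f' u (Y i - x0)))" for i u
      have eq: "(1 / norm (Y i - x0)) *\<^sub>R ((LINT u|M. f (Y i) u) - ((LINT u|M. f x0 u) + (LINT u|M. f' u (Y i - x0))))
          = (LINT u|M. q i u)" for i
        unfolding q_def using int[OF Y(1)] int[of x0] d int' by simp
      have "(\<lambda>i. LINT u|M. q i u) \<longlonglongrightarrow> (LINT u|M. 0)"
      proof (rule integral_dominated_convergence[where w = "\<lambda>u. 2 * w u"])
        show "integrable M (\<lambda>u. 2 * w u)" using w by simp
        show "q i \<in> borel_measurable M" for i
          unfolding q_def using int[OF Y(1)] int[of x0] d int' by (auto intro!: borel_measurable_integrable)
        show "AE u in M. (\<lambda>i. q i u) \<longlonglongrightarrow> 0"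
          using der
        proof eventually_elim
          case (elim u)
          then have "(\<lambda>y. (1 / norm (y - x0)) *\<^sub>R (f y u - (f x0 u + f' u (y - x0)))) \<midarrow>x0\<rightarrow> 0"
            unfolding has_derivative_at2 by auto
          then show ?case
            using Y Ylim unfolding tendsto_at_iff_sequentially comp_def q_def by auto
        qed
        fix i
        show "AE u in M. norm (q i u) \<le> 2 * w u"
          using Lip[OF Y(1), of i] bd[of "Y i - x0"]
        proof eventually_elim
          case (elim u)
          have "norm (f (Y i) u - (f x0 u + f' u (Y i - x0))) \<le> 2 * w u * norm (Y i - x0)"
            using elim norm_triangle_ineq4[of "f (Y i) u - f x0 u" "f' u (Y i - x0)"]
            by (simp add: algebra_simps)
          then show ?case
            using Y(2)[of i] unfolding q_def norm_scaleR by (simp add: divide_le_eq)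
        qed
      qed simp
      then have "(\<lambda>i. (1 / norm (X (i+N) - x0)) *\<^sub>R ((LINT u|M. f (X (i+N)) u) - ((LINT u|M. f x0 u) + (LINT u|M. f' u (X (i+N) - x0))))) \<longlonglongrightarrow> 0"
        unfolding eq[symmetric] Y_def by simp
      then show "(\<lambda>i. (1 / norm (X i - x0)) *\<^sub>R ((LINT u|M. f (X i) u) - ((LINT u|M. f x0 u) + (LINT u|M. f' u (X i - x0))))) \<longlonglongrightarrow> 0"
        by (rule LIMSEQ_offset)
    qed
    then show "(\<lambda>y. (1 / norm (y - x0)) *\<^sub>R ((LINT u|M. f y u) - ((LINT u|M. f x0 u) + (LINT u|M. f' u (y - x0))))) \<midarrow>x0\<rightarrow> 0" .
  qed
qed

text \<open>Convolutions and weighted means along rays are both averages of \<open>f\<close> over affine maps.\<close>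

context
  fixes M :: "'u measure" and c :: "'u \<Rightarrow> real" and b :: "'u \<Rightarrow> complex"
  assumes cm: "c \<in> borel_measurable M" and bm: "b \<in> borel_measurable M"
    and c: "\<And>u. u \<in> space M \<Longrightarrow> \<bar>c u\<bar> \<le> 1"
begin

text \<open>Either only the bounded support of \<open>f\<close> matters, as for convolutions, or the
  arguments stay in a fixed ball because \<open>\<bar>c u\<bar> \<le> 1\<close> and \<open>b\<close>
  is bounded, as for means along rays.\<close>

lemma affine_args_bounded:
  fixes f :: "complex \<Rightarrow> complex"
  assumes f: "continuous_on UNIV f"
    and H: "bdd_supp f \<or> (\<exists>R. \<forall>u\<in>space M. norm (b u) \<le> R)"
  shows "\<exists>B\<ge>0. \<forall>z\<in>ball y 1. \<forall>u\<in>space M. norm (f (of_real (c u) * z + b u)) \<le> B"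
  using H
proof
  assume "bdd_supp f"
  then show ?thesis using bdd_supp_bounded[OF _ f] by blast
next
  assume "\<exists>R. \<forall>u\<in>space M. norm (b u) \<le> R"
  then obtain R where R: "\<And>u. u \<in> space M \<Longrightarrow> norm (b u) \<le> R" by blast
  let ?C = "cball (0::complex) (norm y + 1 + R)"
  have "compact (f ` ?C)"
    by (intro compact_continuous_image continuous_on_subset[OF f]) auto
  then obtain B where B: "\<And>z. z \<in> ?C \<Longrightarrow> norm (f z) \<le> B"
    using compact_imp_bounded bounded_iff by (metis imageI)
  have "norm (f (of_real (c u) * z + b u)) \<le> max 0 B" if z: "z \<in> ball y 1" and u: "u \<in> space M" for z u
  proof -
    have "norm z \<le> norm y + 1"
      using z norm_triangle_ineq2[of z y] by (simp add: dist_norm norm_minus_commute)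
    then have "\<bar>c u\<bar> * norm z \<le> norm y + 1"
      using c[OF u] mult_left_le_one_le[of "norm z" "\<bar>c u\<bar>"] by auto
    then have "norm (of_real (c u) * z + b u) \<le> norm y + 1 + R"
      using R[OF u] by (intro norm_triangle_le) (auto simp: norm_mult)
    then show ?thesis using B[of "of_real (c u) * z + b u"] by (simp add: le_max_iff_disj)
  qed
  then show ?thesis by (intro exI[of _ "max 0 B"]) auto
qed

lemma continuous_measurable_compose:
  fixes f :: "complex \<Rightarrow> complex"
  shows "continuous_on UNIV f \<Longrightarrow> g \<in> borel_measurable M \<Longrightarrow> (\<lambda>u. f (g u)) \<in> borel_measurable M"
  using borel_measurable_continuous_onI measurable_compose by blast

lemma affine_mean_integrable:
  assumes f: "continuous_on UNIV f" and a: "integrable M a"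
    and H: "bdd_supp f \<or> (\<exists>R. \<forall>u\<in>space M. norm (b u) \<le> R)"
  shows "integrable M (\<lambda>u. a u * f (of_real (c u) * z + b u))"
proof -
  obtain B where B: "\<And>u. u \<in> space M \<Longrightarrow> norm (f (of_real (c u) * z + b u)) \<le> B" 
    using affine_args_bounded[of f z, OF f H] by (metis centre_in_ball zero_less_one)
  show ?thesis
  proof (rule Bochner_Integration.integrable_bound[where f = "\<lambda>u. norm (a u) * B"])
    show "integrable M (\<lambda>u. norm (a u) * B)" using a by simp
    show "(\<lambda>u. a u * f (of_real (c u) * z + b u)) \<in> borel_measurable M"
      using a cm bm by (intro borel_measurable_times continuous_measurable_compose[OF f] borel_measurable_add
          borel_measurable_const measurable_compose[OF cm borel_measurable_of_real]) auto
    show "AE u in M. norm (a u * f (of_real (c u) * z + b u)) \<le> norm (norm (a u) * B)"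
      using B by (intro AE_I2) (auto simp: norm_mult abs_mult intro!: mult_left_mono order_trans[OF B])
  qed
qed

lemma affine_mean_has_derivative:
  assumes f: "Cn (Suc 0) f" and a: "integrable M a"
    and H: "bdd_supp f \<or> (\<exists>R. \<forall>u\<in>space M. norm (b u) \<le> R)"
  shows "((\<lambda>z. LINT u|M. a u * f (of_real (c u) * z + b u)) has_derivative
          (\<lambda>v. LINT u|M. (a u * of_real (c u)) * Dv v f (of_real (c u) * z0 + b u))) (at z0)"
proof -
  have fc: "continuous_on UNIV f" using Cn_continuous[OF f] .
  have Dc: "continuous_on UNIV (Dv v f)" for v using Cn_SucD(2)[OF f] by simp
  have H': "bdd_supp (Dv v f) \<or> (\<exists>R. \<forall>u\<in>space M. norm (b u) \<le> R)" for v
    using H bdd_supp_Dv by blast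
  obtain B1 where B1: "B1 \<ge> 0" "\<And>z u. z \<in> ball z0 1 \<Longrightarrow> u \<in> space M \<Longrightarrow> norm (Dv 1 f (of_real (c u) * z + b u)) \<le> B1"
    using affine_args_bounded[of "Dv 1 f" z0, OF Dc H'] by metis
  obtain B2 where B2: "B2 \<ge> 0" "\<And>z u. z \<in> ball z0 1 \<Longrightarrow> u \<in> space M \<Longrightarrow> norm (Dv \<i> f (of_real (c u) * z + b u)) \<le> B2"
    using affine_args_bounded[of "Dv \<i> f" z0, OF Dc H'] by metis
  define B where "B = B1 + B2"
  have B0: "B \<ge> 0" using B1 B2 by (simp add: B_def)
  have B: "norm (of_real (c u) * Dv v f (of_real (c u) * z + b u)) \<le> B * norm v" if "z \<in> ball z0 1" "u \<in> space M" for z u v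
  proof -
    have "norm (Dv v f (of_real (c u) * z + b u)) \<le> norm v * B"
      by (rule order_trans[OF norm_Dv_le[OF f] mult_left_mono]) (use B1(2)[OF that] B2(2)[OF that] in \<open>auto simp: B_def\<close>)
    then have "\<bar>c u\<bar> * norm (Dv v f (of_real (c u) * z + b u)) \<le> 1 * (norm v * B)"
      using c[OF that(2)] by (intro mult_mono) auto
    then show ?thesis by (simp add: norm_mult mult.commute)
  qed
  have der: "((\<lambda>z. f (of_real (c u) * z + b u)) has_derivative (\<lambda>v. of_real (c u) * Dv v f (of_real (c u) * z + b u))) (at z)" for u z
  proof -
    have "((\<lambda>z. f (of_real (c u) * z + b u)) has_derivative (\<lambda>v. Dv (of_real (c u) * v) f (of_real (c u) * z + b u))) (at z)"
      by (rule has_derivative_compose[OF _ Cn_SucD(1)[OF f]]) (auto intro!: derivative_eq_intros)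
    then show ?thesis by (simp only: Dv_scale[OF f])
  qed
  show ?thesis
  proof (rule has_derivative_integral_dominated[where d = 1 and w = "\<lambda>u. norm (a u) * B"])
    show "integrable M (\<lambda>u. a u * f (of_real (c u) * z + b u))" for z
      by (rule affine_mean_integrable[OF fc a H])
    show "AE u in M. ((\<lambda>z. a u * f (of_real (c u) * z + b u)) has_derivative
       (\<lambda>v. a u * of_real (c u) * Dv v f (of_real (c u) * z0 + b u))) (at z0)"
      using has_derivative_mult_right[OF der] by (intro AE_I2) (simp add: mult.assoc)
    show "(\<lambda>u. a u * of_real (c u) * Dv v f (of_real (c u) * z0 + b u)) \<in> borel_measurable M" for v
      using a cm bm by (intro borel_measurable_times continuous_measurable_compose[OF Dc] borel_measurable_add
          borel_measurable_const measurable_compose[OF cm borel_measurable_of_real]) auto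
    show "integrable M (\<lambda>u. norm (a u) * B)" using a by simp
    show "AE u in M. norm (a u * of_real (c u) * Dv v f (of_real (c u) * z0 + b u)) \<le> norm (a u) * B * norm v" for v
      using B by (intro AE_I2) (auto simp: norm_mult mult.assoc intro!: mult_left_mono)
    fix z assume z: "z \<in> ball z0 (1::real)"
    show "AE u in M. norm (a u * f (of_real (c u) * z + b u) - a u * f (of_real (c u) * z0 + b u)) \<le> norm (a u) * B * norm (z - z0)"
    proof (intro AE_I2)
      fix u assume u: "u \<in> space M"
      have "norm (f (of_real (c u) * z + b u) - f (of_real (c u) * z0 + b u)) \<le> B * norm (z - z0)"
        by (rule differentiable_bound[of "ball z0 1" "\<lambda>z. f (of_real (c u) * z + b u)"])
           (use z B0 B u in \<open>auto intro!: has_derivative_at_withinI[OF der] onorm_bound\<close>)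
      then show "norm (a u * f (of_real (c u) * z + b u) - a u * f (of_real (c u) * z0 + b u)) \<le> norm (a u) * B * norm (z - z0)"
        by (simp add: norm_mult right_diff_distrib[symmetric] mult.assoc mult_left_mono)
    qed
  qed simp
qed

text \<open>A derivative turns the weight \<open>a\<close> into \<open>a * c\<close> and
  \<open>f\<close> into \<open>Dv v f\<close>, again a mean of the same kind; hence the induction
  generalises over both.\<close>

lemma Cn_affine_mean:
  assumes "Cn n f" "integrable M a"
    and "bdd_supp f \<or> (\<exists>R. \<forall>u\<in>space M. norm (b u) \<le> R)"
  shows "Cn n (\<lambda>z. LINT u|M. a u * f (of_real (c u) * z + b u))"
  using assms
proof (induction n arbitrary: f a)
  case 0
  have fc: "continuous_on UNIV f" using 0 by simp
  have "isCont (\<lambda>z. LINT u|M. a u * f (of_real (c u) * z + b u)) z0" for z0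
  proof -
    obtain B where B: "B \<ge> 0" "\<And>z u. z \<in> ball z0 1 \<Longrightarrow> u \<in> space M \<Longrightarrow> norm (f (of_real (c u) * z + b u)) \<le> B"
      using affine_args_bounded[of f z0, OF fc 0(3)] by metis
    show ?thesis
      unfolding continuous_at_sequentially comp_def
    proof (intro allI impI)
      fix X assume X: "X \<longlonglongrightarrow> z0"
      then have "\<forall>\<^sub>F i in sequentially. X i \<in> ball z0 1"
        by (intro topological_tendstoD) auto
      then obtain N where N: "\<And>i. i \<ge> N \<Longrightarrow> X i \<in> ball z0 1"
        by (auto simp: eventually_sequentially)
      have X': "(\<lambda>i. X (i + N)) \<longlonglongrightarrow> z0" by (rule LIMSEQ_ignore_initial_segment[OF X])
      have "(\<lambda>i. LINT u|M. a u * f (of_real (c u) * X (i + N) + b u)) \<longlonglongrightarrow> (LINT u|M. a u * f (of_real (c u) * z0 + b u))"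
      proof (rule integral_dominated_convergence[where w = "\<lambda>u. norm (a u) * B"])
        show "integrable M (\<lambda>u. norm (a u) * B)" using 0 by simp
        show "(\<lambda>u. a u * f (of_real (c u) * z0 + b u)) \<in> borel_measurable M"
          "\<And>i. (\<lambda>u. a u * f (of_real (c u) * X (i + N) + b u)) \<in> borel_measurable M"
          by (intro borel_measurable_integrable affine_mean_integrable[OF fc 0(2) 0(3)]; simp)+
        show "AE u in M. (\<lambda>i. a u * f (of_real (c u) * X (i + N) + b u)) \<longlonglongrightarrow> a u * f (of_real (c u) * z0 + b u)"
          using fc X' by (intro AE_I2 tendsto_intros continuous_on_tendsto_compose[OF fc]) auto
        show "AE u in M. norm (a u * f (of_real (c u) * X (i + N) + b u)) \<le> norm (a u) * B" for i
          using B N by (intro AE_I2) (auto simp: norm_mult intro!: mult_left_mono)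
      qed
      then show "(\<lambda>i. LINT u|M. a u * f (of_real (c u) * X i + b u)) \<longlonglongrightarrow> (LINT u|M. a u * f (of_real (c u) * z0 + b u))"
        by (rule LIMSEQ_offset)
    qed
  qed
  then show ?case by (simp add: continuous_on_eq_continuous_at)
next
  case (Suc n)
  have f1: "Cn (Suc 0) f" by (rule Cn_mono[OF Suc.prems(1)]) simp
  show ?case
  proof (rule CnI[OF affine_mean_has_derivative[OF f1 Suc.prems(2) Suc.prems(3)]])
    fix v
    show "Cn n (\<lambda>z. LINT u|M. a u * complex_of_real (c u) * Dv v f (complex_of_real (c u) * z + b u))"
    proof (rule Suc.IH[OF Cn_SucD(2)[OF Suc.prems(1)]])
      show "bdd_supp (Dv v f) \<or> (\<exists>R. \<forall>u\<in>space M. norm (b u) \<le> R)" using Suc.prems(3) bdd_supp_Dv by blast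
      show "integrable M (\<lambda>u. a u * complex_of_real (c u))"
      proof (rule Bochner_Integration.integrable_bound[OF integrable_norm[OF Suc.prems(2)]])
        show "(\<lambda>u. a u * complex_of_real (c u)) \<in> borel_measurable M"
          using Suc.prems(2) cm by (intro borel_measurable_times measurable_compose[OF cm borel_measurable_of_real]) auto
        show "AE u in M. norm (a u * complex_of_real (c u)) \<le> norm (norm (a u))"
          using c by (intro AE_I2) (auto simp: norm_mult intro: mult_right_le_one_le)
      qed
    qed
  qed
qed

end

section \<open>The model singularities and a smooth cutoff\<close>

text \<open>The integer exponents are kept apart from \<alpha> so that the family is stable under
  both Wirtinger derivatives (up to linear combinations) and under multiplication by monomials.
  Since \<open>0 powr x = 0\<close>, the value at the origin is 0 even when all exponents
  vanish.\<close>

definition K :: "nat \<Rightarrow> nat \<Rightarrow> real \<Rightarrow> nat \<Rightarrow> complex \<Rightarrow> complex" where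
  "K a b \<alpha> j z = z ^ a * cnj z ^ b * of_real (cmod z powr (2 * \<alpha>) * ln ((cmod z)\<^sup>2) ^ j)"

text \<open>The factors \<open>1 / z\<close> and \<open>1 / cnj z\<close> of the derivative are
  rewritten with \<open>|z|^2\<close> in the denominator: one integer exponent rises, \<alpha> falls
  by 1, and the degree \<open>a + b + 2\<alpha>\<close> drops by exactly 1. For \<open>j = 0\<close>
  the truncated \<open>j - 1\<close> is neutralised by the factor \<open>of_nat j\<close>.\<close>

definition dK :: "nat \<Rightarrow> nat \<Rightarrow> real \<Rightarrow> nat \<Rightarrow> complex \<Rightarrow> complex \<Rightarrow> complex" where
  "dK a b \<alpha> j z v =
     v * (of_real (a + \<alpha>) * K a (b + 1) (\<alpha> - 1) j z + of_nat j * K a (b + 1) (\<alpha> - 1) (j - 1) z)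
   + cnj v * (of_real (b + \<alpha>) * K (a + 1) b (\<alpha> - 1) j z + of_nat j * K (a + 1) b (\<alpha> - 1) (j - 1) z)"

lemma K_0 [simp]: "K a b \<alpha> j 0 = 0"
  by (simp add: K_def)

lemma K_mult_monom: "z ^ p * cnj z ^ q * K a b \<alpha> j z = K (a + p) (b + q) \<alpha> j z"
  by (simp add: K_def power_add)

lemma K_eqv: "cmod \<omega> = 1 \<Longrightarrow> K a b \<alpha> j (\<omega> * z) = \<omega> ^ a * cnj \<omega> ^ b * K a b \<alpha> j z"
  by (simp add: K_def norm_mult power_mult_distrib)

lemma powr_minus_two: "x \<noteq> 0 \<Longrightarrow> cmod x powr (2 * (\<alpha> - 1)) = cmod x powr (2 * \<alpha>) / (cmod x)\<^sup>2"
  by (simp add: right_diff_distrib powr_diff)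

lemma norm_sq_cnj: "complex_of_real ((cmod z)\<^sup>2) = z * cnj z"
  using complex_norm_square by simp

lemma z_mult_dK:
  "z * K a (b + 1) (\<alpha> - 1) j z = K a b \<alpha> j z" "cnj z * K (a + 1) b (\<alpha> - 1) j z = K a b \<alpha> j z"
proof -
  have "z * K a (b + 1) (\<alpha> - 1) j z = K a b \<alpha> j z \<and> cnj z * K (a + 1) b (\<alpha> - 1) j z = K a b \<alpha> j z"
  proof (cases "z = 0")
    case False
    have "complex_of_real (cmod z powr (2 * \<alpha>)) = z * cnj z * of_real (cmod z powr (2 * (\<alpha> - 1)))"
      using False unfolding norm_sq_cnj[symmetric] of_real_mult[symmetric] powr_minus_two[OF False] by simp
    then show ?thesis by (simp add: K_def)
  qed simp
  then show "z * K a (b + 1) (\<alpha> - 1) j z = K a b \<alpha> j z" "cnj z * K (a + 1) b (\<alpha> - 1) j z = K a b \<alpha> j z"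
    by auto
qed

text \<open>Euler's relation for degree \<open>a + b + 2\<alpha>\<close>; the factor 2 is the radial
  derivative of log |z|^2.\<close>

lemma dK_radial: "dK a b \<alpha> j z z = of_real (a + b + 2 * \<alpha>) * K a b \<alpha> j z + 2 * of_nat j * K a b \<alpha> (j - 1) z"
proof -
  have "dK a b \<alpha> j z z = of_real (a + \<alpha>) * (z * K a (b + 1) (\<alpha> - 1) j z) + of_nat j * (z * K a (b + 1) (\<alpha> - 1) (j - 1) z)
     + of_real (b + \<alpha>) * (cnj z * K (a + 1) b (\<alpha> - 1) j z) + of_nat j * (cnj z * K (a + 1) b (\<alpha> - 1) (j - 1) z)"
    unfolding dK_def by (simp only: algebra_simps)
  then show ?thesis
    unfolding z_mult_dK by (simp add: algebra_simps)
qed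

lemma has_derivative_power_nz:
  assumes "(z::complex) \<noteq> 0"
  shows "((\<lambda>z. z ^ a) has_derivative (\<lambda>v. of_nat a * z ^ a * (v / z))) (at z)"
proof -
  have "((\<lambda>z. z ^ a) has_derivative (\<lambda>v. of_nat a * v * z ^ (a - 1))) (at z)"
    by (auto intro!: derivative_eq_intros)
  moreover have "of_nat a * v * z ^ (a - 1) = of_nat a * z ^ a * (v / z)" for v
    using assms by (cases a) auto
  ultimately show ?thesis by simp
qed

lemma has_derivative_ln_cmod_sq:
  assumes "z \<noteq> 0"
  shows "((\<lambda>z. complex_of_real (ln ((cmod z)\<^sup>2))) has_derivative (\<lambda>v. v / z + cnj v / cnj z)) (at z)"
proof -
  have "((\<lambda>z. ln (z \<bullet> z)) has_derivative (\<lambda>v. (z \<bullet> v + v \<bullet> z) * inverse (z \<bullet> z))) (at z)"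
    using assms by (auto intro!: derivative_eq_intros simp: divide_inverse)
  then have "((\<lambda>z. complex_of_real (ln ((cmod z)\<^sup>2))) has_derivative (\<lambda>v. complex_of_real ((z \<bullet> v + v \<bullet> z) * inverse (z \<bullet> z)))) (at z)"
    unfolding power2_norm_eq_inner by (rule has_derivative_of_real)
  moreover have "complex_of_real ((z \<bullet> v + v \<bullet> z) * inverse (z \<bullet> z)) = v / z + cnj v / cnj z" for v
  proof -
    have "complex_of_real (z \<bullet> v + v \<bullet> z) = v * cnj z + cnj v * z"
      by (simp add: complex_eq_iff inner_complex_def algebra_simps)
    moreover have "complex_of_real (z \<bullet> z) = z * cnj z"
      by (simp flip: power2_norm_eq_inner norm_sq_cnj)
    ultimately show ?thesis using assms by (simp add: field_simps)
  qed
  ultimately show ?thesis by simp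
qed

lemma K_has_derivative:
  assumes "z \<noteq> 0"
  shows "(K a b \<alpha> j has_derivative dK a b \<alpha> j z) (at z)"
proof -
  let ?L = "\<lambda>z. complex_of_real (ln ((cmod z)\<^sup>2))"
  let ?l = "\<lambda>v. v / z + cnj v / cnj z"
  let ?G = "\<lambda>z. z ^ a * cnj z ^ b * (exp (of_real \<alpha> * ?L z) * ?L z ^ j)"
  have K_eq': "K a b \<alpha> i y = y ^ a * cnj y ^ b * (exp (of_real \<alpha> * ?L y) * ?L y ^ i)" if "y \<noteq> 0" for y i
  proof -
    have "cmod y powr (2 * \<alpha>) = exp (\<alpha> * ln ((cmod y)\<^sup>2))"
      using that by (simp add: powr_def ln_realpow)
    then have "complex_of_real (cmod y powr (2 * \<alpha>)) = exp (of_real \<alpha> * ?L y)"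
      by (metis exp_of_real of_real_mult)
    then show ?thesis by (simp add: K_def)
  qed
  note K_eq = K_eq'[of _ j]
  have d2: "((\<lambda>z. cnj z ^ b) has_derivative (\<lambda>v. of_nat b * cnj z ^ b * (cnj v / cnj z))) (at z)"
    using has_derivative_compose[OF bounded_linear_imp_has_derivative[OF bounded_linear_cnj] has_derivative_power_nz[of "cnj z" b]] assms by simp
  have d3: "((\<lambda>z. exp (of_real \<alpha> * ?L z)) has_derivative (\<lambda>v. of_real \<alpha> * ?l v * exp (of_real \<alpha> * ?L z))) (at z)"
  proof -
    have "((\<lambda>z. of_real \<alpha> * ?L z) has_derivative (\<lambda>v. of_real \<alpha> * ?l v)) (at z)"
      by (rule has_derivative_mult_right[OF has_derivative_ln_cmod_sq[OF assms]])
    from has_derivative_compose[OF this DERIV_exp[unfolded has_field_derivative_def]]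
    show ?thesis by (simp add: mult_ac)
  qed
  have d4: "((\<lambda>z. ?L z ^ j) has_derivative (\<lambda>v. of_nat j * ?l v * ?L z ^ (j - 1))) (at z)"
    by (rule has_derivative_power[OF has_derivative_ln_cmod_sq[OF assms]])
  note D = has_derivative_mult[OF has_derivative_mult[OF has_derivative_power_nz[OF assms, of a] d2] has_derivative_mult[OF d3 d4]]
  let ?m = "z ^ a * cnj z ^ b" and ?e = "exp (of_real \<alpha> * ?L z)"
  let ?F = "\<lambda>v. ?m * (?e * (of_nat j * ?l v * ?L z ^ (j - 1)) + (of_real \<alpha> * ?l v * ?e) * ?L z ^ j)
      + (z ^ a * (of_nat b * cnj z ^ b * (cnj v / cnj z)) + (of_nat a * z ^ a * (v / z)) * cnj z ^ b) * (?e * ?L z ^ j)"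
  have "(K a b \<alpha> j has_derivative ?F) (at z)"
    by (rule has_derivative_transform_within_open[OF D, of "-{0}"]) (use assms K_eq in auto)
  also have "?F = dK a b \<alpha> j z"
  proof
    fix v
    have "?F v = v / z * (of_real (a + \<alpha>) * (?m * (?e * ?L z ^ j)) + of_nat j * (?m * (?e * ?L z ^ (j - 1))))
        + cnj v / cnj z * (of_real (b + \<alpha>) * (?m * (?e * ?L z ^ j)) + of_nat j * (?m * (?e * ?L z ^ (j - 1))))"
      by (simp add: algebra_simps)
    also have "\<dots> = v / z * (of_real (a + \<alpha>) * (z * K a (b + 1) (\<alpha> - 1) j z) + of_nat j * (z * K a (b + 1) (\<alpha> - 1) (j - 1) z))
        + cnj v / cnj z * (of_real (b + \<alpha>) * (cnj z * K (a + 1) b (\<alpha> - 1) j z) + of_nat j * (cnj z * K (a + 1) b (\<alpha> - 1) (j - 1) z))"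
      unfolding z_mult_dK K_eq'[OF assms] ..
    also have "\<dots> = dK a b \<alpha> j z v"
      unfolding dK_def using assms by (simp add: field_simps)
    finally show "?F v = dK a b \<alpha> j z v" .
  qed
  finally show ?thesis .
qed

lemma K_bound:
  assumes "d < real a + real b + 2 * \<alpha>"
  shows "\<exists>C\<ge>0. \<forall>z. cmod z \<le> 1 \<longrightarrow> norm (K a b \<alpha> j z) \<le> C * cmod z powr d"
proof -
  \<comment> \<open>The logarithms cost a factor \<open>r powr (- 2 * e * j)\<close>; this
    \<open>e\<close> keeps \<open>2 * e * j\<close> within the margin
    \<open>a + b + 2\<alpha> - d\<close>, and \<open>j + 1\<close> makes the choice valid for
    \<open>j = 0\<close>.\<close>
  define e where "e = (a + b + 2 * \<alpha> - d) / (2 * (real j + 1))"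
  have e: "e > 0" using assms by (simp add: e_def)
  have ed: "real a + real b + 2 * \<alpha> - 2 * e * j \<ge> d"
  proof -
    have "2 * e * j = (a + b + 2 * \<alpha> - d) * (j / (real j + 1))"
      unfolding e_def by (simp add: divide_simps) (simp add: algebra_simps)?
    also have "\<dots> \<le> (a + b + 2 * \<alpha> - d) * 1"
      using assms by (intro mult_left_mono) auto
    finally show ?thesis by simp
  qed
  have "norm (K a b \<alpha> j z) \<le> (1 / e) ^ j * cmod z powr d" if z: "cmod z \<le> 1" for z
  proof (cases "z = 0")
    case False
    define r where "r = cmod z"
    have r: "0 < r" "r \<le> 1" using False z by (auto simp: r_def)
    have "ln (1 / r\<^sup>2) \<le> (1 / r\<^sup>2) powr e / e"
      using r e by (intro ln_powr_bound) (auto simp: power_le_one)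
    also have "(1 / r\<^sup>2) powr e = r powr (- 2 * e)"
      using r by (simp add: powr_def ln_div ln_realpow)
    finally have ln: "\<bar>ln (r\<^sup>2)\<bar> \<le> r powr (- 2 * e) / e"
      using r by (simp add: ln_div ln_realpow)
    have "norm (K a b \<alpha> j z) = r powr (a + b + 2 * \<alpha>) * \<bar>ln (r\<^sup>2)\<bar> ^ j"
      using r by (simp add: K_def norm_mult norm_power r_def[symmetric] powr_add powr_realpow power_abs abs_mult)
    also have "\<dots> \<le> r powr (a + b + 2 * \<alpha>) * (r powr (- 2 * e) / e) ^ j"
      by (intro mult_left_mono power_mono ln) auto
    also have "(r powr (- 2 * e) / e) ^ j = r powr (- 2 * e * j) * (1 / e) ^ j"
      using powr_realpow[of "r powr (- 2 * e)" j] r by (simp add: power_divide powr_powr)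
    also have "r powr (a + b + 2 * \<alpha>) * (r powr (- 2 * e * j) * (1 / e) ^ j)
        = (1 / e) ^ j * r powr (real a + real b + 2 * \<alpha> - 2 * e * j)"
      using r by (simp add: powr_add powr_diff powr_minus field_simps)
    also have "\<dots> \<le> (1 / e) ^ j * r powr d"
      using r e ed by (intro mult_left_mono powr_mono') auto
    finally show ?thesis by (simp add: r_def)
  qed simp
  then show ?thesis using e by (intro exI[of _ "(1 / e) ^ j"]) auto
qed

lemma powr_cmod_tendsto_0: "d > 0 \<Longrightarrow> ((\<lambda>z. C * cmod z powr d) \<longlongrightarrow> 0) (at 0)"
  by (intro tendsto_mult_right_zero tendsto_zero_powrI[where b = d] tendsto_norm_zero tendsto_const) (auto simp: tendsto_ident_at)

lemma eventually_cmod_le_1: "\<forall>\<^sub>F z::complex in at 0. cmod z \<le> 1"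
  unfolding eventually_at by (rule exI[of _ 1]) (auto simp: dist_norm)

lemma K_continuous:
  assumes "0 < real a + real b + 2 * \<alpha>"
  shows "continuous_on UNIV (K a b \<alpha> j)"
proof -
  have "isCont (K a b \<alpha> j) z" for z
  proof (cases "z = 0")
    case True
    obtain C where C: "\<And>z. cmod z \<le> 1 \<Longrightarrow> norm (K a b \<alpha> j z) \<le> C * cmod z powr ((a + b + 2 * \<alpha>) / 2)"
      using K_bound[of "(a + b + 2 * \<alpha>) / 2" a b \<alpha> j] assms by auto
    have "(K a b \<alpha> j \<longlongrightarrow> 0) (at 0)"
      by (rule Lim_null_comparison[OF _ powr_cmod_tendsto_0[of "(a + b + 2 * \<alpha>) / 2" C]])
         (use C assms in \<open>auto intro!: eventually_mono[OF eventually_cmod_le_1]\<close>)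
    then show ?thesis using True by (simp add: isCont_def)
  next
    case False
    then show ?thesis using K_has_derivative has_derivative_continuous by blast
  qed
  then show ?thesis by (simp add: continuous_on_eq_continuous_at)
qed

text \<open>Degree above 1 makes \<open>K\<close> of order o(|z|) at the origin, so the derivative
  there is 0, and so is \<open>dK\<close>.\<close>

lemma K_has_derivative_all:
  assumes "1 < real a + real b + 2 * \<alpha>"
  shows "(K a b \<alpha> j has_derivative dK a b \<alpha> j z) (at z)"
proof (cases "z = 0")
  case True
  define d where "d = (a + b + 2 * \<alpha> + 1) / 2"
  have d: "d > 1" "d < real a + real b + 2 * \<alpha>" using assms by (auto simp: d_def)
  obtain C where C: "\<And>z. cmod z \<le> 1 \<Longrightarrow> norm (K a b \<alpha> j z) \<le> C * cmod z powr d"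
    using K_bound[OF d(2)] by auto
  have "((\<lambda>z. norm (K a b \<alpha> j z) / norm z) \<longlongrightarrow> 0) (at 0)"
  proof (rule Lim_null_comparison[OF _ powr_cmod_tendsto_0[of "d - 1" C]])
    show "\<forall>\<^sub>F z in at 0. norm (norm (K a b \<alpha> j z) / norm z) \<le> C * cmod z powr (d - 1)"
      using eventually_cmod_le_1 eventually_neq_at_within[of 0 0 UNIV]
    proof eventually_elim
      case (elim z)
      then show ?case using C[of z] by (simp add: powr_diff field_simps)
    qed
  qed (use d in simp)
  then have "(K a b \<alpha> j has_derivative (\<lambda>_. 0)) (at 0)"
    by (simp add: has_derivative_iff_norm)
  moreover have "dK a b \<alpha> j 0 = (\<lambda>_. 0)" by (auto simp: dK_def)
  ultimately show ?thesis using True by simp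
qed (rule K_has_derivative)

text \<open>Every derivative costs one unit of degree, and positive degree gives continuity.\<close>

lemma Cn_K: "real n < a + b + 2 * \<alpha> \<Longrightarrow> Cn n (K a b \<alpha> j)"
proof (induction n arbitrary: a b \<alpha> j)
  case 0
  then show ?case using K_continuous by simp
next
  case (Suc n)
  show ?case
  proof (rule CnI[OF K_has_derivative_all])
    show "Cn n (\<lambda>z. dK a b \<alpha> j z v)" for v
      unfolding dK_def using Suc.prems by (intro Cn_add Cn_cmult Suc.IH) auto
  qed (use Suc.prems in simp)
qed

lemma Dv_vanish_ball:
  assumes "\<And>z. cmod z < r \<Longrightarrow> \<phi> z = 0" "cmod z < r"
  shows "Dv v \<phi> z = 0"
proof -
  have "(\<phi> has_derivative (\<lambda>_. 0)) (at z)"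
    by (rule has_derivative_transform_within_open[of "\<lambda>_. 0" _ _ _ "{z. cmod z < r}"])
       (use assms in \<open>auto intro!: open_Collect_less continuous_intros\<close>)
  then show ?thesis by (simp add: Dv_eq)
qed

text \<open>The exponents are unrestricted because the product is zero near the origin. Derivatives
  of \<open>\<phi>\<close> vanish on the same ball, so such products stay in their class when
  differentiated.\<close>

lemma Cn_vanish_mult_K:
  assumes "smooth \<phi>" "r > 0" "\<And>z. cmod z < r \<Longrightarrow> \<phi> z = 0"
  shows "Cn n (\<lambda>z. \<phi> z * K a b \<alpha> j z)"
  using assms(1,3)
proof (induction n arbitrary: \<phi> a b \<alpha> j)
  have D: "((\<lambda>z. \<phi> z * K a b \<alpha> j z) has_derivative (\<lambda>v. \<phi> z * dK a b \<alpha> j z v + Dv v \<phi> z * K a b \<alpha> j z)) (at z)"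
    if "smooth \<phi>" "\<And>z. cmod z < r \<Longrightarrow> \<phi> z = 0" for \<phi> a b \<alpha> j z
  proof (cases "z = 0")
    case True
    have "((\<lambda>z. \<phi> z * K a b \<alpha> j z) has_derivative (\<lambda>_. 0)) (at 0)"
      by (rule has_derivative_transform_within_open[of "\<lambda>_. 0" _ _ _ "{z. cmod z < r}"])
         (use that \<open>r > 0\<close> in \<open>auto intro!: open_Collect_less continuous_intros\<close>)
    then show ?thesis using True that(2)[of 0] \<open>r > 0\<close> by simp
  next
    case False
    show ?thesis
      by (rule has_derivative_mult[OF Cn_SucD(1)[OF smooth_Cn[OF that(1), of "Suc 0"]] K_has_derivative[OF False]])
  qed
  {
    case 0
    show ?case
      using has_derivative_continuous[OF D[OF 0]] by (auto simp: continuous_on_eq_continuous_at)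
  next
    case (Suc n)
    show ?case
    proof (rule CnI[OF D[OF Suc.prems]])
      fix v
      have "Cn n (\<lambda>z. \<phi> z * K a b \<alpha> j z)" for a b \<alpha> j by (rule Suc.IH[OF Suc.prems])
      moreover have "Cn n (\<lambda>z. Dv v \<phi> z * K a b \<alpha> j z)"
        using Suc.prems by (intro Suc.IH smooth_Dv Dv_vanish_ball)
      moreover have "(\<lambda>z. \<phi> z * dK a b \<alpha> j z v + Dv v \<phi> z * K a b \<alpha> j z) = (\<lambda>z.
         v * (of_real (a + \<alpha>) * (\<phi> z * K a (b + 1) (\<alpha> - 1) j z) + of_nat j * (\<phi> z * K a (b + 1) (\<alpha> - 1) (j - 1) z))
         + cnj v * (of_real (b + \<alpha>) * (\<phi> z * K (a + 1) b (\<alpha> - 1) j z) + of_nat j * (\<phi> z * K (a + 1) b (\<alpha> - 1) (j - 1) z))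
         + Dv v \<phi> z * K a b \<alpha> j z)"
        by (auto simp: dK_def algebra_simps)
      ultimately show "Cn n (\<lambda>z. \<phi> z * dK a b \<alpha> j z v + Dv v \<phi> z * K a b \<alpha> j z)"
        by (simp only:) (intro Cn_add Cn_cmult)
    qed
  }
qed

text \<open>This family is closed under differentiation up to linear combinations.\<close>

definition flat_exp :: "nat \<Rightarrow> real \<Rightarrow> real" where
  "flat_exp n x = (if x > 0 then exp (- 1 / x) / x ^ n else 0)"

lemma flat_exp_tendsto: "(flat_exp n \<longlongrightarrow> 0) (at 0)"
  unfolding filterlim_at_split
proof
  have "\<forall>\<^sub>F x in at_left 0. flat_exp n x = 0"
    unfolding eventually_at_left_field flat_exp_def by (intro exI[of _ "-1"]) auto
  then show "(flat_exp n \<longlongrightarrow> 0) (at_left 0)" by (rule tendsto_eventually)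
  have "((\<lambda>x. inverse x ^ n / exp (inverse x)) \<longlongrightarrow> (0::real)) (at_right 0)"
    by (rule filterlim_compose[OF tendsto_power_div_exp_0 filterlim_inverse_at_top_right])
  moreover have "\<forall>\<^sub>F x in at_right (0::real). inverse x ^ n / exp (inverse x) = flat_exp n x"
    unfolding eventually_at_right_field flat_exp_def
    by (intro exI[of _ 1]) (auto simp: exp_minus field_simps)
  ultimately show "(flat_exp n \<longlongrightarrow> 0) (at_right 0)" using tendsto_cong by force
qed

lemma flat_exp_deriv:
  "(flat_exp n has_real_derivative (flat_exp (n + 2) x - n * flat_exp (n + 1) x)) (at x)"
proof -
  consider "x > 0" | "x < 0" | "x = 0" by linarith
  then show ?thesis
  proof cases
    case 1
    have "((\<lambda>x. exp (- 1 / x) / x ^ n) has_real_derivative (flat_exp (n + 2) x - n * flat_exp (n + 1) x)) (at x)"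
    proof -
      have "((\<lambda>x. x ^ n) has_real_derivative (n * x ^ n / x)) (at x)"
        using DERIV_pow[of n x UNIV] 1 by (cases n) auto
      moreover have "((\<lambda>x. exp (- 1 / x)) has_real_derivative (exp (- 1 / x) / x\<^sup>2)) (at x)"
        using 1 by (auto intro!: derivative_eq_intros simp: power2_eq_square)
      ultimately have "((\<lambda>x. exp (- 1 / x) / x ^ n) has_real_derivative
          ((exp (- 1 / x) / x\<^sup>2 * x ^ n - exp (- 1 / x) * (n * x ^ n / x)) / (x ^ n * x ^ n))) (at x)"
        using 1 by (intro DERIV_divide) auto
      moreover have "(exp (- 1 / x) / x\<^sup>2 * x ^ n - exp (- 1 / x) * (n * x ^ n / x)) / (x ^ n * x ^ n)
          = flat_exp (n + 2) x - n * flat_exp (n + 1) x"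
        using 1 by (simp add: flat_exp_def field_simps power2_eq_square)
      ultimately show ?thesis by simp
    qed
    then show ?thesis
      by (rule has_field_derivative_transform_within_open[where S = "{0<..}"]) (use 1 in \<open>auto simp: flat_exp_def\<close>)
  next
    case 2
    have "((\<lambda>_. 0) has_real_derivative 0) (at x)" by simp
    then have "(flat_exp n has_real_derivative 0) (at x)"
      by (rule has_field_derivative_transform_within_open[where S = "{..<0}"]) (use 2 in \<open>auto simp: flat_exp_def\<close>)
    then show ?thesis using 2 by (simp add: flat_exp_def)
  next
    case 3
    \<comment> \<open>At 0 the difference quotient of \<open>flat_exp n\<close> is exactly
      \<open>flat_exp (n + 1)\<close>.\<close>
    have "((\<lambda>h. (flat_exp n (0 + h) - flat_exp n 0) / h) \<longlongrightarrow> 0) (at 0)"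
    proof -
      have "(\<lambda>h. (flat_exp n (0 + h) - flat_exp n 0) / h) = flat_exp (n + 1)"
        by (auto simp: flat_exp_def field_simps)
      then show ?thesis using flat_exp_tendsto by simp
    qed
    then show ?thesis using 3 by (simp add: DERIV_def flat_exp_def)
  qed
qed

text \<open>Dependence through \<open>z \<bullet> z\<close> gives a radial function; the sign of
  \<open>\<sigma>\<close> selects the inside or the outside of a circle.\<close>

lemma Cn_flat_exp: "Cn k (\<lambda>z. of_real (flat_exp n (c + \<sigma> * (z \<bullet> z))))"
proof (induction k arbitrary: n)
  have D: "((\<lambda>z. complex_of_real (flat_exp n (c + \<sigma> * (z \<bullet> z)))) has_derivative
      (\<lambda>v. (of_real (flat_exp (n + 2) (c + \<sigma> * (z \<bullet> z))) - of_nat n * of_real (flat_exp (n + 1) (c + \<sigma> * (z \<bullet> z)))) *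
        (of_real \<sigma> * (v * cnj z + cnj v * z)))) (at z)" for n and z :: complex
  proof -
    have "((\<lambda>z. c + \<sigma> * (z \<bullet> z)) has_derivative (\<lambda>v. \<sigma> * (z \<bullet> v + v \<bullet> z))) (at z)"
      by (auto intro!: derivative_eq_intros)
    from has_derivative_compose[OF this flat_exp_deriv[unfolded has_field_derivative_def]]
    have "((\<lambda>z. complex_of_real (flat_exp n (c + \<sigma> * (z \<bullet> z)))) has_derivative
      (\<lambda>v. complex_of_real ((flat_exp (n + 2) (c + \<sigma> * (z \<bullet> z)) - n * flat_exp (n + 1) (c + \<sigma> * (z \<bullet> z))) *
        (\<sigma> * (z \<bullet> v + v \<bullet> z))))) (at z)"
      by (rule has_derivative_of_real)
    moreover have "complex_of_real (z \<bullet> v + v \<bullet> z) = v * cnj z + cnj v * z" for v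
      by (simp add: complex_eq_iff inner_complex_def algebra_simps)
    ultimately show ?thesis by (simp only: of_real_mult of_real_diff of_real_of_nat_eq)
  qed
  {
    case 0
    show ?case
      unfolding Cn.simps continuous_on_eq_continuous_at[OF open_UNIV]
      using has_derivative_continuous[OF D[of n]] by blast
  next
    case (Suc k)
    show ?case
      by (rule CnI[OF D]) (intro Cn_mult Cn_diff Cn_add Cn_const Cn_id Cn_cnj Suc)
  }
qed

lemma cutoff_exists:
  assumes "R > 0"
  obtains \<rho> :: "complex \<Rightarrow> complex" where "smooth \<rho>" "\<And>z. cmod z \<le> R \<Longrightarrow> \<rho> z = 1"
    "\<And>z. cmod z \<ge> 2 * R \<Longrightarrow> \<rho> z = 0" "\<And>z \<omega>. cmod \<omega> = 1 \<Longrightarrow> \<rho> (\<omega> * z) = \<rho> z"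
proof
  define E where "E c \<sigma> z = complex_of_real (flat_exp 0 (c + \<sigma> * (z \<bullet> z)))" for c \<sigma> and z :: complex
  \<comment> \<open>The numerator vanishes outside radius \<open>2 * R\<close>, the other summand of
    the denominator inside radius \<open>R\<close>, and they never vanish together.\<close>
  define \<rho> where "\<rho> z = E (4 * R\<^sup>2) (-1) z / (E (4 * R\<^sup>2) (-1) z + E (- R\<^sup>2) 1 z)" for z
  have pos: "flat_exp 0 x > 0 \<longleftrightarrow> x > 0" "flat_exp 0 x = 0 \<longleftrightarrow> x \<le> 0" "flat_exp 0 x \<ge> 0" for x
    by (auto simp: flat_exp_def)
  have nz: "E (4 * R\<^sup>2) (-1) z + E (- R\<^sup>2) 1 z \<noteq> 0" for z
  proof -
    have "flat_exp 0 (4 * R\<^sup>2 - z \<bullet> z) > 0 \<or> flat_exp 0 (- R\<^sup>2 + z \<bullet> z) > 0"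
      unfolding pos using assms by (smt (verit) zero_less_power)
    then have "flat_exp 0 (4 * R\<^sup>2 - z \<bullet> z) + flat_exp 0 (- R\<^sup>2 + z \<bullet> z) > 0"
      using pos(3) by (meson add_nonneg_pos add_pos_nonneg)
    then show ?thesis unfolding E_def by (simp flip: of_real_add)
  qed
  have sm: "Cn n (E c \<sigma>)" for n c \<sigma> unfolding E_def by (rule Cn_flat_exp)
  show "smooth \<rho>"
    unfolding smooth_def \<rho>_def by (intro allI Cn_divide Cn_add nz sm)
  show "\<rho> z = 1" if "cmod z \<le> R" for z
  proof -
    have "z \<bullet> z \<le> R\<^sup>2"
      unfolding power2_norm_eq_inner[symmetric] using that by (intro power_mono) auto
    then have "E (- R\<^sup>2) 1 z = 0" by (simp add: E_def flat_exp_def)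
    then show ?thesis using nz[of z] by (simp add: \<rho>_def)
  qed
  show "\<rho> z = 0" if "cmod z \<ge> 2 * R" for z
  proof -
    have "z \<bullet> z \<ge> (2 * R)\<^sup>2"
      unfolding power2_norm_eq_inner[symmetric] using that assms by (intro power_mono) auto
    then have "E (4 * R\<^sup>2) (-1) z = 0" by (simp add: E_def flat_exp_def power_mult_distrib)
    then show ?thesis by (simp add: \<rho>_def)
  qed
  show "\<rho> (\<omega> * z) = \<rho> z" if "cmod \<omega> = 1" for z \<omega>
    using that by (simp add: \<rho>_def E_def norm_mult flip: power2_norm_eq_inner)
qed

section \<open>Taylor expansion at the origin\<close>

abbreviation unit_ival :: "real measure" where
  "unit_ival \<equiv> restrict_space lborel {0..1}"

lemma unit_ival_integrable:
  fixes f :: "real \<Rightarrow> complex"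
  assumes "f \<in> borel_measurable unit_ival" "\<And>t. 0 \<le> t \<Longrightarrow> t \<le> 1 \<Longrightarrow> norm (f t) \<le> B"
  shows "integrable unit_ival f"
proof -
  interpret finite_measure unit_ival
    by (rule finite_measureI) (simp add: emeasure_restrict_space space_restrict_space)
  have "AE t in unit_ival. norm (f t) \<le> B"
    by (rule AE_I2) (use assms(2) in \<open>simp add: space_restrict_space\<close>)
  then show ?thesis
    by (rule integrable_const_bound) (rule assms(1))
qed

text \<open>Differentiability is asked only in the interior, where \<open>t powr (\<mu> + 1)\<close>
  is differentiated; continuity takes care of the end points.\<close>

lemma unit_ival_FTC:
  fixes F G :: "real \<Rightarrow> complex"
  assumes "continuous_on {0..1} F" "\<And>t. 0 < t \<Longrightarrow> t < 1 \<Longrightarrow> (F has_vector_derivative G t) (at t)"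
    "integrable unit_ival G"
  shows "(LINT t|unit_ival. G t) = F 1 - F 0"
proof -
  have si: "set_integrable lborel {0..1} G"
    using assms(3) by (simp add: set_integrable_def integrable_restrict_space)
  have "(LINT t|unit_ival. G t) = (LINT t:{0..1}|lborel. G t)"
    by (simp add: set_lebesgue_integral_def integral_restrict_space)
  also have "\<dots> = integral {0..1} G"
    by (rule set_borel_integral_eq_integral(2)[OF si])
  also have "\<dots> = F 1 - F 0"
    by (rule integral_unique, rule fundamental_theorem_of_calculus_interior) (use assms in auto)
  finally show ?thesis .
qed

text \<open>On smooth functions this weighted mean inverts the Euler field plus
  \<open>\<mu> + 1\<close>. The summand \<open>+ 0\<close> puts it into the affine form
  \<open>c u * z + b u\<close> with \<open>b = 0\<close>.\<close>

definition ray_mean :: "real \<Rightarrow> (complex \<Rightarrow> complex) \<Rightarrow> complex \<Rightarrow> complex" where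
  "ray_mean \<mu> f z = (LINT t|unit_ival. of_real (t powr \<mu>) * f (of_real t * z + 0))"

lemma weight_integrable: "\<mu> \<ge> 0 \<Longrightarrow> integrable unit_ival (\<lambda>t. complex_of_real (t powr \<mu>))"
  by (rule unit_ival_integrable[where B = 1])
     (auto intro!: measurable_restrict_space1 simp: powr_le1)

lemma smooth_ray_mean:
  assumes "\<mu> \<ge> 0" "smooth f"
  shows "smooth (ray_mean \<mu> f)"
  unfolding smooth_def ray_mean_def[abs_def]
  by (intro allI Cn_affine_mean weight_integrable assms smooth_Cn)
     (auto intro!: measurable_restrict_space1 simp: space_restrict_space)

lemma ray_mean_Dv:
  assumes "\<mu> \<ge> 0" "smooth f"
  shows "Dv v (ray_mean \<mu> f) z = (LINT t|unit_ival. of_real (t powr \<mu>) * of_real t * Dv v f (of_real t * z))"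
proof -
  have "(ray_mean \<mu> f has_derivative (\<lambda>v. LINT t|unit_ival. of_real (t powr \<mu>) * of_real t * Dv v f (of_real t * z + 0))) (at z)"
    unfolding ray_mean_def[abs_def]
    by (intro affine_mean_has_derivative weight_integrable assms smooth_Cn)
       (auto intro!: measurable_restrict_space1 simp: space_restrict_space)
  then show ?thesis by (simp add: Dv_eq)
qed

lemma ray_vector_derivative:
  assumes "smooth f"
  shows "((\<lambda>t. f (of_real t * z)) has_vector_derivative Dv z f (of_real t * z)) (at t)"
proof -
  have "((\<lambda>t. of_real t * z) has_derivative (\<lambda>h. of_real h * z)) (at t)"
    by (auto intro!: derivative_eq_intros)
  from has_derivative_compose[OF this Cn_SucD(1)[OF smooth_Cn[OF assms, of "Suc 0"]]]
  have "((\<lambda>t. f (of_real t * z)) has_derivative (\<lambda>h. Dv (of_real h * z) f (of_real t * z))) (at t)" .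
  then show ?thesis
    by (simp add: has_vector_derivative_def scaleR_conv_of_real Dv_scale[OF smooth_Cn[OF assms]])
qed

lemma ray_integrable:
  fixes f :: "complex \<Rightarrow> complex"
  assumes "\<mu> \<ge> 0" "continuous_on UNIV f"
  shows "integrable unit_ival (\<lambda>t. of_real (t powr \<mu>) * f (of_real t * z))"
proof -
  have "integrable unit_ival (\<lambda>t. of_real (t powr \<mu>) * f (of_real t * z + 0))"
    by (intro affine_mean_integrable weight_integrable assms)
       (auto intro!: measurable_restrict_space1 simp: space_restrict_space)
  then show ?thesis by simp
qed

lemma Dv_continuous: "smooth f \<Longrightarrow> continuous_on UNIV (Dv v f)"
  using smooth_Cn[OF smooth_Dv, of f 0] by simp

text \<open>Integrate the derivative of \<open>t powr (\<mu> + 1) * f (t z)\<close> over [0, 1]; the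
  weight kills the boundary term at \<open>t = 0\<close>.\<close>

lemma ray_mean_radial:
  assumes \<mu>: "\<mu> \<ge> 0" and f: "smooth f"
  shows "Dv z (ray_mean \<mu> f) z = f z - of_real (\<mu> + 1) * ray_mean \<mu> f z"
proof -
  let ?G = "\<lambda>t. of_real (\<mu> + 1) * (of_real (t powr \<mu>) * f (of_real t * z)) + of_real (t powr \<mu>) * of_real t * Dv z f (of_real t * z)"
  have fc: "continuous_on UNIV f" using smooth_Cn[OF f, of 0] by simp
  have i1: "integrable unit_ival (\<lambda>t. of_real (t powr \<mu>) * f (of_real t * z))"
    by (rule ray_integrable[OF \<mu> fc])
  have eq: "of_real (t powr (\<mu> + 1)) = (of_real (t powr \<mu>) * of_real t :: complex)" if "t \<ge> 0" for t
    using that by (cases "t = 0") (auto simp: powr_add)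
  have i2: "integrable unit_ival (\<lambda>t. of_real (t powr \<mu>) * of_real t * Dv z f (of_real t * z))"
  proof -
    have "integrable unit_ival (\<lambda>t. of_real (t powr (\<mu> + 1)) * Dv z f (of_real t * z))"
      using \<mu> by (intro ray_integrable Dv_continuous[OF f]) auto
    then show ?thesis
      by (rule iffD1[OF Bochner_Integration.integrable_cong[OF refl], rotated])
         (simp add: eq space_restrict_space)
  qed
  have "(LINT t|unit_ival. ?G t) = of_real (1 powr (\<mu> + 1)) * f (of_real 1 * z) - of_real (0 powr (\<mu> + 1)) * f (of_real 0 * z)"
  proof (rule unit_ival_FTC)
    have "continuous_on {0..1} (\<lambda>t. t powr (\<mu> + 1))"
      using \<mu> by (intro continuous_on_powr' continuous_intros) auto
    then show "continuous_on {0..1} (\<lambda>t. complex_of_real (t powr (\<mu> + 1)) * f (complex_of_real t * z))"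
      by (intro continuous_on_mult continuous_on_of_real continuous_on_compose2[OF fc]
          continuous_on_id continuous_on_const) auto
    fix t :: real assume t: "0 < t" "t < 1"
    have "((\<lambda>t. t powr (\<mu> + 1)) has_real_derivative (\<mu> + 1) * t powr \<mu>) (at t)"
      using t by (auto intro!: derivative_eq_intros)
    then have d: "((\<lambda>t. complex_of_real (t powr (\<mu> + 1))) has_vector_derivative of_real ((\<mu> + 1) * t powr \<mu>)) (at t)"
      by (intro has_vector_derivative_of_real) (simp add: has_real_derivative_iff_has_vector_derivative)
    show "((\<lambda>t. complex_of_real (t powr (\<mu> + 1)) * f (complex_of_real t * z)) has_vector_derivative ?G t) (at t)"
      using has_vector_derivative_mult[OF d ray_vector_derivative[OF f, of z t]] t
      by (simp add: algebra_simps powr_add)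
  qed (use i1 i2 in auto)
  moreover have "(LINT t|unit_ival. ?G t) = of_real (\<mu> + 1) * ray_mean \<mu> f z + Dv z (ray_mean \<mu> f) z"
    unfolding ray_mean_Dv[OF \<mu> f] using i1 i2 by (simp add: ray_mean_def)
  ultimately show ?thesis using \<mu> by (simp add: algebra_simps)
qed

section \<open>Wirtinger derivatives, Hadamard's lemma and Taylor expansions in \<open>z\<close> and
  \<open>cnj z\<close>\<close>

definition dz :: "(complex \<Rightarrow> complex) \<Rightarrow> complex \<Rightarrow> complex" where
  "dz f w = (Dv 1 f w - \<i> * Dv \<i> f w) / 2"

definition dzbar :: "(complex \<Rightarrow> complex) \<Rightarrow> complex \<Rightarrow> complex" where
  "dzbar f w = (Dv 1 f w + \<i> * Dv \<i> f w) / 2"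

lemma smooth_dz: "smooth f \<Longrightarrow> smooth (dz f)" and smooth_dzbar: "smooth f \<Longrightarrow> smooth (dzbar f)"
  unfolding dz_def[abs_def] dzbar_def[abs_def] divide_inverse by (intro smooth_intros smooth_Dv; simp)+

lemma Dv_eq_dz:
  assumes "smooth f"
  shows "Dv v f w = v * dz f w + cnj v * dzbar f w"
proof -
  have "Dv v f w = of_real (Re v) * Dv 1 f w + of_real (Im v) * Dv \<i> f w"
    by (rule Cn_deriv_decomp[OF smooth_Cn[OF assms]])
  then show ?thesis by (simp add: dz_def dzbar_def complex_eq_iff field_simps)
qed

text \<open>The fundamental theorem along the segment from 0 to \<open>z\<close>, with the
  derivative split into its \<open>z\<close> and \<open>cnj z\<close> parts.\<close>

lemma hadamard:
  assumes f: "smooth f"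
  shows "f z = f 0 + z * ray_mean 0 (dz f) z + cnj z * ray_mean 0 (dzbar f) z"
proof -
  note D = Dv_eq_dz[OF f]
  have c: "continuous_on UNIV (dz f)" "continuous_on UNIV (dzbar f)"
    using smooth_Cn[OF smooth_dz[OF f], of 0] smooth_Cn[OF smooth_dzbar[OF f], of 0] by auto
  note i = ray_integrable[OF order_refl c(1), of z] ray_integrable[OF order_refl c(2), of z]
  have "z * ray_mean 0 (dz f) z + cnj z * ray_mean 0 (dzbar f) z
      = (LINT t|unit_ival. z * (of_real (t powr 0) * dz f (of_real t * z)) + cnj z * (of_real (t powr 0) * dzbar f (of_real t * z)))"
    unfolding ray_mean_def using i by simp
  also have "\<dots> = (LINT t|unit_ival. of_real (t powr 0) * Dv z f (of_real t * z))"
    unfolding D by (simp add: algebra_simps)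
  \<comment> \<open>The factor \<open>t powr 0\<close> is 1 in the open interval, where the
    derivative is compared; its value 0 at \<open>t = 0\<close> does not enter there.\<close>
  also have "\<dots> = f (of_real 1 * z) - f (of_real 0 * z)"
  proof (rule unit_ival_FTC)
    have fc: "continuous_on UNIV f" using smooth_Cn[OF f, of 0] by simp
    show "continuous_on {0..1} (\<lambda>t. f (of_real t * z))"
      by (intro continuous_on_compose2[OF fc] continuous_intros) auto
    show "integrable unit_ival (\<lambda>t. of_real (t powr 0) * Dv z f (of_real t * z))"
      by (rule ray_integrable[OF order_refl Dv_continuous[OF f]])
  qed (use ray_vector_derivative[OF f] in auto)
  finally show ?thesis by (simp add: algebra_simps)
qed

definition hpoly :: "nat \<Rightarrow> (nat \<Rightarrow> complex) \<Rightarrow> complex \<Rightarrow> complex" where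
  "hpoly d t z = (\<Sum>a\<le>d. t a * (z ^ a * cnj z ^ (d - a)))"

text \<open>The remainder is recorded as smooth coefficients times monomials of degree
  \<open>M\<close>, not as a bound of order |z|^M: multiplied by a kernel it becomes a sum of smooth
  functions times kernels of degree raised by \<open>M\<close>, to which \<open>Cn_K\<close>
  applies.\<close>

definition has_taylor :: "(complex \<Rightarrow> complex) \<Rightarrow> (nat \<Rightarrow> nat \<Rightarrow> complex) \<Rightarrow> bool" where
  "has_taylor f t \<longleftrightarrow> (\<forall>M. \<exists>r. (\<forall>a. smooth (r a)) \<and>
     (\<forall>z. f z = (\<Sum>d<M. hpoly d (t d) z) + (\<Sum>a\<le>M. r a z * (z ^ a * cnj z ^ (M - a)))))"

text \<open>\<open>taylor_rem M f a\<close> is the coefficient of \<open>z\<^sup>a (cnj z)\<^bsup>M - a\<^esup>\<close> in the remainder of order \<open>M\<close>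
  obtained by iterating Hadamard's lemma; this avoids symmetry of second derivatives.\<close>

primrec taylor_rem :: "nat \<Rightarrow> (complex \<Rightarrow> complex) \<Rightarrow> nat \<Rightarrow> complex \<Rightarrow> complex" where
  "taylor_rem 0 f a = (if a = 0 then f else (\<lambda>_. 0))"
| "taylor_rem (Suc M) f a = (\<lambda>z. (if a = 0 then 0 else ray_mean 0 (dz (taylor_rem M f (a - 1))) z)
     + ray_mean 0 (dzbar (taylor_rem M f a)) z)"

lemma smooth_taylor_rem: "smooth f \<Longrightarrow> smooth (taylor_rem M f a)"
proof (induction M arbitrary: a)
  case 0
  then show ?case by (auto intro: smooth_intros)
next
  case (Suc M)
  then show ?case
    by (cases "a = 0") (auto intro!: smooth_intros smooth_ray_mean smooth_dz smooth_dzbar)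
qed

lemma dz_zero [simp]: "dz (\<lambda>_. 0) = (\<lambda>_. 0)" "dzbar (\<lambda>_. 0) = (\<lambda>_. 0)"
proof -
  have "Dv v (\<lambda>_. 0) w = 0" for v w by (rule Dv_eq) simp
  then show "dz (\<lambda>_. 0) = (\<lambda>_. 0)" "dzbar (\<lambda>_. 0) = (\<lambda>_. 0)" by (auto simp: dz_def dzbar_def)
qed

lemma taylor_rem_beyond: "a > M \<Longrightarrow> taylor_rem M f a = (\<lambda>_. 0)"
proof (induction M arbitrary: a)
  case (Suc M)
  then show ?case by (simp add: ray_mean_def)
qed simp

text \<open>One Hadamard step on each coefficient of the remainder: its value at 0 becomes a Taylor
  coefficient of degree \<open>M\<close>, its \<open>z\<close> part moves to index
  \<open>a + 1\<close>, its \<open>cnj z\<close> part stays at \<open>a\<close>.\<close>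

lemma taylor_expansion:
  assumes f: "smooth f"
  shows "f z = (\<Sum>d<M. hpoly d (\<lambda>a. taylor_rem d f a 0) z)
     + (\<Sum>a\<le>M. taylor_rem M f a z * (z ^ a * cnj z ^ (M - a)))"
proof (induction M)
  case 0
  show ?case by simp
next
  case (Suc M)
  let ?r = "taylor_rem M f"
  let ?P = "\<lambda>a. ray_mean 0 (dz (?r a)) z" and ?Q = "\<lambda>a. ray_mean 0 (dzbar (?r a)) z"
  have Q0: "?Q (Suc M) = 0"
    using taylor_rem_beyond[of M "Suc M" f] by (simp add: ray_mean_def)
  have "(\<Sum>a\<le>M. ?r a z * (z ^ a * cnj z ^ (M - a)))
      = (\<Sum>a\<le>M. (?r a 0 + z * ?P a + cnj z * ?Q a) * (z ^ a * cnj z ^ (M - a)))"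
    by (subst hadamard[OF smooth_taylor_rem[OF f]]) (rule refl)
  also have "\<dots> = hpoly M (\<lambda>a. ?r a 0) z + (\<Sum>a\<le>M. ?P a * (z ^ Suc a * cnj z ^ (M - a)))
      + (\<Sum>a\<le>M. ?Q a * (z ^ a * cnj z ^ (Suc M - a)))"
    unfolding hpoly_def sum.distrib[symmetric]
    by (intro sum.cong refl) (simp add: Suc_diff_le algebra_simps)
  also have "(\<Sum>a\<le>M. ?Q a * (z ^ a * cnj z ^ (Suc M - a))) = (\<Sum>a\<le>Suc M. ?Q a * (z ^ a * cnj z ^ (Suc M - a)))"
    using Q0 by simp
  also have "(\<Sum>a\<le>M. ?P a * (z ^ Suc a * cnj z ^ (M - a)))
      = (\<Sum>a\<le>Suc M. (if a = 0 then 0 else ?P (a - 1)) * (z ^ a * cnj z ^ (Suc M - a)))"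
    by (subst sum.atMost_Suc_shift) simp
  also have "hpoly M (\<lambda>a. ?r a 0) z + \<dots> + (\<Sum>a\<le>Suc M. ?Q a * (z ^ a * cnj z ^ (Suc M - a)))
     = hpoly M (\<lambda>a. ?r a 0) z + (\<Sum>a\<le>Suc M. taylor_rem (Suc M) f a z * (z ^ a * cnj z ^ (Suc M - a)))"
    unfolding add.assoc sum.distrib[symmetric] by (simp only: taylor_rem.simps distrib_right)
  finally show ?case using Suc by simp
qed

lemma has_taylor_exists: "smooth f \<Longrightarrow> \<exists>t. has_taylor f t"
  unfolding has_taylor_def
  using smooth_taylor_rem taylor_expansion by (intro exI[of _ "\<lambda>d a. taylor_rem d f a 0"]) blast

lemma monom_scale:
  assumes "a \<le> d"
  shows "(of_real x * z) ^ a * cnj (of_real x * z) ^ (d - a) = of_real x ^ d * (z ^ a * cnj z ^ (d - a))"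
proof -
  have "of_real x ^ a * of_real x ^ (d - a) = (of_real x ^ d :: complex)"
    using assms by (simp flip: power_add)
  moreover have "(of_real x * z) ^ a * cnj (of_real x * z) ^ (d - a)
     = (of_real x ^ a * of_real x ^ (d - a)) * (z ^ a * cnj z ^ (d - a))"
    by (simp add: power_mult_distrib mult_ac)
  ultimately show ?thesis by simp
qed

lemma hpoly_scale: "hpoly d t (of_real x * z) = of_real x ^ d * hpoly d t z"
  unfolding hpoly_def sum_distrib_left
  by (intro sum.cong refl) (simp only: atMost_iff monom_scale mult.left_commute)

lemma smooth_hpoly: "smooth (hpoly d t)"
  unfolding hpoly_def[abs_def] by (intro smooth_intros)

lemma norm_hpoly_le: "norm (hpoly d t z) \<le> (\<Sum>a\<le>d. norm (t a)) * cmod z ^ d"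
proof -
  have "norm (hpoly d t z) \<le> (\<Sum>a\<le>d. norm (t a * (z ^ a * cnj z ^ (d - a))))"
    unfolding hpoly_def by (rule norm_sum)
  also have "\<dots> = (\<Sum>a\<le>d. norm (t a)) * cmod z ^ d"
    unfolding sum_distrib_right by (intro sum.cong refl) (simp add: norm_mult norm_power flip: power_add)
  finally show ?thesis .
qed

lemma taylor_remainder_bound:
  assumes "\<And>a. smooth (r a)"
  shows "\<exists>C. \<forall>z. cmod z \<le> 1 \<longrightarrow> norm (\<Sum>a\<le>M. r a z * (z ^ a * cnj z ^ (M - a))) \<le> C * cmod z ^ M"
proof -
  have "\<exists>B. \<forall>z. cmod z \<le> 1 \<longrightarrow> norm (r a z) \<le> B" for a
  proof -
    have "continuous_on UNIV (r a)" using smooth_Cn[OF assms, of 0] by simp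
    then have "compact (r a ` cball 0 1)"
      by (intro compact_continuous_image) (auto intro: continuous_on_subset)
    then obtain B where B: "\<And>y. y \<in> r a ` cball 0 1 \<Longrightarrow> norm y \<le> B"
      using compact_imp_bounded bounded_iff by metis
    have "norm (r a z) \<le> B" if "cmod z \<le> 1" for z
      using that by (intro B imageI) auto
    then show ?thesis by blast
  qed
  then obtain B where B: "\<And>a z. cmod z \<le> 1 \<Longrightarrow> norm (r a z) \<le> B a" by metis
  have "norm (\<Sum>a\<le>M. r a z * (z ^ a * cnj z ^ (M - a))) \<le> (\<Sum>a\<le>M. B a) * cmod z ^ M" if z: "cmod z \<le> 1" for z
  proof -
    have "norm (\<Sum>a\<le>M. r a z * (z ^ a * cnj z ^ (M - a))) \<le> (\<Sum>a\<le>M. norm (r a z * (z ^ a * cnj z ^ (M - a))))"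
      by (rule norm_sum)
    also have "\<dots> \<le> (\<Sum>a\<le>M. B a * cmod z ^ M)"
      using B[OF z] by (intro sum_mono) (simp add: norm_mult norm_power mult_right_mono flip: power_add)
    finally show ?thesis by (simp add: sum_distrib_right)
  qed
  then show ?thesis by blast
qed

text \<open>Uniqueness of asymptotic expansions. Once lower degrees vanish, \<open>D d\<close> is
  O(|z|^(d+1)); replacing \<open>z\<close> by \<open>x z\<close> and letting \<open>x\<close> tend
  to 0 gains a factor \<open>x\<close> over homogeneity. Working with components as functions avoids
  any independence of monomials.\<close>

lemma homogeneous_unique:
  fixes D :: "nat \<Rightarrow> complex \<Rightarrow> complex"
  assumes hom: "\<And>d x z. x > 0 \<Longrightarrow> D d (of_real x * z) = of_real x ^ d * D d z"
    and small: "\<And>M. \<exists>C r. r > 0 \<and> (\<forall>z. cmod z \<le> r \<longrightarrow> norm (\<Sum>d<M. D d z) \<le> C * cmod z ^ M)"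
  shows "D d z = 0"
proof (induction d arbitrary: z rule: less_induct)
  case (less d)
  obtain C r where r: "r > 0" and C: "\<And>z. cmod z \<le> r \<Longrightarrow> norm (\<Sum>e<Suc d. D e z) \<le> C * cmod z ^ Suc d"
    using small[of "Suc d"] by auto
  have C': "norm (D d y) \<le> C * cmod y ^ Suc d" if "cmod y \<le> r" for y
    using C[OF that] less by simp
  have le: "norm (D d z) \<le> C * cmod z ^ Suc d * x" if x: "0 < x" "x * cmod z \<le> r" for x
  proof -
    have "x ^ d * norm (D d z) = norm (D d (of_real x * z))"
      using x by (simp add: hom norm_mult norm_power)
    also have "\<dots> \<le> C * (x * cmod z) ^ Suc d"
      using C'[of "of_real x * z"] x by (simp add: norm_mult)
    also have "\<dots> = x ^ d * (C * cmod z ^ Suc d * x)"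
      by (simp add: power_mult_distrib mult_ac)
    finally show ?thesis using x by simp
  qed
  have "((\<lambda>x. C * cmod z ^ Suc d * x) \<longlongrightarrow> C * cmod z ^ Suc d * 0) (at_right 0)"
    by (intro tendsto_intros)
  moreover have "\<forall>\<^sub>F x in at_right 0. norm (D d z) \<le> C * cmod z ^ Suc d * x"
    unfolding eventually_at_right_field
  \<comment> \<open>The added 1 keeps this threshold positive for \<open>z = 0\<close>.\<close>
  proof (intro exI[of _ "r / (cmod z + 1)"] conjI allI impI)
    show "0 < r / (cmod z + 1)" using r by (intro divide_pos_pos) (auto intro: add_nonneg_pos)
    fix y assume y: "0 < y" "y < r / (cmod z + 1)"
    have pos: "cmod z + 1 > 0" by (intro add_nonneg_pos) auto
    have "y * (cmod z + 1) < r" using y(2) pos by (simp add: pos_less_divide_eq)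
    then have "y * cmod z \<le> r" using y(1) by (simp add: algebra_simps)
    then show "norm (D d z) \<le> C * cmod z ^ Suc d * y" by (rule le[OF y(1)])
  qed
  ultimately have "norm (D d z) \<le> C * cmod z ^ Suc d * 0"
    by (intro tendsto_lowerbound) auto
  then show ?case by simp
qed

text \<open>The defect of equivariance is homogeneous in each degree, and its partial sums are
  differences of Taylor remainders, so uniqueness makes it zero.\<close>

lemma taylor_eqv:
  assumes T: "has_taylor f t" and f: "\<And>z. f (\<omega> * z) = c * f z" and \<omega>: "cmod \<omega> = 1" 
  shows "hpoly d (t d) (\<omega> * z) = c * hpoly d (t d) z"
proof -
  define D where "D d z = hpoly d (t d) (\<omega> * z) - c * hpoly d (t d) z" for d z
  have "D d z = 0"
  proof (rule homogeneous_unique[of D])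
    fix d x z
    have "hpoly d (t d) (\<omega> * (of_real x * z)) = of_real x ^ d * hpoly d (t d) (\<omega> * z)"
      using hpoly_scale[of d "t d" x "\<omega> * z"] by (simp add: mult_ac)
    then show "D d (of_real x * z) = of_real x ^ d * D d z"
      unfolding D_def hpoly_scale by (simp add: right_diff_distrib)
  next
    fix M
    obtain r where r: "\<And>a. smooth (r a)" and
      eq: "\<And>z. f z = (\<Sum>d<M. hpoly d (t d) z) + (\<Sum>a\<le>M. r a z * (z ^ a * cnj z ^ (M - a)))"
      using T unfolding has_taylor_def by metis
    define E where "E z = (\<Sum>a\<le>M. r a z * (z ^ a * cnj z ^ (M - a)))" for z
    obtain C where C: "\<And>z. cmod z \<le> 1 \<Longrightarrow> norm (E z) \<le> C * cmod z ^ M"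
      using taylor_remainder_bound[of r M, OF r] unfolding E_def by blast
    have "norm (\<Sum>d<M. D d z) \<le> (C + norm c * C) * cmod z ^ M" if z: "cmod z \<le> 1" for z
    proof -
      have "(\<Sum>d<M. D d z) = (f (\<omega> * z) - E (\<omega> * z)) - c * (f z - E z)"
        unfolding eq E_def D_def by (simp add: sum_subtractf sum_distrib_left)
      also have "\<dots> = c * E z - E (\<omega> * z)" unfolding f by (simp add: algebra_simps)
      finally have "norm (\<Sum>d<M. D d z) \<le> norm c * norm (E z) + norm (E (\<omega> * z))"
        by (metis norm_mult norm_triangle_ineq4)
      also have "\<dots> \<le> norm c * (C * cmod z ^ M) + C * cmod z ^ M"
        using C[OF z] C[of "\<omega> * z"] z \<omega> by (intro add_mono mult_left_mono) (auto simp: norm_mult)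
      finally show ?thesis by (simp add: algebra_simps)
    qed
    then show "\<exists>C r. r > 0 \<and> (\<forall>z. cmod z \<le> r \<longrightarrow> norm (\<Sum>d<M. D d z) \<le> C * cmod z ^ M)"
      by (intro exI[of _ "C + norm c * C"] exI[of _ 1]) auto
  qed
  then show ?thesis by (simp add: D_def)
qed

section \<open>Borel's lemma\<close>

text \<open>A single constant for all iterated derivatives of order at most \<open>n\<close> in the
  two basic directions, so that one summable sequence can dominate a whole series together with its
  derivatives.\<close>

primrec Dv_bounded :: "nat \<Rightarrow> real \<Rightarrow> (complex \<Rightarrow> complex) \<Rightarrow> bool" where
  "Dv_bounded 0 B f \<longleftrightarrow> (\<forall>z. norm (f z) \<le> B)"
| "Dv_bounded (Suc n) B f \<longleftrightarrow> (\<forall>z. norm (f z) \<le> B) \<and> Dv_bounded n B (Dv 1 f) \<and> Dv_bounded n B (Dv \<i> f)"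

lemma Dv_bounded_norm: "Dv_bounded n B f \<Longrightarrow> norm (f z) \<le> B"
  by (cases n) auto

lemma Dv_bounded_mono: "Dv_bounded n B f \<Longrightarrow> B \<le> B' \<Longrightarrow> Dv_bounded n B' f"
  by (induction n arbitrary: f; simp; meson order_trans)

lemma Dv_bounded_SucD: "Dv_bounded (Suc n) B f \<Longrightarrow> Dv_bounded n B f"
proof (induction n arbitrary: f)
  case (Suc n)
  then show ?case by (subst Dv_bounded.simps(2), subst (asm) Dv_bounded.simps(2)) blast
qed simp

lemma Dv_bounded_le: "Dv_bounded n B f \<Longrightarrow> m \<le> n \<Longrightarrow> Dv_bounded m B f"
  by (induction n) (auto simp: le_Suc_eq dest: Dv_bounded_SucD simp del: Dv_bounded.simps)

lemma Dv_bounded_exists: "smooth f \<Longrightarrow> bdd_supp f \<Longrightarrow> \<exists>B\<ge>0. Dv_bounded n B f"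
proof (induction n arbitrary: f)
  case 0
  then show ?case using bdd_supp_bounded[of f] smooth_Cn[of f 0] by auto
next
  case (Suc n)
  obtain B1 B2 B3 where "B1 \<ge> 0" "Dv_bounded n B1 (Dv 1 f)" "Dv_bounded n B2 (Dv \<i> f)" "\<And>z. norm (f z) \<le> B3"
    using Suc.IH[OF smooth_Dv bdd_supp_Dv] Suc.prems bdd_supp_bounded[of f] smooth_Cn[of f 0] Cn.simps(1) by metis
  then have "Dv_bounded (Suc n) (max B1 (max B2 B3)) f"
    by (auto intro: Dv_bounded_mono simp: le_max_iff_disj)
  then show ?case using \<open>B1 \<ge> 0\<close> by (intro exI[of _ "max B1 (max B2 B3)"]) auto
qed

text \<open>Each derivative extracts a factor \<tau>, absorbed into \<open>c\<close> during the
  induction; \<tau> \<ge> 1 lets the top power serve for all lower orders.\<close>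

lemma Dv_bounded_scale:
  assumes "smooth f" "Dv_bounded n B f" "\<tau> \<ge> 1" "c \<ge> 0"
  shows "Dv_bounded n (c * \<tau> ^ n * B) (\<lambda>z. of_real c * f (of_real \<tau> * z))"
  using assms(1,2,4)
proof (induction n arbitrary: f c)
  case 0
  then show ?case by (auto simp: norm_mult intro!: mult_left_mono)
next
  case (Suc n)
  have Dv: "Dv v (\<lambda>z. of_real c * f (of_real \<tau> * z)) = (\<lambda>z. of_real (c * \<tau>) * Dv v f (of_real \<tau> * z))" for v
  proof
    fix z
    have "((\<lambda>z. complex_of_real \<tau> * z) has_derivative (\<lambda>v. of_real \<tau> * v)) (at z)"
      by (auto intro!: derivative_eq_intros)
    from has_derivative_mult_right[OF has_derivative_compose[OF this Cn_SucD(1)[OF smooth_Cn[OF Suc.prems(1), of "Suc 0"]]]]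
    have "((\<lambda>z. of_real c * f (of_real \<tau> * z)) has_derivative (\<lambda>v. of_real c * Dv (of_real \<tau> * v) f (of_real \<tau> * z))) (at z)" .
    then show "Dv v (\<lambda>z. of_real c * f (of_real \<tau> * z)) z = of_real (c * \<tau>) * Dv v f (of_real \<tau> * z)"
      by (simp add: Dv_eq Dv_scale[OF smooth_Cn[OF Suc.prems(1)]])
  qed
  have "norm (of_real c * f (of_real \<tau> * z)) \<le> c * \<tau> ^ Suc n * B" for z
  proof -
    have B: "norm (f (of_real \<tau> * z)) \<le> B" by (rule Dv_bounded_norm[OF Suc.prems(2)])
    then have "B \<ge> 0" using norm_ge_zero order_trans by blast
    then have "B \<le> \<tau> ^ Suc n * B" using mult_right_mono[OF one_le_power[OF assms(3), of "Suc n"], of B] by simp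
    then have "norm (f (of_real \<tau> * z)) \<le> \<tau> ^ Suc n * B" using B by simp
    then have "c * norm (f (of_real \<tau> * z)) \<le> c * (\<tau> ^ Suc n * B)" using Suc.prems(3) by (rule mult_left_mono)
    then show ?thesis using Suc.prems(3) by (simp add: norm_mult mult.assoc)
  qed
  moreover have "Dv_bounded n (c * \<tau> ^ Suc n * B) (\<lambda>z. of_real (c * \<tau>) * Dv v f (of_real \<tau> * z))" if "v = 1 \<or> v = \<i>" for v
    using Suc.IH[of "Dv v f" "c * \<tau>"] Suc.prems assms(3) that smooth_Dv by (auto simp: mult_ac)
  ultimately show ?case unfolding Dv_bounded.simps Dv by auto
qed

lemma Dv_series_bound:
  assumes "smooth f" "Dv_bounded (Suc n) b f"
  shows "norm (Dv h f z) \<le> 2 * b * norm h"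
proof -
  have "norm (Dv h f z) \<le> norm h * (norm (Dv 1 f z) + norm (Dv \<i> f z))"
    by (rule norm_Dv_le[OF smooth_Cn[OF assms(1)]])
  also have "\<dots> \<le> norm h * (b + b)"
    using assms(2) Dv_bounded_norm by (intro mult_left_mono add_mono) auto
  finally show ?thesis by (simp add: algebra_simps)
qed

text \<open>Termwise differentiation: the Weierstrass test gives continuity, and the tails of
  \<open>b\<close> make the derivative series converge uniformly. Each derivative consumes one order
  of \<open>Dv_bounded\<close> with the same \<open>b\<close>.\<close>

lemma Cn_suminf:
  assumes "\<And>i. smooth (y i)" "\<And>i. Dv_bounded n (b i) (y i)" "summable b"
  shows "Cn n (\<lambda>z. \<Sum>i. y i z)"
  using assms(1,2)
proof (induction n arbitrary: y)
  case 0
  have "uniform_limit UNIV (\<lambda>n z. \<Sum>i<n. y i z) (\<lambda>z. \<Sum>i. y i z) sequentially"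
    by (rule Weierstrass_m_test[of _ _ b]) (use 0 assms(3) in auto)
  moreover have "continuous_on UNIV (\<lambda>z. \<Sum>i<m. y i z)" for m
    using smooth_Cn[OF 0(1), of 0] by (intro continuous_on_sum) simp
  ultimately have "continuous_on UNIV (\<lambda>z. \<Sum>i. y i z)"
    by (intro uniform_limit_theorem[where F = sequentially]) auto
  then show ?case by simp
next
  case (Suc n)
  have sm: "summable (\<lambda>i. y i z)" for z
    by (rule summable_comparison_test'[OF assms(3)]) (rule Dv_bounded_norm[OF Suc.prems(2)])
  have Db: "norm (Dv h (y i) z) \<le> 2 * b i * norm h" for h i z
    by (rule Dv_series_bound[OF Suc.prems])
  have sb: "summable (\<lambda>i. 2 * b i * norm h)" for h :: complex
    using assms(3) by (intro summable_mult summable_mult2)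
  have smD: "summable (\<lambda>i. Dv h (y i) z)" for h z
    by (rule summable_comparison_test'[OF sb]) (rule Db)
  have "\<exists>g. \<forall>z\<in>UNIV. (\<lambda>i. y i z) sums (g z) \<and> (g has_derivative (\<lambda>h. \<Sum>i. Dv h (y i) z)) (at z within UNIV)"
  proof (rule has_derivative_series[of UNIV y "\<lambda>i z h. Dv h (y i) z" "\<lambda>z h. \<Sum>i. Dv h (y i) z" 0 "\<Sum>i. y i 0"])
    show "(y i has_derivative (\<lambda>h. Dv h (y i) z)) (at z within UNIV)" for i z
      using Cn_SucD(1)[OF smooth_Cn[OF Suc.prems(1), of "Suc 0"]] by simp
    fix e :: real assume e: "e > 0"
    have "(\<lambda>N. \<Sum>i<N. b i) \<longlonglongrightarrow> suminf b" using assms(3) by (rule summable_LIMSEQ)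
    then have "\<forall>\<^sub>F N in sequentially. dist (\<Sum>i<N. b i) (suminf b) < e / 2"
      using e by (intro tendstoD) auto
    then show "\<forall>\<^sub>F N in sequentially. \<forall>z\<in>UNIV. \<forall>h. norm ((\<Sum>i<N. Dv h (y i) z) - (\<Sum>i. Dv h (y i) z)) \<le> e * norm h"
    proof eventually_elim
      case (elim N)
      show ?case
      proof (intro ballI allI)
        fix z h :: complex
        have tail: "(\<Sum>i. b (i + N)) \<le> e / 2"
          using elim suminf_minus_initial_segment[OF assms(3), of N] unfolding dist_real_def abs_less_iff by linarith
        have sN: "summable (\<lambda>i. 2 * b (i + N) * norm h)"
          using sb[of h] summable_iff_shift[of "\<lambda>i. 2 * b i * norm h" N] by simp
        have "(\<Sum>i<N. Dv h (y i) z) - (\<Sum>i. Dv h (y i) z) = - (\<Sum>i. Dv h (y (i + N)) z)"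
          using suminf_minus_initial_segment[OF smD[of h z], of N] by simp
        also have "norm \<dots> \<le> (\<Sum>i. 2 * b (i + N) * norm h)"
          unfolding norm_minus_cancel by (intro norm_suminf_le sN Db)
        also have "\<dots> = 2 * (\<Sum>i. b (i + N)) * norm h"
          using assms(3) summable_iff_shift[of b N] by (simp add: suminf_mult2[symmetric] suminf_mult summable_mult)
        also have "\<dots> \<le> e * norm h"
          using tail by (intro mult_right_mono) auto
        finally show "norm ((\<Sum>i<N. Dv h (y i) z) - (\<Sum>i. Dv h (y i) z)) \<le> e * norm h" .
      qed
    qed
  qed (auto intro: summable_sums sm)
  then obtain g where g: "\<And>z. (\<lambda>i. y i z) sums (g z)" "\<And>z. (g has_derivative (\<lambda>h. \<Sum>i. Dv h (y i) z)) (at z)"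
    by auto
  have "g = (\<lambda>z. \<Sum>i. y i z)" using g(1) by (auto simp: sums_iff)
  then have D: "((\<lambda>z. \<Sum>i. y i z) has_derivative (\<lambda>h. \<Sum>i. Dv h (y i) z)) (at z)" for z
    using g(2) by simp
  show ?case
  proof (rule CnI2[OF D])
    show "Cn n (\<lambda>z. \<Sum>i. Dv 1 (y i) z)" "Cn n (\<lambda>z. \<Sum>i. Dv \<i> (y i) z)"
      using Suc.prems by (auto intro!: Suc.IH smooth_Dv)
  qed
qed

text \<open>For fixed \<open>n\<close> only finitely many terms escape the bound, and these form a
  smooth finite sum. The form of the hypothesis is that of Borel's construction, where term
  \<open>d\<close> is controlled up to order \<open>d - 1\<close>.\<close>

lemma smooth_suminf:
  assumes y: "\<And>i. smooth (y i)" and Dv_bounded: "\<And>n i. n < i \<Longrightarrow> Dv_bounded n (b i) (y i)" and b: "summable b"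
  shows "smooth (\<lambda>z. \<Sum>i. y i z)"
  unfolding smooth_def
proof
  fix n
  define N where "N = Suc n"
  have CBN: "Dv_bounded n (b (i + N)) (y (i + N))" for i using Dv_bounded by (auto simp: N_def)
  have bN: "summable (\<lambda>i. b (i + N))" using b by (simp add: summable_iff_shift)
  have "summable (\<lambda>i. y (i + N) z)" for z
    by (rule summable_comparison_test'[OF bN]) (rule Dv_bounded_norm[OF CBN])
  then have "summable (\<lambda>i. y i z)" for z
    using summable_iff_shift[of "\<lambda>i. y i z" N] by blast
  then have "(\<Sum>i. y i z) = (\<Sum>i. y (i + N) z) + (\<Sum>i<N. y i z)" for z
    by (rule suminf_split_initial_segment)
  moreover have "Cn n (\<lambda>z. (\<Sum>i. y (i + N) z) + (\<Sum>i<N. y i z))"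
    by (intro Cn_add Cn_sum smooth_Cn[OF y] Cn_suminf[OF y CBN bN])
  ultimately show "Cn n (\<lambda>z. \<Sum>i. y i z)" by simp
qed

text \<open>The component of degree \<open>d\<close> is cut off at a radius of order
  \<open>1 / L d\<close>. Shrinking costs a factor \<open>L d\<close> per derivative, while
  homogeneity returns \<open>d\<close> of them, so derivatives of order below \<open>d\<close>
  become small.\<close>

lemma borel_lemma:
  obtains \<zeta> where "smooth \<zeta>" "bdd_supp \<zeta>" "has_taylor \<zeta> t"
proof -
  obtain \<rho> :: "complex \<Rightarrow> complex" where \<rho>: "smooth \<rho>" "\<And>z. cmod z \<le> 1 \<Longrightarrow> \<rho> z = 1" "\<And>z. cmod z \<ge> 2 * 1 \<Longrightarrow> \<rho> z = 0"
    using cutoff_exists[of 1] by (metis zero_less_one)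
  have b\<rho>: "bdd_supp \<rho>" unfolding bdd_supp_def using \<rho>(3) by (intro exI[of _ 2]) auto
  obtain X where X: "X \<ge> 0" "\<And>z. norm (\<rho> z) \<le> X"
    using bdd_supp_bounded[OF b\<rho>] smooth_Cn[OF \<rho>(1), of 0] by auto
  define f where "f d z = hpoly d (t d) z * \<rho> z" for d z
  have f: "smooth (f d)" "bdd_supp (f d)" for d
    unfolding f_def[abs_def] by (intro smooth_intros smooth_hpoly \<rho>(1) bdd_supp_mult b\<rho>)+
  have "\<exists>B\<ge>0. Dv_bounded (d - 1) B (f d)" for d by (rule Dv_bounded_exists[OF f])
  then obtain B where B: "\<And>d. B d \<ge> 0" "\<And>d. Dv_bounded (d - 1) (B d) (f d)" by metis
  define A where "A d = (\<Sum>a\<le>d. norm (t d a)) * X" for d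
  have A0: "A d \<ge> 0" for d unfolding A_def using X(1) by (intro mult_nonneg_nonneg sum_nonneg) auto
  \<comment> \<open>The entry \<open>B d\<close> makes the derivatives of order below
    \<open>d\<close> at most \<open>2^-d\<close>; the entry \<open>2 * A d\<close> makes the tail
    near 0 summable with a factor |z|^M.\<close>
  define L where "L d = max 1 (2 ^ d * max (B d) (2 * A d))" for d
  have L1: "L d \<ge> 1" for d by (simp add: L_def)
  have LB: "B d / L d \<le> (1/2) ^ d" "2 * A d / L d \<le> (1/2) ^ d" for d
  proof -
    have "2 ^ d * max (B d) (2 * A d) \<le> L d" by (simp add: L_def)
    then have "2 ^ d * B d \<le> L d" "2 ^ d * (2 * A d) \<le> L d"
      by (smt (verit) max.cobounded1 max.cobounded2 mult_left_mono zero_le_power)+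
    then show "B d / L d \<le> (1/2) ^ d" "2 * A d / L d \<le> (1/2) ^ d"
      using L1[of d] by (auto simp: field_simps power_divide)
  qed
  define y where "y d z = hpoly d (t d) z * \<rho> (of_real (L d) * z)" for d z
  have y_eq: "y d = (\<lambda>z. of_real ((1 / L d) ^ d) * f d (of_real (L d) * z))" for d
  proof -
    have "(1 / L d) ^ d * L d ^ d = 1" using L1[of d] by (simp add: power_divide)
    then have "complex_of_real ((1 / L d) ^ d) * of_real (L d) ^ d = 1" by (metis of_real_1 of_real_mult of_real_power)
    then have "y d z = (complex_of_real ((1 / L d) ^ d) * of_real (L d) ^ d) * (hpoly d (t d) z * \<rho> (of_real (L d) * z))" for z
      by (simp only: y_def mult_1)
    then show ?thesis by (intro ext) (simp only: f_def hpoly_scale, simp only: mult_ac)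
  qed
  have ysm: "smooth (y d)" for d
    unfolding y_def[abs_def] using Cn_compose_mult[OF smooth_Cn[OF \<rho>(1)]]
    by (intro smooth_intros smooth_hpoly) (simp add: smooth_def)
  have yCB: "Dv_bounded n ((1/2) ^ d) (y d)" if "n < d" for n d
  proof -
    have "Dv_bounded (d - 1) ((1 / L d) ^ d * L d ^ (d - 1) * B d) (y d)"
      unfolding y_eq by (rule Dv_bounded_scale[OF f(1) B(2)]) (use L1[of d] in auto)
    moreover have "(1 / L d) ^ d * L d ^ (d - 1) * B d = B d / L d"
      using L1[of d] that by (cases d) (auto simp: field_simps)
    ultimately have "Dv_bounded (d - 1) (B d / L d) (y d)" by simp
    then have "Dv_bounded (d - 1) ((1/2) ^ d) (y d)" by (rule Dv_bounded_mono[OF _ LB(1)])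
    then show ?thesis by (rule Dv_bounded_le) (use that in simp)
  qed
  have half: "summable (\<lambda>d. (1/2::real) ^ d)" by (intro summable_geometric) auto
  define \<zeta> where "\<zeta> z = (\<Sum>d. y d z)" for z
  have zsm: "smooth \<zeta>" unfolding \<zeta>_def[abs_def] by (rule smooth_suminf[OF ysm yCB half])
  have y0: "y d z = 0" if "cmod z * L d \<ge> 2" for d z
    using \<rho>(3)[of "of_real (L d) * z"] that L1[of d] by (simp add: y_def norm_mult mult.commute)
  have zb: "bdd_supp \<zeta>"
    unfolding bdd_supp_def
  proof (intro exI[of _ 2] allI impI)
    fix z :: complex assume z: "2 < cmod z"
    have "y d z = 0" for d
    proof (rule y0)
      have "2 * 1 \<le> cmod z * L d" using z L1[of d] by (intro mult_mono) auto
      then show "2 \<le> cmod z * L d" by simp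
    qed
    then show "\<zeta> z = 0" by (simp add: \<zeta>_def)
  qed
  have ybound: "norm (y d z) \<le> A d * cmod z ^ d" for d z
  proof -
    have "norm (y d z) \<le> ((\<Sum>a\<le>d. norm (t d a)) * cmod z ^ d) * X"
      unfolding y_def norm_mult by (intro mult_mono norm_hpoly_le X) (auto intro!: mult_nonneg_nonneg sum_nonneg)
    then show ?thesis by (simp add: A_def mult_ac)
  qed
  \<comment> \<open>Where the term is not zero, \<open>cmod z < 2 / L d\<close>: one of the
    \<open>d\<close> powers of |z| is traded for this small factor, and the remaining
    \<open>d - 1 \<ge> M\<close> give |z|^M.\<close>
  have ytail: "norm (y d z) \<le> (1/2) ^ d * cmod z ^ M" if "M < d" "cmod z \<le> 1" for d z M
  proof (cases "cmod z * L d \<ge> 2")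
    case True
    then show ?thesis by (simp add: y0)
  next
    case False
    have "norm (y d z) \<le> A d * (cmod z * cmod z ^ (d - 1))"
      using ybound[of d z] that by (cases d) auto
    also have "cmod z * cmod z ^ (d - 1) \<le> 2 / L d * cmod z ^ M"
      using False that L1[of d] by (intro mult_mono power_decreasing) (auto simp: field_simps)
    then have "A d * (cmod z * cmod z ^ (d - 1)) \<le> A d * (2 / L d * cmod z ^ M)"
      using A0 by (intro mult_left_mono)
    also have "\<dots> = (2 * A d / L d) * cmod z ^ M" by simp
    also have "\<dots> \<le> (1/2) ^ d * cmod z ^ M" using LB by (intro mult_right_mono) auto
    finally show ?thesis .
  qed
  \<comment> \<open>Smoothness provides some Taylor coefficients \<open>t'\<close>; uniqueness
    identifies their homogeneous components with the prescribed ones, and \<open>has_taylor\<close>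
    depends on nothing more.\<close>
  obtain t' where T: "has_taylor \<zeta> t'" using has_taylor_exists[OF zsm] by blast
  have eq: "hpoly d (t' d) z - hpoly d (t d) z = 0" for d z
  proof (rule homogeneous_unique[of "\<lambda>d z. hpoly d (t' d) z - hpoly d (t d) z"])
    fix d x z
    show "hpoly d (t' d) (of_real x * z) - hpoly d (t d) (of_real x * z) = of_real x ^ d * (hpoly d (t' d) z - hpoly d (t d) z)"
      unfolding hpoly_scale right_diff_distrib ..
  next
    fix M
    obtain r where r: "\<And>a. smooth (r a)" and
      eq: "\<And>z. \<zeta> z = (\<Sum>d<M. hpoly d (t' d) z) + (\<Sum>a\<le>M. r a z * (z ^ a * cnj z ^ (M - a)))"
      using T unfolding has_taylor_def by metis
    define E where "E z = (\<Sum>a\<le>M. r a z * (z ^ a * cnj z ^ (M - a)))" for z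
    obtain C where C: "\<And>z. cmod z \<le> 1 \<Longrightarrow> norm (E z) \<le> C * cmod z ^ M"
      using taylor_remainder_bound[of r M, OF r] unfolding E_def by blast
    \<comment> \<open>For \<open>cmod z \<le> 1 / \<Lambda>\<close> the first \<open>M\<close>
      cutoffs all equal 1, so these terms are exactly the prescribed polynomials.\<close>
    define \<Lambda> where "\<Lambda> = (\<Sum>d<M. L d) + 1"
    have \<Lambda>: "\<Lambda> \<ge> 1" "d < M \<Longrightarrow> L d \<le> \<Lambda>" for d
    proof -
      have "L d \<ge> 0" for d using L1[of d] by simp
      then show "\<Lambda> \<ge> 1" "d < M \<Longrightarrow> L d \<le> \<Lambda>"
        unfolding \<Lambda>_def using member_le_sum[of d "{..<M}" L] by (auto intro!: sum_nonneg)
    qed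
    have bound: "norm (\<Sum>d<M. hpoly d (t' d) z - hpoly d (t d) z) \<le> (A M + 2 + C) * cmod z ^ M" if z: "cmod z \<le> 1 / \<Lambda>" for z
    proof -
      have z1: "cmod z \<le> 1" using z \<Lambda>(1) by (smt (verit) divide_le_eq_1)
      have small: "y d z = hpoly d (t d) z" if d: "d < M" for d
      proof -
        have "cmod z * L d \<le> 1 / \<Lambda> * \<Lambda>"
          using z \<Lambda>(2)[OF d] L1[of d] \<Lambda>(1) by (intro mult_mono) auto
        then have "\<rho> (of_real (L d) * z) = 1"
          using \<Lambda>(1) L1[of d] by (intro \<rho>(2)) (auto simp: norm_mult mult.commute)
        then show ?thesis by (simp add: y_def)
      qed
      define N where "N = Suc M"
      have nt: "norm (y (d + N) z) \<le> (1/2) ^ d * cmod z ^ M" for d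
      proof -
        have "(1/2::real) ^ (d + N) \<le> (1/2) ^ d" by (rule power_decreasing) auto
        then have "(1/2) ^ (d + N) * cmod z ^ M \<le> (1/2) ^ d * cmod z ^ M" by (intro mult_right_mono) auto
        then show ?thesis using ytail[of M "d + N" z] z1 by (simp add: N_def)
      qed
      have sN: "summable (\<lambda>d. (1/2) ^ d * cmod z ^ M)" by (intro summable_mult2 half)
      have "summable (\<lambda>d. y (d + N) z)" by (rule summable_comparison_test'[OF sN nt])
      then have sy: "summable (\<lambda>d. y d z)" using summable_iff_shift[of "\<lambda>d. y d z" N] by blast
      have "\<zeta> z = (\<Sum>d. y (d + N) z) + (y M z + (\<Sum>d<M. y d z))"
        unfolding \<zeta>_def using suminf_split_initial_segment[OF sy, of N] by (simp add: N_def)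
      then have "(\<Sum>d<M. hpoly d (t' d) z - hpoly d (t d) z) = (\<Sum>d. y (d + N) z) + y M z - E z"
        using eq[of z] small unfolding E_def by (simp add: sum_subtractf algebra_simps)
      also have "norm \<dots> \<le> norm (\<Sum>d. y (d + N) z) + norm (y M z) + norm (E z)"
        by (rule order_trans[OF norm_triangle_ineq4 add_right_mono[OF norm_triangle_ineq]])
      also have "\<dots> \<le> 2 * cmod z ^ M + A M * cmod z ^ M + C * cmod z ^ M"
      proof (intro add_mono ybound C z1)
        have "norm (\<Sum>d. y (d + N) z) \<le> (\<Sum>d. (1/2) ^ d * cmod z ^ M)"
          by (rule norm_suminf_le[OF nt sN])
        also have "\<dots> = 2 * cmod z ^ M"
          using suminf_mult2[OF half, of "cmod z ^ M"] suminf_geometric[of "1/2::real"] by simp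
        finally show "norm (\<Sum>d. y (d + N) z) \<le> 2 * cmod z ^ M" .
      qed
      finally show ?thesis by (simp add: algebra_simps)
    qed
    show "\<exists>C r. r > 0 \<and> (\<forall>z. cmod z \<le> r \<longrightarrow> norm (\<Sum>d<M. hpoly d (t' d) z - hpoly d (t d) z) \<le> C * cmod z ^ M)"
      using bound \<Lambda>(1) by (intro exI[of _ "A M + 2 + C"] exI[of _ "1 / \<Lambda>"]) auto
  qed
  have "has_taylor \<zeta> t" using T eq unfolding has_taylor_def by simp
  then show ?thesis using that zsm zb by blast
qed

section \<open>Convolution of singular functions\<close>

lemma cmod_powr_measurable [measurable]: "(\<lambda>z::complex. cmod z powr c) \<in> borel_measurable borel"
  unfolding powr_def by measurable

definition wt :: "real \<Rightarrow> real \<Rightarrow> complex \<Rightarrow> real" where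
  "wt a R z = indicator (cball 0 R) z * cmod z powr (2 * a)"

lemma wt_nonneg [simp]: "0 \<le> wt a R z"
  by (simp add: wt_def)

lemma wt_measurable [measurable]: "wt a R \<in> borel_measurable borel"
  unfolding wt_def[abs_def] by (intro borel_measurable_times borel_measurable_indicator cmod_powr_measurable) auto

lemma nn_integral_abs_powr_finite:
  assumes "-1 < a" "0 \<le> R"
  shows "(\<integral>\<^sup>+x. ennreal (indicator {-R..R} x * \<bar>x\<bar> powr a) \<partial>lborel) < \<infinity>"
proof -
  define g :: "real \<Rightarrow> real" where "g x = indicator {0..R} x * x powr a" for x
  have [measurable]: "g \<in> borel_measurable borel" unfolding g_def[abs_def] by measurable
  have "((\<lambda>x. if x \<in> {0..R} then x powr a else 0) has_integral (R powr (a+1) / (a+1))) UNIV"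
    using has_integral_powr_from_0[OF assms] by (simp only: has_integral_restrict_UNIV)
  moreover have "g = (\<lambda>x. if x \<in> {0..R} then x powr a else 0)"
    by (auto simp: g_def)
  ultimately have "integral\<^sup>N lborel g = ennreal (R powr (a+1) / (a+1))"
    by (intro nn_integral_has_integral_lborel) (auto simp: g_def)
  then have fin: "integral\<^sup>N lborel g < \<infinity>" by simp
  have "integral\<^sup>N lborel g = (\<integral>\<^sup>+x. g (- x) \<partial>lborel)"
    using nn_integral_real_affine[of "\<lambda>x. ennreal (g x)" "-1" 0] by simp
  then have fin': "(\<integral>\<^sup>+x. g (- x) \<partial>lborel) < \<infinity>" using fin by simp
  have "(\<integral>\<^sup>+x. ennreal (indicator {-R..R} x * \<bar>x\<bar> powr a) \<partial>lborel) \<le> (\<integral>\<^sup>+x. ennreal (g x) + ennreal (g (- x)) \<partial>lborel)"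
    by (intro nn_integral_mono) (auto simp: g_def indicator_def)
  also have "\<dots> = integral\<^sup>N lborel g + (\<integral>\<^sup>+x. g (- x) \<partial>lborel)"
    by (intro nn_integral_add) auto
  also have "\<dots> < \<infinity>" using fin fin' by simp
  finally show ?thesis .
qed

text \<open>For \<open>a < 0\<close>, |Re z| |Im z| \<le> |z|^2 turns into |z|^(2a) \<le> |Re z|^a
  |Im z|^a, a product of one-dimensional powers that are locally integrable because
  \<open>a > -1\<close>.\<close>

lemma wt_integrable:
  assumes "-1 < a" "a < 0" "0 \<le> R"
  shows "integrable lborel (wt a R)"
proof -
  \<comment> \<open>The value \<infinity> at 0 keeps the product bound true on the axes, where
    \<open>0 powr a = 0\<close> would break it; it affects only a null set.\<close>
  define h :: "real \<Rightarrow> ennreal" where "h x = (if x = 0 then \<infinity> else ennreal (indicator {-R..R} x * \<bar>x\<bar> powr a))" for x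
  have [measurable]: "h \<in> borel_measurable borel" unfolding h_def[abs_def] by measurable
  have "(\<integral>\<^sup>+x. h x \<partial>lborel) = (\<integral>\<^sup>+x. ennreal (indicator {-R..R} x * \<bar>x\<bar> powr a) \<partial>lborel)"
    by (intro nn_integral_cong_AE) (use AE_lborel_singleton[of "0::real"] in \<open>auto simp: h_def elim!: eventually_mono\<close>)
  then have fin: "(\<integral>\<^sup>+x. h x \<partial>lborel) < \<infinity>"
    using nn_integral_abs_powr_finite[OF assms(1,3)] by simp
  have "(\<integral>\<^sup>+z. ennreal (wt a R z) \<partial>lborel) \<le> (\<integral>\<^sup>+z. (\<Prod>b\<in>(Basis::complex set). h (z \<bullet> b)) \<partial>lborel)"
  proof (intro nn_integral_mono)
    fix z :: complex
    have prod: "(\<Prod>b\<in>Basis. h (z \<bullet> b)) = h (Re z) * h (Im z)"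
      by (simp add: Basis_complex_def inner_complex_def)
    show "ennreal (wt a R z) \<le> (\<Prod>b\<in>Basis. h (z \<bullet> b))"
    proof (cases "cmod z \<le> R \<and> z \<noteq> 0")
      case True
      then have bd: "\<bar>Re z\<bar> \<le> R" "\<bar>Im z\<bar> \<le> R"
        using abs_Re_le_cmod[of z] abs_Im_le_cmod[of z] by auto
      show ?thesis
      proof (cases "Re z = 0 \<or> Im z = 0")
        case True
        have "h x > 0" if "\<bar>x\<bar> \<le> R" for x using that by (auto simp: h_def indicator_def abs_le_iff)
        then have "h (Re z) \<noteq> 0" "h (Im z) \<noteq> 0" using bd by (metis less_irrefl)+
        moreover have "h (Re z) = \<infinity> \<or> h (Im z) = \<infinity>" using True by (auto simp: h_def)
        ultimately have "h (Re z) * h (Im z) = \<infinity>"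
          by (auto simp: ennreal_top_mult ennreal_mult_top)
        then show ?thesis unfolding prod by simp
      next
        case False
        have "\<bar>Re z\<bar> * \<bar>Im z\<bar> \<le> (cmod z)\<^sup>2"
        proof -
          have "2 * (\<bar>Re z\<bar> * \<bar>Im z\<bar>) \<le> (cmod z)\<^sup>2"
            using sum_squares_bound[of "\<bar>Re z\<bar>" "\<bar>Im z\<bar>"] unfolding cmod_power2 by (simp add: mult.assoc)
          moreover have "0 \<le> \<bar>Re z\<bar> * \<bar>Im z\<bar>" by simp
          ultimately show ?thesis by linarith
        qed
        then have "((cmod z)\<^sup>2) powr a \<le> (\<bar>Re z\<bar> * \<bar>Im z\<bar>) powr a"
          using False assms by (intro powr_mono2') auto
        moreover have "((cmod z)\<^sup>2) powr a = cmod z powr (2 * a)"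
          by (simp add: powr_powr flip: powr_numeral)
        ultimately have "cmod z powr (2 * a) \<le> \<bar>Re z\<bar> powr a * \<bar>Im z\<bar> powr a"
          by (simp add: powr_mult)
        then show ?thesis
          unfolding prod using False bd True by (auto simp: h_def wt_def indicator_def abs_le_iff simp flip: ennreal_mult intro!: ennreal_leI)
      qed
    qed (auto simp: wt_def indicator_def)
  qed
  also have "\<dots> = (\<Prod>b\<in>(Basis::complex set). (\<integral>\<^sup>+x. h x \<partial>lborel))"
    by (rule nn_integral_lborel_prod) auto
  also have "\<dots> < \<infinity>"
    using fin by (simp add: Basis_complex_def ennreal_mult_less_top)
  finally show ?thesis
    by (intro integrableI_nonneg) auto
qed

lemma wt_mono:
  assumes "a' \<le> a" "0 < R" "R \<le> R'"
  shows "wt a R z \<le> R powr (2 * (a - a')) * wt a' R' z"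
proof (cases "cmod z \<le> R \<and> z \<noteq> 0")
  case True
  have "cmod z powr (2 * a) = cmod z powr (2 * (a - a')) * cmod z powr (2 * a')"
    by (simp flip: powr_add add: algebra_simps)
  also have "\<dots> \<le> R powr (2 * (a - a')) * cmod z powr (2 * a')"
    using True assms by (intro mult_right_mono powr_mono2) auto
  finally show ?thesis using True assms by (simp add: wt_def)
qed (auto simp: wt_def indicator_def)

text \<open>The bound is by a power above \<open>-2\<close>, hence integrable on the plane, and forces \<open>f 0 = 0\<close>
  since \<open>0 powr x = 0\<close>.\<close>

definition L1_sing :: "(complex \<Rightarrow> complex) \<Rightarrow> bool" where
  "L1_sing f \<longleftrightarrow> f \<in> borel_measurable borel \<and>
     (\<exists>a B R. -1 < a \<and> a < 0 \<and> 0 \<le> B \<and> 0 < R \<and> (\<forall>z. norm (f z) \<le> B * wt a R z))"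

lemma L1_sing_measurable: "L1_sing f \<Longrightarrow> f \<in> borel_measurable borel"
  by (simp add: L1_sing_def)

lemma L1_sing_integrable:
  assumes "L1_sing f"
  shows "integrable lborel f"
proof -
  obtain a B R where *: "-1 < a" "a < 0" "0 \<le> B" "0 < R" "\<And>z. norm (f z) \<le> B * wt a R z"
    using assms by (auto simp: L1_sing_def)
  show ?thesis
  proof (rule Bochner_Integration.integrable_bound)
    show "integrable lborel (\<lambda>z. B * wt a R z)"
      using * by (intro integrable_mult_right wt_integrable) auto
    show "AE z in lborel. norm (f z) \<le> norm (B * wt a R z)"
      using * by (intro AE_I2) (simp add: abs_mult)
  qed (use assms in \<open>simp add: L1_sing_def\<close>)
qed

lemma L1_sing_add:
  assumes "L1_sing f" "L1_sing g"
  shows "L1_sing (\<lambda>z. f z + g z)"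
proof -
  obtain a B R where f: "-1 < a" "a < 0" "0 \<le> B" "0 < R" "\<And>z. norm (f z) \<le> B * wt a R z"
    using assms by (auto simp: L1_sing_def)
  obtain a' B' R' where g: "-1 < a'" "a' < 0" "0 \<le> B'" "0 < R'" "\<And>z. norm (g z) \<le> B' * wt a' R' z"
    using assms by (auto simp: L1_sing_def)
  define m where "m = min a a'"
  define S where "S = max R R'"
  have "norm (f z + g z) \<le> (B * R powr (2 * (a - m)) + B' * R' powr (2 * (a' - m))) * wt m S z" for z
  proof -
    have "norm (f z + g z) \<le> B * wt a R z + B' * wt a' R' z"
      using f(5)[of z] g(5)[of z] by (intro norm_triangle_le) auto
    also have "\<dots> \<le> B * (R powr (2 * (a - m)) * wt m S z) + B' * (R' powr (2 * (a' - m)) * wt m S z)"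
      using f g by (intro add_mono mult_left_mono wt_mono) (auto simp: m_def S_def)
    finally show ?thesis by (simp add: algebra_simps)
  qed
  moreover have "(\<lambda>z. f z + g z) \<in> borel_measurable borel"
    using assms by (auto simp: L1_sing_def)
  ultimately show ?thesis unfolding L1_sing_def using f g
    by (intro conjI exI[of _ m] exI[of _ "B * R powr (2 * (a - m)) + B' * R' powr (2 * (a' - m))"] exI[of _ S])
       (auto simp: m_def S_def)
qed

lemma L1_sing_cmult:
  assumes "L1_sing f"
  shows "L1_sing (\<lambda>z. c * f z)"
proof -
  obtain a B R where f: "-1 < a" "a < 0" "0 \<le> B" "0 < R" "\<And>z. norm (f z) \<le> B * wt a R z"
    using assms by (auto simp: L1_sing_def)
  have "norm (c * f z) \<le> (norm c * B) * wt a R z" for z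
    using mult_left_mono[OF f(5)[of z], of "norm c"] by (simp add: norm_mult mult.assoc)
  moreover have "(\<lambda>z. c * f z) \<in> borel_measurable borel"
    using assms by (auto simp: L1_sing_def)
  ultimately show ?thesis unfolding L1_sing_def using f
    by (intro conjI exI[of _ a] exI[of _ "norm c * B"] exI[of _ R]) auto
qed

lemma K_measurable [measurable]: "K a b \<alpha> j \<in> borel_measurable borel"
proof -
  have [measurable]: "cnj \<in> borel_measurable borel"
    by (intro borel_measurable_continuous_onI continuous_intros)
  show ?thesis unfolding K_def[abs_def] by measurable
qed

lemma K_split: "K a b \<alpha> j z = of_real (cmod z powr (2 * a')) * K a b (\<alpha> - a') j z"
proof -
  have "cmod z powr (2 * \<alpha>) = cmod z powr (2 * a') * cmod z powr (2 * (\<alpha> - a'))"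
    by (simp flip: powr_add add: algebra_simps)
  then show ?thesis by (simp add: K_def mult_ac)
qed

text \<open>A pure power with exponent \<open>a'\<close> strictly between -1 and
  \<open>min \<alpha> 0\<close> is split off. What remains has positive degree, hence is continuous
  in spite of the logarithms, and is bounded on the support of \<open>\<psi>\<close>.\<close>

lemma L1_sing_mult_K:
  assumes "continuous_on UNIV \<psi>" "bdd_supp \<psi>" "\<alpha> > -1"
  shows "L1_sing (\<lambda>z. \<psi> z * K a b \<alpha> j z)"
proof -
  define a' where "a' = (-1 + min \<alpha> 0) / 2"
  have a': "-1 < a'" "a' < 0" "a' < \<alpha>" using assms(3) by (auto simp: a'_def min_def)
  obtain R where R: "\<And>z. R < norm z \<Longrightarrow> \<psi> z = 0" using assms(2) by (auto simp: bdd_supp_def)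
  have "continuous_on UNIV (\<lambda>z. \<psi> z * K a b (\<alpha> - a') j z)"
    using a' by (intro continuous_on_mult assms K_continuous) auto
  then obtain B where B: "B \<ge> 0" "\<And>z. norm (\<psi> z * K a b (\<alpha> - a') j z) \<le> B"
    using bdd_supp_bounded[OF bdd_supp_mult(1)[OF assms(2)]] by metis
  have "norm (\<psi> z * K a b \<alpha> j z) \<le> B * wt a' (max 1 R) z" for z
  proof (cases "cmod z \<le> max 1 R")
    case True
    have "norm (\<psi> z * K a b \<alpha> j z) = norm (\<psi> z * K a b (\<alpha> - a') j z) * cmod z powr (2 * a')"
      by (subst K_split[of _ _ _ _ _ a']) (simp add: norm_mult)
    also have "\<dots> \<le> B * cmod z powr (2 * a')" by (intro mult_right_mono B) auto
    finally show ?thesis using True by (simp add: wt_def)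
  next
    case False
    then show ?thesis using R[of z] B by (simp add: wt_def)
  qed
  moreover have "(\<lambda>z. \<psi> z * K a b \<alpha> j z) \<in> borel_measurable borel"
    using borel_measurable_continuous_onI[OF assms(1)] by measurable
  ultimately show ?thesis unfolding L1_sing_def using a' B
    by (intro conjI exI[of _ a'] exI[of _ B] exI[of _ "max 1 R"]) auto
qed

section \<open>Convolution, its regularity and its symmetries\<close>

definition conv :: "(complex \<Rightarrow> complex) \<Rightarrow> (complex \<Rightarrow> complex) \<Rightarrow> complex \<Rightarrow> complex" where
  "conv f g s = (LINT u|lborel. f (s - u) * g u)"

lemma lborel_distr_reflect: "distr lborel borel (\<lambda>u. s - u) = (lborel :: complex measure)"
  using lborel_affine[of "-1" s] by (simp add: density_1)

lemma integrable_reflect: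
  fixes f :: "complex \<Rightarrow> 'b::{banach, second_countable_topology}"
  assumes "integrable lborel f"
  shows "integrable lborel (\<lambda>u. f (s - u))"
  using assms integrable_distr_eq[of "\<lambda>u. s - u" lborel borel f]
  by (simp add: lborel_distr_reflect borel_measurable_integrable)

lemma conv_commute:
  assumes [measurable]: "f \<in> borel_measurable borel" "g \<in> borel_measurable borel"
  shows "conv f g s = conv g f s"
  using integral_distr[of "\<lambda>u. s - u" lborel borel "\<lambda>u. f (s - u) * g u"]
  by (simp add: lborel_distr_reflect conv_def mult.commute)

text \<open>One of \<open>u\<close> and \<open>s - u\<close> has modulus at least
  \<open>cmod s / 2\<close>, so one weight is bounded and the other integrable. At
  \<open>s = 0\<close> the two exponents would add up.\<close>

lemma wt_conv_integrable:
  assumes "-1 < a" "a < 0" "0 \<le> R" "-1 < b" "b < 0" "0 \<le> S" "s \<noteq> 0"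
  shows "integrable lborel (\<lambda>u. wt a R (s - u) * wt b S u)"
proof (rule Bochner_Integration.integrable_bound)
  let ?c = "(cmod s / 2) powr (2 * a)" and ?d = "(cmod s / 2) powr (2 * b)"
  show "integrable lborel (\<lambda>u. ?c * wt b S u + ?d * wt a R (s - u))"
    using assms by (intro Bochner_Integration.integrable_add integrable_mult_right wt_integrable integrable_reflect) auto
  have far: "wt x T z \<le> (cmod s / 2) powr (2 * x)" if "cmod z \<ge> cmod s / 2" "x < 0" for x T z
    using that assms(7) by (auto simp: wt_def indicator_def intro!: powr_mono2')
  show "AE u in lborel. norm (wt a R (s - u) * wt b S u) \<le> norm (?c * wt b S u + ?d * wt a R (s - u))"
  proof (intro AE_I2)
    fix u
    have "cmod s \<le> cmod (s - u) + cmod u" using norm_triangle_ineq[of "s - u" u] by simp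
    then consider "cmod (s - u) \<ge> cmod s / 2" | "cmod u \<ge> cmod s / 2" by linarith
    then have "wt a R (s - u) * wt b S u \<le> ?c * wt b S u + ?d * wt a R (s - u)"
    proof cases
      case 1
      then have "wt a R (s - u) * wt b S u \<le> ?c * wt b S u" using assms by (intro mult_right_mono far) auto
      then show ?thesis by (simp add: add_increasing2)
    next
      case 2
      then have "wt a R (s - u) * wt b S u \<le> wt a R (s - u) * ?d" using assms by (intro mult_left_mono far) auto
      then show ?thesis by (simp add: add_increasing mult.commute)
    qed
    then show "norm (wt a R (s - u) * wt b S u) \<le> norm (?c * wt b S u + ?d * wt a R (s - u))"
      by (simp add: abs_mult)
  qed
qed measurable

lemma conv_integrable:
  assumes "L1_sing f" "L1_sing g" "s \<noteq> 0"
  shows "integrable lborel (\<lambda>u. f (s - u) * g u)"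
proof -
  obtain a B R where f: "-1 < a" "a < 0" "0 \<le> B" "0 < R" "\<And>z. norm (f z) \<le> B * wt a R z"
    using assms by (auto simp: L1_sing_def)
  obtain a' B' R' where g: "-1 < a'" "a' < 0" "0 \<le> B'" "0 < R'" "\<And>z. norm (g z) \<le> B' * wt a' R' z"
    using assms by (auto simp: L1_sing_def)
  have [measurable]: "f \<in> borel_measurable borel" "g \<in> borel_measurable borel"
    using assms by (auto simp: L1_sing_def)
  show ?thesis
  proof (rule Bochner_Integration.integrable_bound)
    show "integrable lborel (\<lambda>u. (B * B') * (wt a R (s - u) * wt a' R' u))"
      using f g assms by (intro integrable_mult_right wt_conv_integrable) auto
    show "AE u in lborel. norm (f (s - u) * g u) \<le> norm ((B * B') * (wt a R (s - u) * wt a' R' u))"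
    proof (intro AE_I2)
      fix u
      have "norm (f (s - u) * g u) \<le> (B * wt a R (s - u)) * (B' * wt a' R' u)"
        unfolding norm_mult using f g by (intro mult_mono) auto
      then show "norm (f (s - u) * g u) \<le> norm ((B * B') * (wt a R (s - u) * wt a' R' u))"
        using f(3) g(3) by (simp add: abs_mult mult_ac)
    qed
  qed measurable
qed

lemma conv_add_left: "L1_sing f \<Longrightarrow> L1_sing f' \<Longrightarrow> L1_sing g \<Longrightarrow> s \<noteq> 0 \<Longrightarrow>
    conv (\<lambda>z. f z + f' z) g s = conv f g s + conv f' g s"
  unfolding conv_def by (simp add: distrib_right conv_integrable)

lemma conv_add_right: "L1_sing f \<Longrightarrow> L1_sing g \<Longrightarrow> L1_sing g' \<Longrightarrow> s \<noteq> 0 \<Longrightarrow>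
    conv f (\<lambda>z. g z + g' z) s = conv f g s + conv f g' s"
  unfolding conv_def by (simp add: distrib_left conv_integrable)

lemma conv_cmult_left: "conv (\<lambda>z. c * f z) g s = c * conv f g s"
  unfolding conv_def by (simp add: mult.assoc)

lemma conv_cmult_right: "conv f (\<lambda>z. c * g z) s = c * conv f g s"
  unfolding conv_def by (simp add: mult.left_commute)

text \<open>An affine mean with \<open>c = 1\<close> and \<open>b u = - u\<close>: all derivatives
  fall on \<open>f\<close>, and \<open>g\<close> only has to be integrable.\<close>

lemma Cn_conv:
  assumes "Cn n f" "bdd_supp f" "integrable lborel g"
  shows "Cn n (conv f g)"
proof -
  have "Cn n (\<lambda>z. LINT u|lborel. g u * f (of_real 1 * z + (- u)))"
    by (rule Cn_affine_mean) (use assms in auto)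
  then show ?thesis by (simp add: conv_def[abs_def] mult.commute)
qed

text \<open>Uniqueness of Haar measure: compare both sides after convolving with the indicator of
  the unit ball, which is rotation invariant.\<close>

lemma lborel_distr_rotate:
  fixes \<omega> :: complex
  assumes \<omega>: "cmod \<omega> = 1"
  shows "distr lborel borel (\<lambda>u. \<omega> * u) = lborel"
proof (rule measure_eqI)
  fix A assume "A \<in> sets (distr lborel borel (\<lambda>u. \<omega> * u))"
  then have A [measurable]: "A \<in> sets borel" by simp
  let ?f = "indicator A :: complex \<Rightarrow> ennreal" and ?g = "indicator (ball 0 1) :: complex \<Rightarrow> ennreal"
  let ?b = "emeasure lborel (ball (0::complex) 1)"
  have [measurable]: "?g \<in> borel_measurable borel"
    by (intro borel_measurable_indicator) simp
  have ball: "(\<integral>\<^sup>+y. ?g (y - x) \<partial>lborel) = ?b" for x :: complex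
  proof -
    have "(+) (- x) = (\<lambda>y. y - x)" by auto
    then have "distr lborel borel (\<lambda>y. y - x) = lborel" using lborel_distr_plus[of "- x"] by simp
    then show ?thesis using nn_integral_distr[of "\<lambda>y. y - x" lborel borel ?g] by simp
  qed
  have shift: "(\<integral>\<^sup>+x. h (x + c) \<partial>lborel) = (\<integral>\<^sup>+x. h x \<partial>lborel)" if "h \<in> borel_measurable borel" for h :: "complex \<Rightarrow> ennreal" and c
    using nn_integral_distr[of "(+) c" lborel borel h] lborel_distr_plus[of c] that
    by (simp add: add.commute[of _ c])
  have "(\<integral>\<^sup>+y. \<integral>\<^sup>+x. ?f (x + \<omega> * y) * ?g y \<partial>lborel \<partial>lborel) = (\<integral>\<^sup>+y. emeasure lborel A * ?g y \<partial>lborel)"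
    using shift[of ?f] by (intro nn_integral_cong) (simp add: nn_integral_multc)
  also have "\<dots> = emeasure lborel A * ?b"
    by (simp add: nn_integral_cmult)
  finally have 1: "(\<integral>\<^sup>+y. \<integral>\<^sup>+x. ?f (x + \<omega> * y) * ?g y \<partial>lborel \<partial>lborel) = emeasure lborel A * ?b" .
  have "(\<integral>\<^sup>+y. \<integral>\<^sup>+x. ?f (x + \<omega> * y) * ?g y \<partial>lborel \<partial>lborel)
      = (\<integral>\<^sup>+x. \<integral>\<^sup>+y. ?f (x + \<omega> * y) * ?g y \<partial>lborel \<partial>lborel)"
    by (rule lborel_pair.Fubini') measurable
  \<comment> \<open>Shifting \<open>y\<close> frees the argument of \<open>?f\<close> from
    \<open>x\<close>; the ball, being rotation invariant, then lets \<open>x\<close> be integrated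
    away.\<close>
  also have "\<dots> = (\<integral>\<^sup>+x. \<integral>\<^sup>+y. ?f (\<omega> * y) * ?g (y - x / \<omega>) \<partial>lborel \<partial>lborel)"
  proof (rule nn_integral_cong)
    fix x
    have "(\<integral>\<^sup>+y. ?f (\<omega> * y) * ?g (y - x / \<omega>) \<partial>lborel) = (\<integral>\<^sup>+y. ?f (\<omega> * (y + x / \<omega>)) * ?g (y + x / \<omega> - x / \<omega>) \<partial>lborel)"
      by (rule shift[symmetric]) measurable
    moreover have "\<omega> * (y + x / \<omega>) = x + \<omega> * y" for y
      using \<omega> by (auto simp: algebra_simps)
    ultimately show "(\<integral>\<^sup>+y. ?f (x + \<omega> * y) * ?g y \<partial>lborel) = (\<integral>\<^sup>+y. ?f (\<omega> * y) * ?g (y - x / \<omega>) \<partial>lborel)"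
      by simp
  qed
  also have "\<dots> = (\<integral>\<^sup>+y. \<integral>\<^sup>+x. ?f (\<omega> * y) * ?g (y - x / \<omega>) \<partial>lborel \<partial>lborel)"
    by (rule lborel_pair.Fubini'[symmetric]) measurable
  also have "\<dots> = (\<integral>\<^sup>+y. ?f (\<omega> * y) * ?b \<partial>lborel)"
  proof (rule nn_integral_cong)
    fix y
    have "cmod (y - x / \<omega>) = cmod (x - \<omega> * y)" for x
    proof -
      have "cmod (x - \<omega> * y) = cmod \<omega> * cmod (y - x / \<omega>)"
        unfolding norm_mult[symmetric] using \<omega> by (subst norm_minus_commute) (auto simp: algebra_simps)
      then show ?thesis using \<omega> by simp
    qed
    then have "?g (y - x / \<omega>) = ?g (x - \<omega> * y)" for x by (simp add: indicator_def)
    then show "(\<integral>\<^sup>+x. ?f (\<omega> * y) * ?g (y - x / \<omega>) \<partial>lborel) = ?f (\<omega> * y) * ?b"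
      using ball by (simp add: nn_integral_cmult)
  qed
  also have "\<dots> = (\<integral>\<^sup>+y. ?f (\<omega> * y) \<partial>lborel) * ?b"
    by (intro nn_integral_multc) measurable
  also have "(\<integral>\<^sup>+y. ?f (\<omega> * y) \<partial>lborel) = emeasure (distr lborel borel (\<lambda>u. \<omega> * u)) A"
    by (subst nn_integral_distr[symmetric, of "\<lambda>u. \<omega> * u" lborel borel]) auto
  finally have "emeasure (distr lborel borel (\<lambda>u. \<omega> * u)) A * ?b = emeasure lborel A * ?b"
    using 1 by simp
  moreover have "?b < \<infinity>"
    using emeasure_lborel_ball_finite by blast
  moreover have "?b \<noteq> 0"
    using content_ball_pos[of "1::real" "0::complex"] by (auto simp: measure_def)
  ultimately show "emeasure (distr lborel borel (\<lambda>u. \<omega> * u)) A = emeasure lborel A"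
    by (auto simp: mult.commute[of _ ?b] ennreal_mult_cancel_left)
qed simp

lemma conv_eqv:
  assumes [measurable]: "f \<in> borel_measurable borel" "g \<in> borel_measurable borel"
    and "cmod \<omega> = 1" "\<And>z. f (\<omega> * z) = c * f z" "\<And>z. g (\<omega> * z) = d * g z"
  shows "conv f g (\<omega> * s) = c * d * conv f g s"
proof -
  have "conv f g (\<omega> * s) = (LINT u|distr lborel borel (\<lambda>u. \<omega> * u). f (\<omega> * s - u) * g u)"
    by (simp add: lborel_distr_rotate[OF assms(3)] conv_def)
  also have "\<dots> = (LINT u|lborel. f (\<omega> * s - \<omega> * u) * g (\<omega> * u))"
    by (rule integral_distr) measurable
  also have "\<dots> = (LINT u|lborel. (c * d) * (f (s - u) * g u))"
    unfolding right_diff_distrib[symmetric] assms(4,5) by (simp only: mult_ac)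
  finally show ?thesis by (simp add: conv_def)
qed

lemma conv_scale:
  assumes [measurable]: "f \<in> borel_measurable borel" "g \<in> borel_measurable borel" and "t > 0"
  shows "conv f g (of_real t * s) = of_real t ^ 2 * (LINT u|lborel. f (of_real t * (s - u)) * g (of_real t * u))"
proof -
  have "lborel = density (distr lborel borel (\<lambda>x::complex. 0 + t *\<^sub>R x)) (\<lambda>_. ennreal (\<bar>t\<bar> ^ DIM(complex)))"
    using lborel_affine[of t "0::complex"] assms by (simp add: ennreal_power)
  then have "conv f g (of_real t * s) = (LINT u|density (distr lborel borel (\<lambda>x::complex. 0 + t *\<^sub>R x)) (\<lambda>_. ennreal (t ^ 2)). f (of_real t * s - u) * g u)"
    using assms by (simp add: conv_def)
  also have "\<dots> = (LINT u|distr lborel borel (\<lambda>x::complex. 0 + t *\<^sub>R x). t ^ 2 *\<^sub>R (f (of_real t * s - u) * g u))"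
    by (rule integral_density) auto
  also have "\<dots> = (LINT u|lborel. t ^ 2 *\<^sub>R (f (of_real t * s - (0 + t *\<^sub>R u)) * g (0 + t *\<^sub>R u)))"
    by (rule integral_distr) auto
  finally show ?thesis by (simp add: scaleR_conv_of_real right_diff_distrib)
qed

section \<open>Radial derivatives\<close>

text \<open>The Euler field at \<open>z\<close>, encoded as a one-variable derivative because model
  convolutions are shown to be differentiable along rays only.\<close>

definition has_radial :: "(complex \<Rightarrow> complex) \<Rightarrow> complex \<Rightarrow> complex \<Rightarrow> bool" where
  "has_radial f D z \<longleftrightarrow> ((\<lambda>t. f (of_real t * z)) has_vector_derivative D) (at (1::real))"

lemma has_radial_add: "has_radial f D z \<Longrightarrow> has_radial g E z \<Longrightarrow> has_radial (\<lambda>z. f z + g z) (D + E) z"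
  unfolding has_radial_def by (rule has_vector_derivative_add)

lemma has_radial_diff: "has_radial f D z \<Longrightarrow> has_radial g E z \<Longrightarrow> has_radial (\<lambda>z. f z - g z) (D - E) z"
  unfolding has_radial_def by (rule has_vector_derivative_diff)

lemma has_radial_mult: "has_radial f D z \<Longrightarrow> has_radial g E z \<Longrightarrow> has_radial (\<lambda>z. f z * g z) (f z * E + D * g z) z"
  unfolding has_radial_def using has_vector_derivative_mult[of "\<lambda>t. f (of_real t * z)" D 1 UNIV "\<lambda>t. g (of_real t * z)" E] by simp

lemma has_radial_cmult: "has_radial f D z \<Longrightarrow> has_radial (\<lambda>z. c * f z) (c * D) z"
  unfolding has_radial_def by (rule has_vector_derivative_mult_right)

lemma has_radial_sum: "(\<And>i. i \<in> I \<Longrightarrow> has_radial (f i) (D i) z) \<Longrightarrow> has_radial (\<lambda>z. \<Sum>i\<in>I. f i z) (\<Sum>i\<in>I. D i) z"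
  unfolding has_radial_def by (rule has_vector_derivative_sum)

lemma has_radial_smooth: "smooth f \<Longrightarrow> has_radial f (Dv z f z) z"
  unfolding has_radial_def using ray_vector_derivative[of f z 1] by simp

lemma has_radial_K:
  assumes "z \<noteq> 0"
  shows "has_radial (K a b \<alpha> j) (of_real (a + b + 2 * \<alpha>) * K a b \<alpha> j z + 2 * of_nat j * K a b \<alpha> (j - 1) z) z"
proof -
  have "((\<lambda>t. of_real t * z) has_derivative (\<lambda>h. of_real h * z)) (at (1::real))"
    by (auto intro!: derivative_eq_intros)
  moreover have "(K a b \<alpha> j has_derivative dK a b \<alpha> j (of_real 1 * z)) (at (of_real 1 * z))"
    using K_has_derivative[OF assms] by simp
  ultimately have "((\<lambda>t. K a b \<alpha> j (of_real t * z)) has_derivative (\<lambda>h. dK a b \<alpha> j (of_real 1 * z) (of_real h * z))) (at (1::real))"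
    by (rule has_derivative_compose)
  moreover have "dK a b \<alpha> j (of_real 1 * z) (of_real h * z) = h *\<^sub>R dK a b \<alpha> j z z" for h
    by (simp add: dK_def scaleR_conv_of_real algebra_simps)
  ultimately show ?thesis
    unfolding has_radial_def has_vector_derivative_def dK_radial[symmetric] by simp
qed

lemma has_radial_homogeneous:
  assumes "\<And>t. t > 0 \<Longrightarrow> f (of_real t * z) = of_real t ^ d * f z"
  shows "has_radial f (of_nat d * f z) z"
proof -
  have "((\<lambda>t. of_real t ^ d * f z) has_vector_derivative (of_nat d * f z)) (at (1::real))"
    by (auto intro!: derivative_eq_intros simp: has_vector_derivative_def scaleR_conv_of_real)
  then show ?thesis
    unfolding has_radial_def
    by (rule has_vector_derivative_transform_within_open[of _ _ _ "{0<..}"]) (use assms in auto)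
qed

text \<open>The radial derivative at the point \<open>t z\<close> rescales to the derivative at
  parameter \<open>t\<close>; the chain rule contributes \<open>1 / t\<close>.\<close>

lemma has_radial_at:
  assumes "has_radial f D (of_real t * z)" "t > 0"
  shows "((\<lambda>t. f (of_real t * z)) has_vector_derivative D / of_real t) (at t)"
proof -
  have "((\<lambda>x. x / t) has_vector_derivative 1 / t) (at t)"
    using assms(2) by (auto intro!: derivative_eq_intros simp: has_vector_derivative_def)
  moreover have "((\<lambda>x. f (of_real x * (of_real t * z))) has_vector_derivative D) (at (t / t))"
    using assms by (simp add: has_radial_def)
  ultimately have "((\<lambda>x. f (of_real x * (of_real t * z))) \<circ> (\<lambda>x. x / t) has_vector_derivative (1 / t) *\<^sub>R D) (at t)"
    by (rule vector_diff_chain_at)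
  then show ?thesis
    using assms(2) by (simp add: o_def scaleR_conv_of_real)
qed

text \<open>The constant 4 is \<open>(1/2) powr (-2)\<close>, which bounds
  \<open>t powr (2 * a)\<close> when \<open>t \<ge> 1/2\<close> and \<open>-1 < a < 0\<close>; for
  such \<open>t\<close> the support radius at most doubles.\<close>

lemma wt_scale:
  assumes "-1 < a" "a < 0" "1/2 \<le> t"
  shows "wt a R (of_real t * z) \<le> 4 * wt a (2 * R) z"
proof (cases "cmod (of_real t * z) \<le> R \<and> z \<noteq> 0")
  case True
  then have "t * cmod z \<le> R" using assms by (simp add: norm_mult)
  moreover have "1/2 * cmod z \<le> t * cmod z" using assms by (intro mult_right_mono) auto
  ultimately have z: "cmod z \<le> 2 * R" by simp
  have "t powr (2 * a) \<le> (1/2) powr (2 * a)" using assms by (intro powr_mono2') auto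
  also have "\<dots> \<le> (1/2) powr (-2)" using assms by (intro powr_mono') auto
  also have "\<dots> = 4" by (simp add: powr_minus power_divide)
  finally have "t powr (2 * a) * cmod z powr (2 * a) \<le> 4 * cmod z powr (2 * a)"
    by (intro mult_right_mono) auto
  then show ?thesis using True z assms by (simp add: wt_def norm_mult powr_mult)
qed (auto simp: wt_def indicator_def)

text \<open>One weight for both functions and all dilations by \<open>t \<ge> 1/2\<close> serves to
  dominate the integrand near \<open>t = 1\<close>. The norms are viewed as complex functions so
  that \<open>L1_sing_add\<close> can merge the two weights.\<close>

lemma L1_sing_common_bound:
  assumes "L1_sing f" "L1_sing f'"
  obtains a B R where "-1 < a" "a < 0" "0 \<le> B" "0 < R"
    "\<And>t z. 1/2 \<le> t \<Longrightarrow> norm (f (of_real t * z)) \<le> B * wt a R z"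
    "\<And>t z. 1/2 \<le> t \<Longrightarrow> norm (f' (of_real t * z)) \<le> B * wt a R z"
proof -
  have n: "L1_sing (\<lambda>z. of_real (norm (h z)))" if h: "L1_sing h" for h
  proof -
    have "(\<lambda>z. complex_of_real (norm (h z))) \<in> borel_measurable borel"
      using L1_sing_measurable[OF h] by measurable
    then show ?thesis using h unfolding L1_sing_def by simp
  qed
  obtain a B R where *: "-1 < a" "a < 0" "0 \<le> B" "0 < R"
    "\<And>z. norm (complex_of_real (norm (f z)) + of_real (norm (f' z))) \<le> B * wt a R z"
    using L1_sing_add[OF n[OF assms(1)] n[OF assms(2)]] unfolding L1_sing_def by auto
  have b: "norm (f z) + norm (f' z) \<le> B * wt a R z" for z
    using *(5)[of z] by (simp flip: of_real_add)
  have "norm (f (of_real t * z)) \<le> (B * 4) * wt a (2 * R) z" "norm (f' (of_real t * z)) \<le> (B * 4) * wt a (2 * R) z"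
    if "1/2 \<le> t" for t z
  proof -
    have "B * wt a R (of_real t * z) \<le> B * (4 * wt a (2 * R) z)"
      using * that by (intro mult_left_mono wt_scale) auto
    then show "norm (f (of_real t * z)) \<le> (B * 4) * wt a (2 * R) z" "norm (f' (of_real t * z)) \<le> (B * 4) * wt a (2 * R) z"
      using b[of "of_real t * z"] norm_ge_zero[of "f (of_real t * z)"] norm_ge_zero[of "f' (of_real t * z)"] by linarith+
  qed
  then show ?thesis using * by (intro that[of a "B * 4" "2 * R"]) auto
qed

text \<open>Substituting \<open>t u\<close> for \<open>u\<close> moves the dilation into both
  factors and creates the Jacobian \<open>t^2\<close>, whose derivative is the source of
  \<open>2 * conv f g s\<close>. Both factors are then differentiated only along rays.\<close>

lemma conv_has_radial:
  assumes f: "L1_sing f" and f': "L1_sing f'" and g: "L1_sing g" and g': "L1_sing g'"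
    and df: "\<And>z. z \<noteq> 0 \<Longrightarrow> has_radial f (f' z) z"
    and dg: "\<And>z. z \<noteq> 0 \<Longrightarrow> has_radial g (g' z) z"
    and s: "s \<noteq> 0"
  shows "has_radial (conv f g) (2 * conv f g s + conv f' g s + conv f g' s) s"
proof -
  note [measurable] = L1_sing_measurable[OF f] L1_sing_measurable[OF f'] L1_sing_measurable[OF g] L1_sing_measurable[OF g']
  obtain a B R where F: "-1 < a" "a < 0" "0 \<le> B" "0 < R"
    "\<And>t z. 1/2 \<le> t \<Longrightarrow> norm (f (of_real t * z)) \<le> B * wt a R z"
    "\<And>t z. 1/2 \<le> t \<Longrightarrow> norm (f' (of_real t * z)) \<le> B * wt a R z"
    using L1_sing_common_bound[OF f f'] by blast
  obtain b C S where G: "-1 < b" "b < 0" "0 \<le> C" "0 < S"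
    "\<And>t z. 1/2 \<le> t \<Longrightarrow> norm (g (of_real t * z)) \<le> C * wt b S z"
    "\<And>t z. 1/2 \<le> t \<Longrightarrow> norm (g' (of_real t * z)) \<le> C * wt b S z"
    using L1_sing_common_bound[OF g g'] by blast
  \<comment> \<open>The factor 4 accounts for the two terms of the product rule and for
    \<open>1 / t \<le> 2\<close>.\<close>
  define W where "W u = 4 * (B * wt a R (s - u)) * (C * wt b S u)" for u
  have Wint: "integrable lborel W"
  proof -
    have "integrable lborel (\<lambda>u. (4 * B * C) * (wt a R (s - u) * wt b S u))"
      using F G s by (intro integrable_mult_right wt_conv_integrable) auto
    then show ?thesis by (simp add: W_def[abs_def] mult_ac)
  qed
  define h where "h t u = f (of_real t * (s - u)) * g (of_real t * u)" for t :: real and u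
  define h' where "h' t u = f (of_real t * (s - u)) * (g' (of_real t * u) / of_real t) + (f' (of_real t * (s - u)) / of_real t) * g (of_real t * u)" for t :: real and u
  have der: "((\<lambda>t. h t u) has_vector_derivative h' t u) (at t)" if "t > 0" "u \<noteq> 0" "u \<noteq> s" for t u
    unfolding h_def h'_def
    by (rule has_vector_derivative_mult[OF has_radial_at[OF df] has_radial_at[OF dg]]) (use that in auto)
  have hb: "norm (h t u) \<le> W u" if "1/2 \<le> t" for t u
  proof -
    have "norm (h t u) \<le> (B * wt a R (s - u)) * (C * wt b S u)"
      unfolding h_def norm_mult using F G that by (intro mult_mono) auto
    also have "\<dots> \<le> W u" using F G by (simp add: W_def)
    finally show ?thesis .
  qed
  have h'b: "norm (h' t u) \<le> W u" if t: "1/2 \<le> t" for t u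
  proof -
    let ?P = "(B * wt a R (s - u)) * (C * wt b S u)"
    have P0: "?P \<ge> 0" using F G by simp
    have "norm (f (of_real t * (s - u))) * norm (g' (of_real t * u)) \<le> ?P"
      "norm (f' (of_real t * (s - u))) * norm (g (of_real t * u)) \<le> ?P"
      using F G that by (intro mult_mono; simp)+
    then have "(norm (f (of_real t * (s - u))) * norm (g' (of_real t * u)) +
       norm (f' (of_real t * (s - u))) * norm (g (of_real t * u))) / t \<le> (?P + ?P) / t"
      using t by (intro divide_right_mono add_mono) auto
    moreover have "norm (h' t u) \<le> (norm (f (of_real t * (s - u))) * norm (g' (of_real t * u)) +
       norm (f' (of_real t * (s - u))) * norm (g (of_real t * u))) / t"
      unfolding h'_def using t by (intro norm_triangle_le) (simp add: norm_mult norm_divide add_divide_distrib)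
    ultimately have "norm (h' t u) \<le> (?P + ?P) / t" by (rule order_trans[rotated])
    also have "\<dots> \<le> (?P + ?P) / (1/2)" using t by (intro divide_left_mono add_nonneg_nonneg P0) auto
    also have "\<dots> = W u" by (simp add: W_def)
    finally show ?thesis .
  qed
  have ae: "AE u in lborel. u \<noteq> 0 \<and> u \<noteq> s"
    using AE_lborel_singleton[of "0::complex"] AE_lborel_singleton[of s] by eventually_elim auto
  have "((\<lambda>t. LINT u|lborel. h t u) has_derivative (\<lambda>v. LINT u|lborel. v *\<^sub>R h' 1 u)) (at 1)"
  proof (rule has_derivative_integral_dominated[where d = "1/2" and w = W])
    have ball: "1/2 \<le> t" if "t \<in> ball 1 (1/2)" for t :: real
      using that unfolding mem_ball dist_real_def by linarith
    show "integrable lborel (h t)" if "t \<in> ball 1 (1/2)" for t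
    proof (rule Bochner_Integration.integrable_bound[OF Wint])
      show "h t \<in> borel_measurable lborel" unfolding h_def[abs_def] by measurable
      show "AE u in lborel. norm (h t u) \<le> norm (W u)"
        using hb[OF ball[OF that]] by (intro AE_I2) (metis abs_ge_self order_trans real_norm_def)
    qed
    show "AE u in lborel. ((\<lambda>t. h t u) has_derivative (\<lambda>v. v *\<^sub>R h' 1 u)) (at 1)"
      using ae by eventually_elim (use der[of 1] in \<open>simp add: has_vector_derivative_def\<close>)
    show "(\<lambda>u. v *\<^sub>R h' 1 u) \<in> borel_measurable lborel" for v
      unfolding h'_def by measurable
    show "integrable lborel W" by (rule Wint)
    show "AE u in lborel. norm (v *\<^sub>R h' 1 u) \<le> W u * norm v" for v
      using h'b[of 1] by (intro AE_I2) (simp add: mult.commute mult_left_mono)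
    fix t :: real assume t: "t \<in> ball 1 (1/2)"
    show "AE u in lborel. norm (h t u - h 1 u) \<le> W u * norm (t - 1)"
      using ae
    proof eventually_elim
      case (elim u)
      show ?case
      proof (rule differentiable_bound[of "ball 1 (1/2)" "\<lambda>t. h t u" "\<lambda>t v. v *\<^sub>R h' t u"])
        fix x :: real assume x: "x \<in> ball 1 (1/2)"
        have "x > 0" using ball[OF x] by simp
        then show "((\<lambda>t. h t u) has_derivative (\<lambda>v. v *\<^sub>R h' x u)) (at x within ball 1 (1/2))"
          using der[of x u] elim by (simp add: has_vector_derivative_def has_derivative_at_withinI)
        show "onorm (\<lambda>v. v *\<^sub>R h' x u) \<le> W u"
          using h'b[OF ball[OF x], of u] order_trans[OF norm_ge_zero h'b[OF ball[OF x], of u]]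
          by (intro onorm_bound) (auto simp: mult.commute intro: mult_left_mono)
      qed (use t in auto)
    qed
  qed simp
  then have "((\<lambda>t. LINT u|lborel. h t u) has_vector_derivative (LINT u|lborel. h' 1 u)) (at 1)"
    unfolding has_vector_derivative_def by simp
  moreover have "((\<lambda>t. complex_of_real t ^ 2) has_vector_derivative 2) (at 1)"
    by (auto intro!: derivative_eq_intros simp: has_vector_derivative_def scaleR_conv_of_real)
  ultimately have "((\<lambda>t. of_real t ^ 2 * (LINT u|lborel. h t u)) has_vector_derivative
      (of_real 1 ^ 2 * (LINT u|lborel. h' 1 u) + 2 * (LINT u|lborel. h 1 u))) (at 1)"
    by (intro has_vector_derivative_mult)
  moreover have "(LINT u|lborel. h' 1 u) = conv f g' s + conv f' g s"
    unfolding conv_def h'_def using conv_integrable[OF f g' s] conv_integrable[OF f' g s] by simp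
  moreover have "(LINT u|lborel. h 1 u) = conv f g s"
    unfolding conv_def h_def by simp
  ultimately have "((\<lambda>t. of_real t ^ 2 * (LINT u|lborel. h t u)) has_vector_derivative
      (2 * conv f g s + conv f' g s + conv f g' s)) (at 1)"
    by (simp add: algebra_simps)
  then show ?thesis
    unfolding has_radial_def
    by (rule has_vector_derivative_transform_within_open[of _ _ _ "{0<..}"])
       (auto simp: h_def conv_scale)
qed

section \<open>The radial equation\<close>

text \<open>Here \<open>n\<close> counts terms, so \<open>n = 0\<close> says that \<open>H\<close>
  extends smoothly across 0. Constant coefficients suffice for the models because of their exact
  equivariance.\<close>

definition K_expansion :: "nat \<Rightarrow> nat \<Rightarrow> real \<Rightarrow> nat \<Rightarrow> (complex \<Rightarrow> complex) \<Rightarrow> bool" where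
  "K_expansion p q \<gamma> n H \<longleftrightarrow>
     (\<exists>c \<xi>. smooth \<xi> \<and> (\<forall>s. s \<noteq> 0 \<longrightarrow> H s = (\<Sum>l<n. c l * K p q \<gamma> l s) + \<xi> s))"

lemma K_expansion_mono:
  assumes "K_expansion p q \<gamma> n H" "n \<le> m"
  shows "K_expansion p q \<gamma> m H"
proof -
  obtain c \<xi> where 1: "smooth \<xi>" "\<And>s. s \<noteq> 0 \<Longrightarrow> H s = (\<Sum>l<n. c l * K p q \<gamma> l s) + \<xi> s"
    using assms(1) unfolding K_expansion_def by blast
  have "(\<Sum>l<n. c l * K p q \<gamma> l s) = (\<Sum>l<m. (if l < n then c l else 0) * K p q \<gamma> l s)" for s
    by (rule sum.mono_neutral_cong_left) (use assms(2) in auto)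
  then show ?thesis
    unfolding K_expansion_def using 1 by (intro exI[of _ "\<lambda>l. if l < n then c l else 0"] exI[of _ \<xi>]) simp
qed

lemma K_expansion_add:
  assumes "K_expansion p q \<gamma> n H" "K_expansion p q \<gamma> n G"
  shows "K_expansion p q \<gamma> n (\<lambda>s. H s + G s)"
proof -
  obtain c \<xi> where 1: "smooth \<xi>" "\<And>s. s \<noteq> 0 \<Longrightarrow> H s = (\<Sum>l<n. c l * K p q \<gamma> l s) + \<xi> s"
    using assms(1) unfolding K_expansion_def by blast
  obtain d \<eta> where 2: "smooth \<eta>" "\<And>s. s \<noteq> 0 \<Longrightarrow> G s = (\<Sum>l<n. d l * K p q \<gamma> l s) + \<eta> s"
    using assms(2) unfolding K_expansion_def by blast
  show ?thesis
    unfolding K_expansion_def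
    by (intro exI[of _ "\<lambda>l. c l + d l"] exI[of _ "\<lambda>s. \<xi> s + \<eta> s"])
       (use 1 2 in \<open>auto intro: smooth_intros simp: distrib_right sum.distrib\<close>)
qed

lemma K_expansion_cmult:
  assumes "K_expansion p q \<gamma> n H"
  shows "K_expansion p q \<gamma> n (\<lambda>s. x * H s)"
proof -
  obtain c \<xi> where 1: "smooth \<xi>" "\<And>s. s \<noteq> 0 \<Longrightarrow> H s = (\<Sum>l<n. c l * K p q \<gamma> l s) + \<xi> s"
    using assms(1) unfolding K_expansion_def by blast
  show ?thesis
    unfolding K_expansion_def
    by (intro exI[of _ "\<lambda>l. x * c l"] exI[of _ "\<lambda>s. x * \<xi> s"])
       (use 1 in \<open>auto intro: smooth_intros simp: distrib_left sum_distrib_left mult.assoc\<close>)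
qed

lemma K_expansion_smooth: "smooth \<xi> \<Longrightarrow> (\<And>s. s \<noteq> 0 \<Longrightarrow> H s = \<xi> s) \<Longrightarrow> K_expansion p q \<gamma> n H"
  unfolding K_expansion_def by (intro exI[of _ "\<lambda>_. 0"] exI[of _ \<xi>]) simp

text \<open>Along a ray, \<open>t powr - \<kappa> * G (t \<omega>)\<close> has derivative
  zero.\<close>

lemma radial_homogeneous_solution:
  assumes ode: "\<And>s. s \<noteq> 0 \<Longrightarrow> has_radial G (of_real \<kappa> * G s) s" and s: "s \<noteq> 0"
  shows "G s = of_real (cmod s powr \<kappa>) * G (s / of_real (cmod s))"
proof -
  define \<omega> where "\<omega> = s / of_real (cmod s)"
  have \<omega>: "\<omega> \<noteq> 0" using s by (simp add: \<omega>_def)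
  define F where "F t = of_real (t powr - \<kappa>) * G (of_real t * \<omega>)" for t :: real
  have der: "(F has_vector_derivative 0) (at t)" if t: "t > 0" for t
  proof -
    have "((\<lambda>t. t powr - \<kappa>) has_real_derivative (- \<kappa> * t powr (- \<kappa> - 1))) (at t)"
      using t by (auto intro!: derivative_eq_intros)
    then have "((\<lambda>t. complex_of_real (t powr - \<kappa>)) has_vector_derivative of_real (- \<kappa> * t powr (- \<kappa> - 1))) (at t)"
      by (intro has_vector_derivative_of_real) (simp add: has_real_derivative_iff_has_vector_derivative)
    from has_vector_derivative_mult[OF this has_radial_at[OF ode t, of \<omega>]]
    have "(F has_vector_derivative (of_real (t powr - \<kappa>) * (of_real \<kappa> * G (of_real t * \<omega>) / of_real t)
        + of_real (- \<kappa> * t powr (- \<kappa> - 1)) * G (of_real t * \<omega>))) (at t)"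
      using t \<omega> by (simp add: F_def[abs_def])
    moreover have "of_real (t powr - \<kappa>) * (of_real \<kappa> * G (of_real t * \<omega>) / of_real t)
        + of_real (- \<kappa> * t powr (- \<kappa> - 1)) * G (of_real t * \<omega>) = 0"
      using t by (simp add: powr_diff field_simps)
    ultimately show ?thesis by simp
  qed
  have "F (cmod s) = F 1"
  proof (rule has_derivative_zero_unique[of "{0<..}" F])
    show "(F has_derivative (\<lambda>h. 0)) (at t within {0<..})" if "t \<in> {0<..}" for t
      using der[of t] that by (auto simp: has_vector_derivative_def intro: has_derivative_at_withinI)
  qed (use s in auto)
  moreover have "of_real (cmod s) * \<omega> = s" using s by (simp add: \<omega>_def)
  ultimately have "of_real (cmod s powr - \<kappa>) * G s = G \<omega>" by (simp add: F_def)
  then have "of_real (cmod s powr \<kappa>) * (of_real (cmod s powr - \<kappa>) * G s) = of_real (cmod s powr \<kappa>) * G \<omega>" by simp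
  then show ?thesis using s by (simp add: \<omega>_def powr_minus flip: mult.assoc)
qed

text \<open>Homogeneity reduces to the unit circle, equivariance to the point 1, leaving the single
  constant \<open>G 1\<close>.\<close>

lemma eqv_homogeneous_eq_K:
  assumes G: "\<And>s. s \<noteq> 0 \<Longrightarrow> G s = of_real (cmod s powr (real p + real q + 2 * \<gamma>)) * G (s / of_real (cmod s))"
    and eqv: "\<And>\<omega>. cmod \<omega> = 1 \<Longrightarrow> G \<omega> = \<omega> ^ p * cnj \<omega> ^ q * G 1"
    and s: "s \<noteq> 0"
  shows "G s = G 1 * K p q \<gamma> 0 s"
proof -
  define r where "r = cmod s"
  define \<omega> where "\<omega> = s / of_real r"
  have r: "r > 0" and \<omega>: "cmod \<omega> = 1" "s = of_real r * \<omega>"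
    using s by (auto simp: r_def \<omega>_def norm_divide)
  have "K p q \<gamma> 0 s = of_real (r ^ p * r ^ q * r powr (2 * \<gamma>)) * (\<omega> ^ p * cnj \<omega> ^ q)"
    using r \<omega> by (simp add: K_def norm_mult power_mult_distrib mult_ac)
  also have "r ^ p * r ^ q * r powr (2 * \<gamma>) = r powr (real p + real q + 2 * \<gamma>)"
    using r by (simp add: powr_add powr_realpow)
  finally show ?thesis
    using G[OF s] eqv[OF \<omega>(1)] by (simp add: r_def[symmetric] \<omega>_def[symmetric] mult_ac)
qed

text \<open>A homogeneous Taylor component of degree \<open>\<kappa>\<close> of the smooth right-hand side is the only one that
  cannot be inverted; by equivariance it is a multiple of \<open>K p q \<gamma> 0\<close>, and by parity it vanishes
  unless \<open>\<gamma> \<in> \<nat>\<close>.\<close>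

lemma radial_ode_expansion:
  fixes p q n :: nat and \<gamma> :: real
  defines "\<kappa> \<equiv> real p + real q + 2 * \<gamma>"
  assumes \<gamma>: "\<gamma> > -1" and n: "\<gamma> \<in> \<nat> \<Longrightarrow> n \<ge> 1"
    and H: "\<And>\<omega> s. cmod \<omega> = 1 \<Longrightarrow> H (\<omega> * s) = \<omega> ^ p * cnj \<omega> ^ q * H s"
    and ode: "\<And>s. s \<noteq> 0 \<Longrightarrow> has_radial H (of_real \<kappa> * H s + F s) s"
    and F: "\<And>s. s \<noteq> 0 \<Longrightarrow> F s = (\<Sum>l<n. e l * K p q \<gamma> l s) + g s"
    and g: "smooth g" "\<And>\<omega> s. cmod \<omega> = 1 \<Longrightarrow> g (\<omega> * s) = \<omega> ^ p * cnj \<omega> ^ q * g s"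
  shows "K_expansion p q \<gamma> (Suc n) H"
proof -
  obtain t where t: "has_taylor g t" using has_taylor_exists[OF g(1)] by blast
  define P where "P d = hpoly d (t d)" for d
  have P_eqv: "P d (\<omega> * z) = \<omega> ^ p * cnj \<omega> ^ q * P d z" if "cmod \<omega> = 1" for d \<omega> z
    unfolding P_def by (rule taylor_eqv[OF t g(2)[OF that] that])
  have P_scale: "P d (of_real x * z) = of_real x ^ d * P d z" for d x z
    unfolding P_def by (rule hpoly_scale)
  have P_sm: "smooth (P d)" for d unfolding P_def by (rule smooth_hpoly)
  have P_K: "P d s = P d 1 * K p q \<gamma> 0 s" if d: "\<kappa> = d" and s: "s \<noteq> 0" for d s
  proof (rule eqv_homogeneous_eq_K[where G = "P d"])
    show "s \<noteq> 0" by (rule s)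
  next
    fix s :: complex assume s: "s \<noteq> 0"
    have "P d (of_real (cmod s) * (s / of_real (cmod s))) = of_real (cmod s) ^ d * P d (s / of_real (cmod s))"
      by (rule P_scale)
    moreover have "cmod s powr (real p + real q + 2 * \<gamma>) = cmod s ^ d"
      using d s powr_realpow[of "cmod s" d] unfolding \<kappa>_def by simp
    ultimately show "P d s = of_real (cmod s powr (real p + real q + 2 * \<gamma>)) * P d (s / of_real (cmod s))"
      using s by simp
  next
    show "P d \<omega> = \<omega> ^ p * cnj \<omega> ^ q * P d 1" if "cmod \<omega> = 1" for \<omega>
      using P_eqv[OF that, of d 1] by simp
  qed
  \<comment> \<open>The point -1 is reached from 1 both by the scalar -1 and by a rotation. The
    signs agree only if \<open>d + p + q\<close> is even, and with \<open>\<kappa> = d\<close> this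
    would make \<gamma> an integer above -1.\<close>
  have P_res: "P d 1 = 0" if d: "\<kappa> = d" and nn: "\<gamma> \<notin> \<nat>" for d
  proof -
    have "P d (- 1) = (-1) ^ d * P d 1" using P_scale[of d "-1" 1] by simp
    moreover have "P d (- 1) = (-1) ^ (p + q) * P d 1" using P_eqv[of "-1" d 1] by (simp add: power_add)
    moreover have "odd (d + p + q)"
    proof
      assume "even (d + p + q)"
      then obtain k where k: "d + p + q = 2 * k" by (blast elim: evenE)
      have "real d + real p + real q = 2 * real k"
        using k by (metis of_nat_add of_nat_mult of_nat_numeral)
      then have "\<gamma> = of_int (int k - int p - int q)" using d by (simp add: \<kappa>_def)
      moreover from this have "int k - int p - int q \<ge> 0" using \<gamma> by linarith
      ultimately have "\<gamma> = real (nat (int k - int p - int q))" by simp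
      then show False using nn by (metis of_nat_in_Nats)
    qed
    then have "(-1 :: complex) ^ d = - ((-1) ^ (p + q))"
      by (cases "even d") (auto simp: uminus_power_if)
    ultimately show ?thesis by (simp add: uminus_power_if split: if_splits)
  qed
  \<comment> \<open>A remainder of degree at least \<open>\<kappa> + 2\<close> makes
    \<open>\<mu>\<close> nonnegative; \<open>\<mu>\<close> is chosen with
    \<open>M - (\<mu> + 1) = \<kappa>\<close>, so that \<open>I\<close> below solves the equation
    for the remainder.\<close>
  define M where "M = nat \<lceil>\<kappa>\<rceil> + 2"
  define \<mu> where "\<mu> = real M - \<kappa> - 1"
  have M: "real M \<ge> \<kappa> + 2" unfolding M_def by linarith
  then have \<mu>: "\<mu> \<ge> 0" by (simp add: \<mu>_def)
  obtain r where r: "\<And>a. smooth (r a)" and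
    g_eq: "\<And>z. g z = (\<Sum>d<M. P d z) + (\<Sum>a\<le>M. r a z * (z ^ a * cnj z ^ (M - a)))"
    using t unfolding has_taylor_def P_def by metis
  define I where "I z = (\<Sum>a\<le>M. ray_mean \<mu> (r a) z * (z ^ a * cnj z ^ (M - a)))" for z
  have I_sm: "smooth I"
    unfolding I_def[abs_def] by (intro smooth_intros smooth_ray_mean \<mu> r)
  have I_rad: "has_radial I (of_real \<kappa> * I z + (\<Sum>a\<le>M. r a z * (z ^ a * cnj z ^ (M - a)))) z" for z
  proof -
    have "has_radial (\<lambda>z. ray_mean \<mu> (r a) z * (z ^ a * cnj z ^ (M - a)))
       (of_real \<kappa> * (ray_mean \<mu> (r a) z * (z ^ a * cnj z ^ (M - a))) + r a z * (z ^ a * cnj z ^ (M - a))) z"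
      if a: "a \<le> M" for a
    proof -
      have "has_radial (\<lambda>z. z ^ a * cnj z ^ (M - a)) (of_nat M * (z ^ a * cnj z ^ (M - a))) z"
        by (rule has_radial_homogeneous, rule monom_scale[OF a])
      note D = has_radial_mult[OF has_radial_smooth[OF smooth_ray_mean[OF \<mu> r[of a]], of z] this]
      have "ray_mean \<mu> (r a) z * (of_nat M * (z ^ a * cnj z ^ (M - a))) + (r a z - of_real (\<mu> + 1) * ray_mean \<mu> (r a) z) * (z ^ a * cnj z ^ (M - a))
          = of_real \<kappa> * (ray_mean \<mu> (r a) z * (z ^ a * cnj z ^ (M - a))) + r a z * (z ^ a * cnj z ^ (M - a))"
        by (simp add: \<mu>_def algebra_simps)
      then show ?thesis using D unfolding ray_mean_radial[OF \<mu> r] by simp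
    qed
    from has_radial_sum[of "{..M}", OF this] show ?thesis
      unfolding I_def by (simp add: sum.distrib sum_distrib_left)
  qed
  \<comment> \<open>The \<open>r a\<close> need not be equivariant one by one. For
    \<open>x > 0\<close>, \<open>A x\<close> is the whole remainder of \<open>g\<close> at
    \<open>x y\<close> divided by \<open>x^M\<close>, equivariant as a difference of equivariant
    functions, and \<open>I\<close> is its weighted mean.\<close>
  have I_eqv: "I (\<omega> * s) = \<omega> ^ p * cnj \<omega> ^ q * I s" if \<omega>: "cmod \<omega> = 1" for \<omega> s
  proof -
    define A where "A x y = (\<Sum>a\<le>M. r a (of_real x * y) * (y ^ a * cnj y ^ (M - a)))" for x :: real and y
    have A: "of_real x ^ M * A x y = g (of_real x * y) - (\<Sum>d<M. P d (of_real x * y))" for x y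
    proof -
      have "of_real x ^ M * A x y = (\<Sum>a\<le>M. r a (of_real x * y) * ((of_real x * y) ^ a * cnj (of_real x * y) ^ (M - a)))"
        unfolding A_def sum_distrib_left by (intro sum.cong refl) (simp only: atMost_iff monom_scale mult.left_commute)
      then show ?thesis unfolding g_eq by simp
    qed
    have A_eqv: "A x (\<omega> * y) = \<omega> ^ p * cnj \<omega> ^ q * A x y" if x: "x > 0" for x y
    proof -
      have "of_real x * (\<omega> * y) = \<omega> * (of_real x * y)" by simp
      then have "of_real x ^ M * A x (\<omega> * y) = \<omega> ^ p * cnj \<omega> ^ q * (of_real x ^ M * A x y)"
        unfolding A by (simp only: g(2)[OF \<omega>] P_eqv[OF \<omega>] right_diff_distrib sum_distrib_left)
      then have "of_real x ^ M * A x (\<omega> * y) = of_real x ^ M * (\<omega> ^ p * cnj \<omega> ^ q * A x y)"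
        by (simp add: mult_ac)
      then show ?thesis using x by simp
    qed
    have I_int: "I y = (LINT x|unit_ival. of_real (x powr \<mu>) * A x y)" for y
    proof -
      have int: "integrable unit_ival (\<lambda>x. of_real (x powr \<mu>) * r a (of_real x * y) * (y ^ a * cnj y ^ (M - a)))" for a
        using smooth_Cn[OF r, of 0] by (intro integrable_mult_left ray_integrable \<mu>) simp
      have "(LINT x|unit_ival. of_real (x powr \<mu>) * A x y)
          = (LINT x|unit_ival. (\<Sum>a\<le>M. of_real (x powr \<mu>) * r a (of_real x * y) * (y ^ a * cnj y ^ (M - a))))"
        unfolding A_def sum_distrib_left by (simp only: mult.assoc)
      also have "\<dots> = (\<Sum>a\<le>M. (LINT x|unit_ival. of_real (x powr \<mu>) * r a (of_real x * y) * (y ^ a * cnj y ^ (M - a))))"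
        by (rule Bochner_Integration.integral_sum) (rule int)
      also have "\<dots> = I y"
        unfolding I_def ray_mean_def by simp
      finally show ?thesis by simp
    qed
    have "I (\<omega> * s) = (LINT x|unit_ival. (\<omega> ^ p * cnj \<omega> ^ q) * (of_real (x powr \<mu>) * A x s))"
      unfolding I_int
    proof (intro Bochner_Integration.integral_cong refl)
      fix x assume "x \<in> space unit_ival"
      \<comment> \<open>Dividing by \<open>x^M\<close> says nothing at \<open>x = 0\<close>, but
        there the weight \<open>0 powr \<mu>\<close> is 0.\<close>
      then have "x = 0 \<or> x > 0" by (auto simp: space_restrict_space)
      then show "of_real (x powr \<mu>) * A x (\<omega> * s) = (\<omega> ^ p * cnj \<omega> ^ q) * (of_real (x powr \<mu>) * A x s)"
        using A_eqv[of x s] by auto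
    qed
    then show ?thesis by (simp add: I_int)
  qed
  \<comment> \<open>The Euler field minus \<kappa> acts on degree \<open>d\<close> as multiplication
    by \<open>d - \<kappa>\<close>, which is inverted off resonance.\<close>
  define Q where "Q z = (\<Sum>d<M. (if \<kappa> = d then 0 else 1 / of_real (d - \<kappa>)) * P d z)" for z
  \<comment> \<open>The resonant component is a multiple of \<open>K p q \<gamma> 0\<close>, and
    \<open>K p q \<gamma> 1\<close> is sent to twice that kernel; hence the division by 2.\<close>
  define c0 where "c0 = (\<Sum>d<M. if \<kappa> = d then P d 1 else 0) / 2"
 have c0_2: "2 * c0 = (\<Sum>d<M. if \<kappa> = d then P d 1 else 0)" by (simp add: c0_def)
  \<comment> \<open>With only one term allowed there is no room for a resonant logarithm; parity
    excludes it.\<close>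
  have c0: "c0 = 0" if "n = 0"
  proof -
    have "\<gamma> \<notin> \<nat>" using n that by auto
    then have "(if \<kappa> = d then P d 1 else 0) = 0" for d using P_res[of d] by simp
    then show ?thesis by (simp add: c0_def)
  qed
  have Q_sm: "smooth Q"
    unfolding Q_def[abs_def] by (intro smooth_intros P_sm)
  have Q_eqv: "Q (\<omega> * s) = \<omega> ^ p * cnj \<omega> ^ q * Q s" if "cmod \<omega> = 1" for \<omega> s
    unfolding Q_def P_eqv[OF that] sum_distrib_left by (simp only: mult_ac)
  have Q_rad: "has_radial Q (of_real \<kappa> * Q z + ((\<Sum>d<M. P d z) - 2 * c0 * K p q \<gamma> 0 z)) z" if z: "z \<noteq> 0" for z
  proof -
    let ?w = "\<lambda>d. if \<kappa> = d then 0 else 1 / complex_of_real (real d - \<kappa>)"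
    have "has_radial (\<lambda>z. ?w d * P d z) (?w d * (of_nat d * P d z)) z" for d
      by (intro has_radial_cmult has_radial_homogeneous P_scale)
    from has_radial_sum[of "{..<M}", OF this]
    have "has_radial Q (\<Sum>d<M. ?w d * (of_nat d * P d z)) z" by (simp add: Q_def[abs_def])
    moreover have "?w d * (of_nat d * P d z) = of_real \<kappa> * (?w d * P d z) + (P d z - (if \<kappa> = d then P d 1 else 0) * K p q \<gamma> 0 z)" for d
    proof (cases "\<kappa> = d")
      case True
      then show ?thesis using P_K[OF True z] by simp
    next
      case False
      then have nz: "complex_of_real (real d - \<kappa>) \<noteq> 0" unfolding of_real_eq_0_iff by simp
      define x where "x = complex_of_real (real d - \<kappa>)"
      have x: "x \<noteq> 0" "of_nat d = x + of_real \<kappa>" using nz by (simp_all add: x_def)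
      have "?w d * (of_nat d * P d z) = of_real \<kappa> * (?w d * P d z) + P d z"
        using False x(1) unfolding x(2) x_def[symmetric] by (simp add: field_simps)
      then show ?thesis using False by simp
    qed
    then have "(\<Sum>d<M. ?w d * (of_nat d * P d z)) = of_real \<kappa> * Q z + ((\<Sum>d<M. P d z) - 2 * c0 * K p q \<gamma> 0 z)"
      unfolding Q_def c0_2 by (simp add: sum.distrib sum_subtractf sum_distrib_left sum_distrib_right)
    ultimately show ?thesis by simp
  qed
  have hK: "has_radial (K p q \<gamma> l) (of_real \<kappa> * K p q \<gamma> l z + 2 * of_nat l * K p q \<gamma> (l - 1) z) z" if "z \<noteq> 0" for l z
    using has_radial_K[OF that, of p q \<gamma> l] unfolding \<kappa>_def .
  \<comment> \<open>The Euler field minus \<kappa> lowers the logarithm: index \<open>Suc l\<close>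
    goes to index \<open>l\<close> with factor \<open>2 * Suc l\<close>.\<close>
  define L where "L z = (\<Sum>l<n. (e l / of_nat (2 * Suc l)) * K p q \<gamma> (Suc l) z)" for z
  have L_eqv: "L (\<omega> * s) = \<omega> ^ p * cnj \<omega> ^ q * L s" if "cmod \<omega> = 1" for \<omega> s
    unfolding L_def K_eqv[OF that] sum_distrib_left by (simp only: mult_ac)
  have L_rad: "has_radial L (of_real \<kappa> * L z + (\<Sum>l<n. e l * K p q \<gamma> l z)) z" if z: "z \<noteq> 0" for z
  proof -
    have "has_radial (\<lambda>z. (e l / of_nat (2 * Suc l)) * K p q \<gamma> (Suc l) z)
       ((e l / of_nat (2 * Suc l)) * (of_real \<kappa> * K p q \<gamma> (Suc l) z + 2 * of_nat (Suc l) * K p q \<gamma> l z)) z" for l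
      by (rule has_radial_cmult[OF hK[OF z, of "Suc l", unfolded diff_Suc_1]])
    from has_radial_sum[of "{..<n}", OF this]
    have "has_radial L (\<Sum>l<n. (e l / of_nat (2 * Suc l)) * (of_real \<kappa> * K p q \<gamma> (Suc l) z + 2 * of_nat (Suc l) * K p q \<gamma> l z)) z"
      by (simp add: L_def[abs_def])
    moreover have "(e l / of_nat (2 * Suc l)) * (of_real \<kappa> * K p q \<gamma> (Suc l) z + 2 * of_nat (Suc l) * K p q \<gamma> l z)
       = of_real \<kappa> * ((e l / of_nat (2 * Suc l)) * K p q \<gamma> (Suc l) z) + e l * K p q \<gamma> l z" for l
    proof -
      have "complex_of_nat (2 * Suc l) \<noteq> 0" unfolding of_nat_eq_0_iff by simp
      then have "(e l / of_nat (2 * Suc l)) * of_nat (2 * Suc l) = e l" by (rule nonzero_eq_divide_eq[THEN iffD1]) (rule refl)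
      then have "(e l / of_nat (2 * Suc l)) * (2 * of_nat (Suc l)) = e l" by (simp only: of_nat_mult of_nat_numeral)
      then have "(e l / of_nat (2 * Suc l)) * (2 * of_nat (Suc l) * K p q \<gamma> l z) = e l * K p q \<gamma> l z"
        by (metis mult.assoc)
      then show ?thesis by (simp only: distrib_left mult.left_commute)
    qed
    ultimately show ?thesis unfolding L_def by (simp only: sum.distrib sum_distrib_left)
  qed
  \<comment> \<open>The four subtracted terms absorb the entire right-hand side, so \<open>G\<close>
    solves the homogeneous equation and is a multiple of \<open>K p q \<gamma> 0\<close>.\<close>
  define G where "G z = H z - (L z + c0 * K p q \<gamma> 1 z + Q z + I z)" for z
  have G_rad: "has_radial G (of_real \<kappa> * G z) z" if z: "z \<noteq> 0" for z
  proof -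
    have k1: "has_radial (\<lambda>z. c0 * K p q \<gamma> 1 z) (c0 * (of_real \<kappa> * K p q \<gamma> 1 z + 2 * K p q \<gamma> 0 z)) z"
      using has_radial_cmult[OF hK[OF z, of 1], of c0] by simp
    have "has_radial G (of_real \<kappa> * H z + F z
       - ((of_real \<kappa> * L z + (\<Sum>l<n. e l * K p q \<gamma> l z)) + c0 * (of_real \<kappa> * K p q \<gamma> 1 z + 2 * K p q \<gamma> 0 z)
          + (of_real \<kappa> * Q z + ((\<Sum>d<M. P d z) - 2 * c0 * K p q \<gamma> 0 z))
          + (of_real \<kappa> * I z + (\<Sum>a\<le>M. r a z * (z ^ a * cnj z ^ (M - a)))))) z"
      unfolding G_def[abs_def]
      by (intro has_radial_diff has_radial_add ode[OF z] L_rad[OF z] k1 Q_rad[OF z] I_rad)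
    then show ?thesis unfolding F[OF z] g_eq G_def by (simp add: algebra_simps)
  qed
  have G_eqv: "G \<omega> = \<omega> ^ p * cnj \<omega> ^ q * G 1" if \<omega>: "cmod \<omega> = 1" for \<omega>
  proof -
    have "G (\<omega> * 1) = \<omega> ^ p * cnj \<omega> ^ q * G 1"
      unfolding G_def H[OF \<omega>] L_eqv[OF \<omega>] K_eqv[OF \<omega>] Q_eqv[OF \<omega>] I_eqv[OF \<omega>] by (simp add: algebra_simps)
    then show ?thesis by simp
  qed
  have G_K: "G s = G 1 * K p q \<gamma> 0 s" if s: "s \<noteq> 0" for s
    by (rule eqv_homogeneous_eq_K[OF radial_homogeneous_solution[OF G_rad, unfolded \<kappa>_def] G_eqv s])
  \<comment> \<open>Integration shifts the indices by one: the constant \<open>G 1\<close> enters at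
    0 and the resonant \<open>c0\<close> at 1.\<close>
  define c where "c l = (case l of 0 \<Rightarrow> G 1 | Suc m \<Rightarrow> e m / of_nat (2 * Suc m) + (if m = 0 then c0 else 0))" for l
  have "H s = (\<Sum>l<Suc n. c l * K p q \<gamma> l s) + (Q s + I s)" if s: "s \<noteq> 0" for s
  proof -
    have "(\<Sum>l<Suc n. c l * K p q \<gamma> l s) = G 1 * K p q \<gamma> 0 s + (\<Sum>l<n. (e l / of_nat (2 * Suc l) + (if l = 0 then c0 else 0)) * K p q \<gamma> (Suc l) s)"
      by (subst sum.lessThan_Suc_shift) (simp add: c_def)
    also have "(\<Sum>l<n. (e l / of_nat (2 * Suc l) + (if l = 0 then c0 else 0)) * K p q \<gamma> (Suc l) s)
        = L s + (\<Sum>l<n. (if l = 0 then c0 * K p q \<gamma> 1 s else 0))"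
      unfolding L_def sum.distrib[symmetric] by (intro sum.cong refl) (simp add: distrib_right)
    also have "(\<Sum>l<n. (if l = 0 then c0 * K p q \<gamma> 1 s else 0)) = c0 * K p q \<gamma> 1 s"
      using c0 by (cases "n = 0") auto
    finally have "(\<Sum>l<Suc n. c l * K p q \<gamma> l s) = G 1 * K p q \<gamma> 0 s + (L s + c0 * K p q \<gamma> 1 s)" .
    moreover have "H s = G 1 * K p q \<gamma> 0 s + (L s + c0 * K p q \<gamma> 1 s + Q s + I s)"
      unfolding G_K[OF s, symmetric] by (simp add: G_def)
    ultimately show ?thesis by (simp only: add.assoc)
  qed
  moreover have "smooth (\<lambda>s. Q s + I s)" by (intro smooth_intros Q_sm I_sm)
  ultimately show ?thesis unfolding K_expansion_def by blast
qed

section \<open>Model convolutions\<close>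

lemma L1_sing_sum: "finite I \<Longrightarrow> (\<And>i. i \<in> I \<Longrightarrow> L1_sing (f i)) \<Longrightarrow> L1_sing (\<lambda>z. \<Sum>i\<in>I. f i z)"
proof (induction I rule: finite_induct)
  case empty
  show ?case unfolding L1_sing_def
    by (intro conjI exI[of _ "-1/2"] exI[of _ 0] exI[of _ 1]) auto
qed (simp add: L1_sing_add)

lemma conv_sum_left:
  assumes "finite I" "\<And>i. i \<in> I \<Longrightarrow> L1_sing (f i)" "L1_sing g" "s \<noteq> 0"
  shows "conv (\<lambda>z. \<Sum>i\<in>I. f i z) g s = (\<Sum>i\<in>I. conv (f i) g s)"
  using assms(1,2)
proof (induction I rule: finite_induct)
  case empty
  show ?case by (simp add: conv_def)
next
  case (insert i I)
  then show ?case using assms by (simp add: conv_add_left L1_sing_sum)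
qed

lemma conv_sum_right:
  assumes "finite I" "\<And>i. i \<in> I \<Longrightarrow> L1_sing (g i)" "L1_sing f" "s \<noteq> 0"
  shows "conv f (\<lambda>z. \<Sum>i\<in>I. g i z) s = (\<Sum>i\<in>I. conv f (g i) s)"
  using assms(1,2)
proof (induction I rule: finite_induct)
  case empty
  show ?case by (simp add: conv_def)
next
  case (insert i I)
  then show ?case using assms by (simp add: conv_add_right L1_sing_sum)
qed

lemma continuous_eq_off_0:
  fixes f g :: "complex \<Rightarrow> complex"
  assumes "continuous_on UNIV f" "continuous_on UNIV g" "\<And>s. s \<noteq> 0 \<Longrightarrow> f s = g s"
  shows "f = g"
proof -
  have "(f \<longlongrightarrow> f 0) (at 0)" "(g \<longlongrightarrow> g 0) (at 0)"
    using assms(1,2) by (auto simp: continuous_on_eq_continuous_at isCont_def)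
  moreover have "(f \<longlongrightarrow> g 0) (at 0)"
    by (rule Lim_transform_eventually[OF \<open>(g \<longlongrightarrow> g 0) (at 0)\<close>])
       (use assms(3) in \<open>auto simp: eventually_at_filter\<close>)
  ultimately have "f 0 = g 0" using tendsto_unique[OF at_neq_bot] by blast
  then show ?thesis using assms(3) by (intro ext) metis
qed

lemma smooth_continuous: "smooth f \<Longrightarrow> continuous_on UNIV f"
  using smooth_Cn[of f 0] by simp

text \<open>Representatives for different \<open>N\<close> are continuous and agree off 0, hence
  coincide; the one resulting function is C^N for all \<open>N\<close>.\<close>

lemma smooth_glue:
  assumes "\<And>N. \<exists>X. Cn N X \<and> (\<forall>s. s \<noteq> 0 \<longrightarrow> X s = G s)"
  obtains \<xi> where "smooth \<xi>" "\<And>s. s \<noteq> 0 \<Longrightarrow> \<xi> s = G s"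
proof -
  obtain X where X: "\<And>N. Cn N (X N)" "\<And>N s. s \<noteq> 0 \<Longrightarrow> X N s = G s"
    using assms by metis
  have "X N = X 0" for N
    using X by (intro continuous_eq_off_0 Cn_continuous[OF X(1)]) auto
  then have "smooth (X 0)" using X(1) unfolding smooth_def by metis
  then show ?thesis using that X(2) by blast
qed

lemma smooth_conv: "smooth f \<Longrightarrow> bdd_supp f \<Longrightarrow> L1_sing g \<Longrightarrow> smooth (conv f g)"
  unfolding smooth_def by (auto intro: Cn_conv L1_sing_integrable)

locale radial_cutoff =
  fixes \<rho> :: "complex \<Rightarrow> complex" and R :: real
  assumes R: "R > 0" and sm: "smooth \<rho>" and bs: "bdd_supp \<rho>"
    and one: "\<And>z. cmod z \<le> R \<Longrightarrow> \<rho> z = 1"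
    and rot: "\<And>z \<omega>. cmod \<omega> = 1 \<Longrightarrow> \<rho> (\<omega> * z) = \<rho> z"
begin

definition A :: "nat \<Rightarrow> nat \<Rightarrow> real \<Rightarrow> nat \<Rightarrow> complex \<Rightarrow> complex" where
  "A a b \<alpha> j z = \<rho> z * K a b \<alpha> j z"

text \<open>The Euler field applied to the cutoff. It vanishes near the origin, so the products
  \<open>B\<close> with a kernel are smooth and yield the smooth error of the radial
  equation.\<close>

definition \<phi> :: "complex \<Rightarrow> complex" where "\<phi> z = Dv z \<rho> z"

definition B :: "nat \<Rightarrow> nat \<Rightarrow> real \<Rightarrow> nat \<Rightarrow> complex \<Rightarrow> complex" where
  "B a b \<alpha> j z = \<phi> z * K a b \<alpha> j z"

text \<open>Point and direction vary together in \<open>\<phi>\<close>; the Wirtinger form separates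
  them and makes smoothness visible.\<close>

lemma \<phi>_eq: "\<phi> = (\<lambda>z. z * dz \<rho> z + cnj z * dzbar \<rho> z)"
  unfolding \<phi>_def using Dv_eq_dz[OF sm] by auto

lemma \<phi>_sm: "smooth \<phi>"
  unfolding \<phi>_eq by (intro smooth_intros smooth_dz smooth_dzbar sm)

lemma \<phi>_bs: "bdd_supp \<phi>"
proof -
  obtain S T where "\<And>z. S < cmod z \<Longrightarrow> Dv 1 \<rho> z = 0" "\<And>z. T < cmod z \<Longrightarrow> Dv \<i> \<rho> z = 0"
    using bdd_supp_Dv[OF bs] unfolding bdd_supp_def by metis
  then show ?thesis unfolding bdd_supp_def \<phi>_eq dz_def dzbar_def by (intro exI[of _ "max S T"]) auto
qed

lemma \<phi>_vanish: "cmod z < R \<Longrightarrow> \<phi> z = 0"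
proof -
  assume z: "cmod z < R"
  have "Dv z (\<lambda>z. \<rho> z - 1) z = 0"
    by (rule Dv_vanish_ball[OF _ z]) (simp add: one)
  moreover have "Dv z (\<lambda>z. \<rho> z - 1) z = Dv z \<rho> z"
    by (rule Dv_eq) (use Cn_SucD(1)[OF smooth_Cn[OF sm, of "Suc 0"], of z] in \<open>auto intro!: derivative_eq_intros\<close>)
  ultimately show ?thesis by (simp add: \<phi>_def)
qed

text \<open>The cutoff takes the same values along both rays, so its radial derivatives
  agree.\<close>

lemma \<phi>_rot:
  assumes "cmod \<omega> = 1"
  shows "\<phi> (\<omega> * z) = \<phi> z"
proof -
  have "\<rho> (of_real t * (\<omega> * z)) = \<rho> (of_real t * z)" for t
    using rot[OF assms, of "of_real t * z"] by (simp add: mult.left_commute)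
  then have "has_radial \<rho> (\<phi> (\<omega> * z)) z"
    using has_radial_smooth[OF sm, of "\<omega> * z"] by (simp add: has_radial_def \<phi>_def)
  moreover have "has_radial \<rho> (\<phi> z) z" unfolding \<phi>_def by (rule has_radial_smooth[OF sm])
  ultimately show ?thesis unfolding has_radial_def by (rule vector_derivative_unique_at)
qed

lemma A_L1_sing: "\<alpha> > -1 \<Longrightarrow> L1_sing (A a b \<alpha> j)"
  unfolding A_def[abs_def] by (rule L1_sing_mult_K[OF smooth_continuous[OF sm] bs])

lemma B_L1_sing: "\<alpha> > -1 \<Longrightarrow> L1_sing (B a b \<alpha> j)"
  unfolding B_def[abs_def] by (rule L1_sing_mult_K[OF smooth_continuous[OF \<phi>_sm] \<phi>_bs])

lemma B_sm: "smooth (B a b \<alpha> j)"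
  unfolding smooth_def B_def[abs_def] using Cn_vanish_mult_K[OF \<phi>_sm R \<phi>_vanish] by blast

lemma B_bs: "bdd_supp (B a b \<alpha> j)"
  unfolding B_def[abs_def] by (rule bdd_supp_mult(1)[OF \<phi>_bs])

lemma A_eqv: "cmod \<omega> = 1 \<Longrightarrow> A a b \<alpha> j (\<omega> * z) = (\<omega> ^ a * cnj \<omega> ^ b) * A a b \<alpha> j z"
  by (simp add: A_def rot K_eqv)

lemma B_eqv: "cmod \<omega> = 1 \<Longrightarrow> B a b \<alpha> j (\<omega> * z) = (\<omega> ^ a * cnj \<omega> ^ b) * B a b \<alpha> j z"
  by (simp add: B_def \<phi>_rot K_eqv)

lemma A_radial:
  assumes "z \<noteq> 0"
  shows "has_radial (A a b \<alpha> j) (of_real (real a + real b + 2 * \<alpha>) * A a b \<alpha> j z + 2 * of_nat j * A a b \<alpha> (j - 1) z + B a b \<alpha> j z) z"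
  using has_radial_mult[OF has_radial_smooth[OF sm] has_radial_K[OF assms, of a b \<alpha> j]]
  by (simp add: A_def[abs_def] B_def \<phi>_def algebra_simps)

definition H :: "nat \<Rightarrow> nat \<Rightarrow> real \<Rightarrow> nat \<Rightarrow> nat \<Rightarrow> nat \<Rightarrow> real \<Rightarrow> nat \<Rightarrow> complex \<Rightarrow> complex" where
  "H a b \<alpha> j c d \<beta> k = conv (A a b \<alpha> j) (A c d \<beta> k)"

text \<open>Both convolutions have the smooth factor on the left, where \<open>smooth_conv\<close>
  expects it.\<close>

definition G :: "nat \<Rightarrow> nat \<Rightarrow> real \<Rightarrow> nat \<Rightarrow> nat \<Rightarrow> nat \<Rightarrow> real \<Rightarrow> nat \<Rightarrow> complex \<Rightarrow> complex" where
  "G a b \<alpha> j c d \<beta> k s = conv (B a b \<alpha> j) (A c d \<beta> k) s + conv (B c d \<beta> k) (A a b \<alpha> j) s"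

context
  fixes a b c d :: nat and \<alpha> \<beta> :: real
  assumes \<alpha>: "\<alpha> > -1" and \<beta>: "\<beta> > -1"
begin

lemma G_sm: "smooth (G a b \<alpha> j c d \<beta> k)"
  unfolding G_def[abs_def] by (intro smooth_intros smooth_conv B_sm B_bs A_L1_sing \<alpha> \<beta>)

lemma H_eqv: "cmod \<omega> = 1 \<Longrightarrow> H a b \<alpha> j c d \<beta> k (\<omega> * s) = \<omega> ^ (a + c) * cnj \<omega> ^ (b + d) * H a b \<alpha> j c d \<beta> k s"
  unfolding H_def
  by (subst conv_eqv[OF L1_sing_measurable[OF A_L1_sing[OF \<alpha>]] L1_sing_measurable[OF A_L1_sing[OF \<beta>]] _ A_eqv A_eqv])
     (auto simp: power_add mult_ac)

lemma G_eqv: "cmod \<omega> = 1 \<Longrightarrow> G a b \<alpha> j c d \<beta> k (\<omega> * s) = \<omega> ^ (a + c) * cnj \<omega> ^ (b + d) * G a b \<alpha> j c d \<beta> k s"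
proof -
  assume \<omega>: "cmod \<omega> = 1"
  have "conv (B a b \<alpha> j) (A c d \<beta> k) (\<omega> * s) = (\<omega> ^ a * cnj \<omega> ^ b) * (\<omega> ^ c * cnj \<omega> ^ d) * conv (B a b \<alpha> j) (A c d \<beta> k) s"
    by (rule conv_eqv[OF L1_sing_measurable[OF B_L1_sing[OF \<alpha>]] L1_sing_measurable[OF A_L1_sing[OF \<beta>]] \<omega> B_eqv[OF \<omega>] A_eqv[OF \<omega>]])
  moreover have "conv (B c d \<beta> k) (A a b \<alpha> j) (\<omega> * s) = (\<omega> ^ c * cnj \<omega> ^ d) * (\<omega> ^ a * cnj \<omega> ^ b) * conv (B c d \<beta> k) (A a b \<alpha> j) s"
    by (rule conv_eqv[OF L1_sing_measurable[OF B_L1_sing[OF \<beta>]] L1_sing_measurable[OF A_L1_sing[OF \<alpha>]] \<omega> B_eqv[OF \<omega>] A_eqv[OF \<omega>]])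
  ultimately show ?thesis unfolding G_def by (simp add: power_add algebra_simps)
qed

text \<open>The degrees of the two kernels add up, and the Jacobian of the scaling contributes the
  further 2 contained in \<open>2 * (\<alpha> + \<beta> + 1)\<close>.\<close>

lemma H_radial:
  assumes s: "s \<noteq> 0"
  shows "has_radial (H a b \<alpha> j c d \<beta> k)
    (of_real (real (a + c) + real (b + d) + 2 * (\<alpha> + \<beta> + 1)) * H a b \<alpha> j c d \<beta> k s
     + (2 * of_nat j * H a b \<alpha> (j - 1) c d \<beta> k s + 2 * of_nat k * H a b \<alpha> j c d \<beta> (k - 1) s
        + G a b \<alpha> j c d \<beta> k s)) s"
proof -
  let ?f = "A a b \<alpha> j" and ?g = "A c d \<beta> k"
  let ?f' = "\<lambda>z. of_real (real a + real b + 2 * \<alpha>) * A a b \<alpha> j z + 2 * of_nat j * A a b \<alpha> (j - 1) z + B a b \<alpha> j z"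
  let ?g' = "\<lambda>z. of_real (real c + real d + 2 * \<beta>) * A c d \<beta> k z + 2 * of_nat k * A c d \<beta> (k - 1) z + B c d \<beta> k z"
  note L = A_L1_sing[OF \<alpha>] A_L1_sing[OF \<beta>] B_L1_sing[OF \<alpha>] B_L1_sing[OF \<beta>] L1_sing_add L1_sing_cmult
  have "has_radial (conv ?f ?g) (2 * conv ?f ?g s + conv ?f' ?g s + conv ?f ?g' s) s"
    by (rule conv_has_radial[OF _ _ _ _ A_radial A_radial s]) (intro L)+
  moreover have "conv ?f' ?g s = of_real (real a + real b + 2 * \<alpha>) * conv ?f ?g s + 2 * of_nat j * conv (A a b \<alpha> (j - 1)) ?g s + conv (B a b \<alpha> j) ?g s"
    using s by (simp add: conv_add_left conv_cmult_left L)
  moreover have "conv ?f ?g' s = of_real (real c + real d + 2 * \<beta>) * conv ?f ?g s + 2 * of_nat k * conv ?f (A c d \<beta> (k - 1)) s + conv ?f (B c d \<beta> k) s"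
    using s by (simp add: conv_add_right conv_cmult_right L)
  moreover have "conv ?f (B c d \<beta> k) s = conv (B c d \<beta> k) ?f s"
    by (rule conv_commute) (intro L1_sing_measurable L)+
  ultimately show ?thesis
    unfolding H_def G_def by (simp add: algebra_simps)
qed

text \<open>Off 0 the first factor is the cutoff times a monomial in \<open>z\<close> and
  \<open>cnj z\<close>. The conventional value 0 at the origin may differ from it, but only on a
  null set under the integral.\<close>

lemma H_smooth_left:
  assumes "\<alpha> \<in> \<nat>"
  shows "\<exists>\<xi>. smooth \<xi> \<and> (\<forall>s. s \<noteq> 0 \<longrightarrow> H a b \<alpha> 0 c d \<beta> k s = \<xi> s)"
proof -
  obtain m where m: "\<alpha> = real m" using assms by (auto elim: Nats_cases)
  define \<psi> where "\<psi> z = \<rho> z * (z ^ (a + m) * cnj z ^ (b + m))" for z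
  have eq: "A a b \<alpha> 0 z = \<psi> z" if "z \<noteq> 0" for z
  proof -
    have "complex_of_real (cmod z powr (2 * \<alpha>)) = of_real ((cmod z)\<^sup>2) ^ m"
      using that powr_realpow[of "cmod z" "2 * m"] by (simp add: m power_mult)
    then show ?thesis
      unfolding A_def \<psi>_def K_def norm_sq_cnj by (simp add: power_add power_mult_distrib mult_ac)
  qed
  have "H a b \<alpha> 0 c d \<beta> k s = conv \<psi> (A c d \<beta> k) s" for s
    unfolding H_def conv_def
  proof (rule integral_cong_AE)
    have [measurable]: "A a b \<alpha> 0 \<in> borel_measurable borel" "A c d \<beta> k \<in> borel_measurable borel" "\<psi> \<in> borel_measurable borel"
    proof -
      show "A a b \<alpha> 0 \<in> borel_measurable borel" "A c d \<beta> k \<in> borel_measurable borel"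
        using A_L1_sing \<alpha> \<beta> L1_sing_measurable by auto
      have "smooth \<psi>" unfolding \<psi>_def[abs_def] by (intro smooth_intros sm)
      then show "\<psi> \<in> borel_measurable borel" by (intro borel_measurable_continuous_onI smooth_continuous)
    qed
    show "(\<lambda>u. A a b \<alpha> 0 (s - u) * A c d \<beta> k u) \<in> borel_measurable lborel" by measurable
    show "(\<lambda>u. \<psi> (s - u) * A c d \<beta> k u) \<in> borel_measurable lborel" by measurable
    show "AE u in lborel. A a b \<alpha> 0 (s - u) * A c d \<beta> k u = \<psi> (s - u) * A c d \<beta> k u"
      using AE_lborel_singleton[of s] by eventually_elim (simp add: eq)
  qed
  moreover have "smooth (conv \<psi> (A c d \<beta> k))"
    unfolding \<psi>_def[abs_def] by (intro smooth_conv A_L1_sing \<beta> smooth_intros sm bdd_supp_mult(1) bs)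
  ultimately show ?thesis by blast
qed

end

lemma H_commute:
  assumes "\<alpha> > -1" "\<beta> > -1"
  shows "H a b \<alpha> j c d \<beta> k = H c d \<beta> k a b \<alpha> j"
  unfolding H_def using conv_commute[OF L1_sing_measurable[OF A_L1_sing] L1_sing_measurable[OF A_L1_sing]] assms by blast

text \<open>The premise on \<open>nn\<close> packages the three ways of counting logarithms.\<close>

lemma H_expansion:
  fixes nn :: "nat \<Rightarrow> nat \<Rightarrow> nat"
  assumes \<alpha>: "\<alpha> > -1" and \<beta>: "\<beta> > -1" and \<gamma>: "\<gamma> = \<alpha> + \<beta> + 1"
    and nn: "\<And>j k. ((\<alpha> \<in> \<nat> \<and> j = 0) \<or> (\<beta> \<in> \<nat> \<and> k = 0)) \<or>
      (nn j k \<ge> 1 \<and> (\<gamma> \<in> \<nat> \<longrightarrow> nn j k \<ge> 2) \<and> (j > 0 \<longrightarrow> nn (j - 1) k < nn j k) \<and> (k > 0 \<longrightarrow> nn j (k - 1) < nn j k))"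
  shows "K_expansion (a + c) (b + d) \<gamma> (nn j k) (H a b \<alpha> j c d \<beta> k)"
proof (induction "j + k" arbitrary: j k rule: less_induct)
  case less
  consider "\<alpha> \<in> \<nat> \<and> j = 0" | "\<beta> \<in> \<nat> \<and> k = 0"
    | "nn j k \<ge> 1" "\<gamma> \<in> \<nat> \<longrightarrow> nn j k \<ge> 2" "j > 0 \<longrightarrow> nn (j - 1) k < nn j k" "k > 0 \<longrightarrow> nn j (k - 1) < nn j k"
    using nn[of j k] by blast
  then show ?case
  proof cases
    case 1
    then show ?thesis using H_smooth_left[OF \<alpha> \<beta>] K_expansion_smooth by blast
  next
    case 2
    then show ?thesis using H_smooth_left[OF \<beta> \<alpha>] K_expansion_smooth H_commute[OF \<alpha> \<beta>] by metis
  next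
    case 3
    \<comment> \<open>Solving the radial equation adds one term, so the right-hand side must be
      expanded with one term fewer.\<close>
    obtain n where n: "nn j k = Suc n" using 3(1) by (cases "nn j k") auto
    let ?E = "K_expansion (a + c) (b + d) \<gamma>"
    define F where "F s = 2 * of_nat j * H a b \<alpha> (j - 1) c d \<beta> k s + 2 * of_nat k * H a b \<alpha> j c d \<beta> (k - 1) s
        + G a b \<alpha> j c d \<beta> k s" for s
    have e1: "?E n (\<lambda>s. 2 * of_nat j * H a b \<alpha> (j - 1) c d \<beta> k s)"
    proof (cases "j = 0")
      case True
      then show ?thesis by (intro K_expansion_smooth[of "\<lambda>_. 0"] smooth_intros) simp
    next
      case False
      then have "?E (nn (j - 1) k) (H a b \<alpha> (j - 1) c d \<beta> k)" by (intro less) simp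
      then show ?thesis using False 3(3) n by (intro K_expansion_cmult) (auto intro: K_expansion_mono)
    qed
    have e2: "?E n (\<lambda>s. 2 * of_nat k * H a b \<alpha> j c d \<beta> (k - 1) s)"
    proof (cases "k = 0")
      case True
      then show ?thesis by (intro K_expansion_smooth[of "\<lambda>_. 0"] smooth_intros) simp
    next
      case False
      then have "?E (nn j (k - 1)) (H a b \<alpha> j c d \<beta> (k - 1))" by (intro less) simp
      then show ?thesis using False 3(4) n by (intro K_expansion_cmult) (auto intro: K_expansion_mono)
    qed
    have "?E n (G a b \<alpha> j c d \<beta> k)"
      by (rule K_expansion_smooth[OF G_sm[OF \<alpha> \<beta>] refl])
    then have "?E n F"
      unfolding F_def[abs_def] by (intro K_expansion_add e1 e2)
    then obtain e g where g: "smooth g" and F: "\<And>s. s \<noteq> 0 \<Longrightarrow> F s = (\<Sum>l<n. e l * K (a + c) (b + d) \<gamma> l s) + g s"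
      unfolding K_expansion_def by blast
    have F_eqv: "F (\<omega> * s) = \<omega> ^ (a + c) * cnj \<omega> ^ (b + d) * F s" if "cmod \<omega> = 1" for \<omega> s
      unfolding F_def H_eqv[OF \<alpha> \<beta> that] G_eqv[OF \<alpha> \<beta> that] by (simp add: algebra_simps)
    \<comment> \<open>Off 0 the equivariance of \<open>F\<close> and of the kernels passes to
      \<open>g\<close> by subtraction; continuity extends it to 0.\<close>
    have g_eqv: "g (\<omega> * s) = \<omega> ^ (a + c) * cnj \<omega> ^ (b + d) * g s" if \<omega>: "cmod \<omega> = 1" for \<omega> s
    proof -
      have "(\<lambda>s. g (\<omega> * s)) = (\<lambda>s. \<omega> ^ (a + c) * cnj \<omega> ^ (b + d) * g s)"
      proof (rule continuous_eq_off_0)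
        show "continuous_on UNIV (\<lambda>s. g (\<omega> * s))"
          using Cn_compose_mult[OF smooth_Cn[OF g], of 0] by simp
        show "continuous_on UNIV (\<lambda>s. \<omega> ^ (a + c) * cnj \<omega> ^ (b + d) * g s)"
          by (intro continuous_intros smooth_continuous g)
        fix s :: complex assume s: "s \<noteq> 0"
        then have "\<omega> * s \<noteq> 0" using \<omega> by auto
        from F[OF this] F[OF s] F_eqv[OF \<omega>, of s]
        have "(\<Sum>l<n. e l * K (a + c) (b + d) \<gamma> l (\<omega> * s)) + g (\<omega> * s) =
          \<omega> ^ (a + c) * cnj \<omega> ^ (b + d) * ((\<Sum>l<n. e l * K (a + c) (b + d) \<gamma> l s) + g s)" by simp
        moreover have "(\<Sum>l<n. e l * K (a + c) (b + d) \<gamma> l (\<omega> * s)) = \<omega> ^ (a + c) * cnj \<omega> ^ (b + d) * (\<Sum>l<n. e l * K (a + c) (b + d) \<gamma> l s)"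
          unfolding K_eqv[OF \<omega>] sum_distrib_left by (simp only: mult_ac)
        ultimately show "g (\<omega> * s) = \<omega> ^ (a + c) * cnj \<omega> ^ (b + d) * g s"
          by (simp add: distrib_left)
      qed
      then show ?thesis by metis
    qed
    have "K_expansion (a + c) (b + d) \<gamma> (Suc n) (H a b \<alpha> j c d \<beta> k)"
    proof (rule radial_ode_expansion[where F = F and e = e and g = g])
      show "\<gamma> > -1" using \<alpha> \<beta> \<gamma> by simp
      show "n \<ge> 1" if "\<gamma> \<in> \<nat>" using 3(2) that n by simp
      show "has_radial (H a b \<alpha> j c d \<beta> k) (of_real (real (a + c) + real (b + d) + 2 * \<gamma>) * H a b \<alpha> j c d \<beta> k s + F s) s" if "s \<noteq> 0" for s
        unfolding F_def \<gamma> by (rule H_radial[OF \<alpha> \<beta> that])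
    qed (use g g_eqv F H_eqv[OF \<alpha> \<beta>] in auto)
    then show ?thesis by (simp add: n)
  qed
qed

end

section \<open>The expansion\<close>

lemma bdd_supp_common_radius:
  assumes "bdd_supp f" "bdd_supp g"
  obtains R where "R > 0" "\<And>z. R < cmod z \<Longrightarrow> f z = 0" "\<And>z. R < cmod z \<Longrightarrow> g z = 0"
proof -
  obtain S T where "\<And>z. S < cmod z \<Longrightarrow> f z = 0" "\<And>z. T < cmod z \<Longrightarrow> g z = 0"
    using assms unfolding bdd_supp_def by metis
  then show ?thesis by (intro that[of "max 1 (max S T)"]) auto
qed

text \<open>The constant is \<open>- 2 * \<i>\<close> from the area form divided by
  \<open>2 * \<i> * pi\<close>.\<close>

lemma F_conv_eq_conv:
  "F_conv \<theta> \<eta> \<alpha> \<beta> j k s = - of_real (1 / pi) * conv (\<lambda>z. \<theta> z * K 0 0 \<alpha> j z) (\<lambda>z. \<eta> z * K 0 0 \<beta> k z) s"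
proof -
  have "(\<lambda>u. \<theta> (s - u) * \<eta> u * complex_of_real (cmod (s - u) powr (2 * \<alpha>) * ln ((cmod (s - u))\<^sup>2) ^ j *
                        cmod u powr (2 * \<beta>) * ln ((cmod u)\<^sup>2) ^ k))
      = (\<lambda>u. \<theta> (s - u) * K 0 0 \<alpha> j (s - u) * (\<eta> u * K 0 0 \<beta> k u))"
    by (simp add: K_def fun_eq_iff mult_ac)
  then show ?thesis
    unfolding F_conv_def integral_du_dubar_def conv_def by (simp add: field_simps)
qed

lemma conv_bdd_supp:
  assumes "\<And>z. R < cmod z \<Longrightarrow> f z = 0" "\<And>z. R < cmod z \<Longrightarrow> g z = 0" "2 * R < cmod s"
  shows "conv f g s = 0"
proof -
  have "f (s - u) * g u = 0" for u
  proof -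
    have "cmod s \<le> cmod (s - u) + cmod u" using norm_triangle_ineq[of "s - u" u] by simp
    then have "R < cmod (s - u) \<or> R < cmod u" using assms(3) by linarith
    then show ?thesis using assms by auto
  qed
  then have "(\<lambda>u. f (s - u) * g u) = (\<lambda>_. 0)" by (intro ext)
  then show ?thesis by (simp add: conv_def)
qed

text \<open>Pairs of total degree below \<open>M\<close> are matched exactly by Taylor components of
  the \<open>\<zeta> l\<close>; the other pairs have degree at least \<open>M\<close> and only
  contribute functions of class C^N.\<close>

lemma square_split_sum:
  fixes f :: "nat \<Rightarrow> nat \<Rightarrow> complex"
  shows "(\<Sum>i<M. \<Sum>j<M. f i j) = (\<Sum>N<M. \<Sum>i\<le>N. f i (N - i)) + (\<Sum>(i,j)\<in>{(i,j). i < M \<and> j < M \<and> M \<le> i + j}. f i j)"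
proof -
  have "(\<Sum>i<M. \<Sum>j<M. f i j) = (\<Sum>(i,j)\<in>{..<M} \<times> {..<M}. f i j)"
    by (simp add: sum.cartesian_product)
  also have "{..<M} \<times> {..<M} = {(i,j). i + j < M} \<union> {(i,j). i < M \<and> j < M \<and> M \<le> i + j}" by auto
  also have "(\<Sum>(i,j)\<in>\<dots>. f i j) = (\<Sum>(i,j)\<in>{(i,j). i + j < M}. f i j) + (\<Sum>(i,j)\<in>{(i,j). i < M \<and> j < M \<and> M \<le> i + j}. f i j)"
  proof (rule sum.union_disjoint)
    show "finite {(i,j). i + j < M}" by (rule finite_subset[of _ "{..<M} \<times> {..<M}"]) auto
    show "finite {(i,j). i < M \<and> j < M \<and> M \<le> i + j}" by (rule finite_subset[of _ "{..<M} \<times> {..<M}"]) auto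
  qed auto
  finally show ?thesis by (simp add: sum.triangle_reindex)
qed

lemma sum_pull_out:
  fixes W :: "nat \<Rightarrow> nat \<Rightarrow> nat \<Rightarrow> nat \<Rightarrow> nat \<Rightarrow> complex"
  shows "(\<Sum>D<M. \<Sum>e<M. \<Sum>a\<le>D. \<Sum>c\<le>e. \<Sum>l<n. W D e a c l) = (\<Sum>l<n. \<Sum>D<M. \<Sum>e<M. \<Sum>a\<le>D. \<Sum>c\<le>e. W D e a c l)"
proof -
  have "(\<Sum>a\<le>D. \<Sum>c\<le>e. \<Sum>l<n. W D e a c l) = (\<Sum>l<n. \<Sum>a\<le>D. \<Sum>c\<le>e. W D e a c l)" for D e
    by (subst sum.swap[of _ "{..D}"], rule sum.cong[OF refl], rule sum.swap)
  then have "(\<Sum>D<M. \<Sum>e<M. \<Sum>a\<le>D. \<Sum>c\<le>e. \<Sum>l<n. W D e a c l) = (\<Sum>D<M. \<Sum>e<M. \<Sum>l<n. \<Sum>a\<le>D. \<Sum>c\<le>e. W D e a c l)"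
    by simp
  also have "\<dots> = (\<Sum>D<M. \<Sum>l<n. \<Sum>e<M. \<Sum>a\<le>D. \<Sum>c\<le>e. W D e a c l)"
    by (rule sum.cong[OF refl], rule sum.swap)
  also have "\<dots> = (\<Sum>l<n. \<Sum>D<M. \<Sum>e<M. \<Sum>a\<le>D. \<Sum>c\<le>e. W D e a c l)"
    by (rule sum.swap)
  finally show ?thesis .
qed

text \<open>For fixed total degree \<open>N\<close> the products of monomials are sorted by the
  power of \<open>s\<close>; \<open>a \<le> D\<close> and \<open>c \<le> N - D\<close> keep
  \<open>a + c \<le> N\<close>, so none is lost.\<close>

lemma collect_coefficients:
  fixes X :: "nat \<Rightarrow> nat \<Rightarrow> nat \<Rightarrow> complex"
  assumes "Z = (\<lambda>p. \<Sum>D\<le>N. \<Sum>a\<le>D. \<Sum>c\<le>N - D. if a + c = p then X D a c else 0)"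
  shows "hpoly N Z s = (\<Sum>D\<le>N. \<Sum>a\<le>D. \<Sum>c\<le>N - D. X D a c * (s ^ (a + c) * cnj s ^ (N - (a + c))))"
proof -
  let ?m = "\<lambda>p. s ^ p * cnj s ^ (N - p)"
  have "hpoly N Z s = (\<Sum>p\<le>N. \<Sum>D\<le>N. \<Sum>a\<le>D. \<Sum>c\<le>N - D. (if a + c = p then X D a c * ?m (a + c) else 0))"
    unfolding hpoly_def assms sum_distrib_right by (intro sum.cong refl) auto
  also have "\<dots> = (\<Sum>D\<le>N. \<Sum>p\<le>N. \<Sum>a\<le>D. \<Sum>c\<le>N - D. (if a + c = p then X D a c * ?m (a + c) else 0))"
    by (rule sum.swap)
  also have "\<dots> = (\<Sum>D\<le>N. \<Sum>a\<le>D. \<Sum>p\<le>N. \<Sum>c\<le>N - D. (if a + c = p then X D a c * ?m (a + c) else 0))"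
    by (rule sum.cong[OF refl], rule sum.swap)
  also have "\<dots> = (\<Sum>D\<le>N. \<Sum>a\<le>D. \<Sum>c\<le>N - D. \<Sum>p\<le>N. (if a + c = p then X D a c * ?m (a + c) else 0))"
    by (rule sum.cong[OF refl], rule sum.cong[OF refl], rule sum.swap)
  also have "\<dots> = (\<Sum>D\<le>N. \<Sum>a\<le>D. \<Sum>c\<le>N - D. X D a c * ?m (a + c))"
    by (intro sum.cong refl) auto
  finally show ?thesis .
qed

text \<open>The Taylor remainder times the kernel has degree \<open>M + 2\<alpha> > N\<close>, hence
  class C^N. Inserting \<open>\<rho>\<close>, which does not change \<open>f\<close>, gives every
  piece bounded support and turns the polynomial part into model factors.\<close>

lemma taylor_split:
  fixes f :: "complex \<Rightarrow> complex"
  assumes t: "has_taylor f t" and \<rho>: "\<And>z. \<rho> z * f z = f z" "smooth \<rho>" "bdd_supp \<rho>"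
    and M: "real N < real M + 2 * \<alpha>" and \<alpha>: "\<alpha> > -1"
  obtains r where "\<And>z. f z * K 0 0 \<alpha> j z = (\<Sum>d<M. \<Sum>a\<le>d. t d a * (\<rho> z * K a (d - a) \<alpha> j z)) + r z"
    "Cn N r" "bdd_supp r" "L1_sing r"
proof -
  obtain q where q: "\<And>a. smooth (q a)" and
    eq: "\<And>z. f z = (\<Sum>d<M. hpoly d (t d) z) + (\<Sum>a\<le>M. q a z * (z ^ a * cnj z ^ (M - a)))"
    using t unfolding has_taylor_def by metis
  define r where "r z = (\<Sum>a\<le>M. (\<rho> z * q a z) * K a (M - a) \<alpha> j z)" for z
  have mon: "z ^ a * cnj z ^ b * K 0 0 \<alpha> j z = K a b \<alpha> j z" for a b z
    using K_mult_monom[of z a b 0 0 \<alpha> j] by simp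
  have "f z * K 0 0 \<alpha> j z = (\<Sum>d<M. \<Sum>a\<le>d. t d a * (\<rho> z * K a (d - a) \<alpha> j z)) + r z" for z
  proof -
    have "f z * K 0 0 \<alpha> j z = \<rho> z * ((\<Sum>d<M. hpoly d (t d) z) + (\<Sum>a\<le>M. q a z * (z ^ a * cnj z ^ (M - a)))) * K 0 0 \<alpha> j z"
      unfolding eq[symmetric] \<rho>(1) ..
    also have "\<dots> = (\<Sum>d<M. \<Sum>a\<le>d. t d a * (\<rho> z * (z ^ a * cnj z ^ (d - a) * K 0 0 \<alpha> j z)))
       + (\<Sum>a\<le>M. (\<rho> z * q a z) * (z ^ a * cnj z ^ (M - a) * K 0 0 \<alpha> j z))"
      unfolding hpoly_def by (simp add: distrib_left distrib_right sum_distrib_left sum_distrib_right mult_ac)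
    finally show ?thesis unfolding mon r_def .
  qed
  moreover have "Cn N r"
    unfolding r_def[abs_def] using M by (intro Cn_sum Cn_mult smooth_Cn[OF \<rho>(2)] smooth_Cn[OF q] Cn_K) auto
  moreover have "bdd_supp r"
  proof -
    obtain S where S: "\<And>z. S < cmod z \<Longrightarrow> \<rho> z = 0" using \<rho>(3) unfolding bdd_supp_def by blast
    then show ?thesis unfolding bdd_supp_def r_def by (intro exI[of _ S]) auto
  qed
  moreover have "L1_sing r"
    unfolding r_def[abs_def]
    by (intro L1_sing_sum L1_sing_mult_K smooth_continuous smooth_intros \<rho> q bdd_supp_mult(1) \<alpha>) auto
  ultimately show ?thesis by (rule that)
qed

lemma (in radial_cutoff) log_expansion_from_model:
  assumes \<alpha>: "\<alpha> > -1" and \<beta>: "\<beta> > -1" and \<gamma>: "\<gamma> = \<alpha> + \<beta> + 1"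
    and \<theta>: "smooth \<theta>" "\<And>z. R < cmod z \<Longrightarrow> \<theta> z = 0" and \<eta>: "smooth \<eta>" "\<And>z. R < cmod z \<Longrightarrow> \<eta> z = 0"
    and E: "\<And>a b c d. K_expansion (a + c) (b + d) \<gamma> n (H a b \<alpha> j c d \<beta> k)"
  shows "has_log_expansion (F_conv \<theta> \<eta> \<alpha> \<beta> j k) \<gamma> (int n - 1)"
proof -
  define f where "f z = \<theta> z * K 0 0 \<alpha> j z" for z
  define g where "g z = \<eta> z * K 0 0 \<beta> k z" for z
  have b\<theta>: "bdd_supp \<theta>" and b\<eta>: "bdd_supp \<eta>" using \<theta> \<eta> unfolding bdd_supp_def by blast+
  have f_L1: "L1_sing f" unfolding f_def[abs_def] by (rule L1_sing_mult_K[OF smooth_continuous[OF \<theta>(1)] b\<theta> \<alpha>])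
  have g_L1: "L1_sing g" unfolding g_def[abs_def] by (rule L1_sing_mult_K[OF smooth_continuous[OF \<eta>(1)] b\<eta> \<beta>])
  obtain t u where t: "has_taylor \<theta> t" and u: "has_taylor \<eta> u"
    using has_taylor_exists \<theta>(1) \<eta>(1) by metis
  have \<rho>\<theta>: "\<rho> z * \<theta> z = \<theta> z" and \<rho>\<eta>: "\<rho> z * \<eta> z = \<eta> z" for z
    using one[of z] \<theta>(2)[of z] \<eta>(2)[of z] by (cases "cmod z \<le> R"; simp)+
  \<comment> \<open>These are fixed before any \<open>N\<close>, so that the same \<open>Z\<close>
    and \<open>\<zeta>\<close> serve for every order of differentiability.\<close>
  obtain C X where X: "\<And>a b c d. smooth (X a b c d)"
    and HC: "\<And>a b c d s. s \<noteq> 0 \<Longrightarrow> H a b \<alpha> j c d \<beta> k s = (\<Sum>l<n. C a b c d l * K (a + c) (b + d) \<gamma> l s) + X a b c d s"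
  proof -
    define P where "P a b c d cc x \<longleftrightarrow> smooth x \<and> (\<forall>s. s \<noteq> 0 \<longrightarrow>
      H a b \<alpha> j c d \<beta> k s = (\<Sum>l<n. cc l * K (a + c) (b + d) \<gamma> l s) + x s)" for a b c d cc x
    define C where "C a b c d = (SOME cc. \<exists>x. P a b c d cc x)" for a b c d
    define X where "X a b c d = (SOME x. P a b c d (C a b c d) x)" for a b c d
    have "\<exists>cc x. P a b c d cc x" for a b c d
      using E[of a c b d] unfolding K_expansion_def P_def by blast
    then have "\<exists>x. P a b c d (C a b c d) x" for a b c d
      unfolding C_def by (rule someI_ex)
    then have "P a b c d (C a b c d) (X a b c d)" for a b c d
      unfolding X_def by (rule someI_ex)
    then show ?thesis unfolding P_def by (intro that[of X C]) blast+
  qed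
  define W where "W l D e a c s = t D a * u e c * C a (D - a) c (e - c) l * K (a + c) (D - a + (e - c)) \<gamma> l s" for l D e a c s
  define Y where "Y l D e s = (\<Sum>a\<le>D. \<Sum>c\<le>e. W l D e a c s)" for l D e s
  \<comment> \<open>The formal Taylor coefficients of \<open>\<zeta> l\<close>: coefficients of
    \<theta> and \<eta> times the model constants, collected by the power of
    \<open>s\<close>.\<close>
  define Z where "Z l N p = (\<Sum>D\<le>N. \<Sum>a\<le>D. \<Sum>c\<le>N - D. if a + c = p then t D a * u (N - D) c * C a (D - a) c (N - D - c) l else 0)" for l N p
  have "\<exists>\<zeta>. smooth \<zeta> \<and> bdd_supp \<zeta> \<and> has_taylor \<zeta> (Z l)" for l using borel_lemma by metis
  then obtain \<zeta> where \<zeta>: "\<And>l. smooth (\<zeta> l)" "\<And>l. bdd_supp (\<zeta> l)" "\<And>l. has_taylor (\<zeta> l) (Z l)" by metis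
  have ZY: "hpoly N (Z l N) s * K 0 0 \<gamma> l s = (\<Sum>D\<le>N. Y l D (N - D) s)" for l N s
  proof -
    have "hpoly N (Z l N) s = (\<Sum>D\<le>N. \<Sum>a\<le>D. \<Sum>c\<le>N - D. t D a * u (N - D) c * C a (D - a) c (N - D - c) l * (s ^ (a + c) * cnj s ^ (N - (a + c))))"
      by (rule collect_coefficients) (simp add: Z_def[abs_def])
    then have "hpoly N (Z l N) s * K 0 0 \<gamma> l s = (\<Sum>D\<le>N. \<Sum>a\<le>D. \<Sum>c\<le>N - D. t D a * u (N - D) c * C a (D - a) c (N - D - c) l * (s ^ (a + c) * cnj s ^ (N - (a + c)) * K 0 0 \<gamma> l s))"
      by (simp add: sum_distrib_right mult.assoc)
    also have "\<dots> = (\<Sum>D\<le>N. Y l D (N - D) s)"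
      unfolding Y_def
    proof (intro sum.cong refl)
      fix D a c assume "D \<in> {..N}" "a \<in> {..D}" "c \<in> {..N - D}"
      then have "N - (a + c) = D - a + (N - D - c)" by auto
      then show "t D a * u (N - D) c * C a (D - a) c (N - D - c) l * (s ^ (a + c) * cnj s ^ (N - (a + c)) * K 0 0 \<gamma> l s)
        = W l D (N - D) a c s"
        unfolding K_mult_monom W_def by simp
    qed
    finally show ?thesis .
  qed
  have key: "\<exists>x. Cn N x \<and> (\<forall>s. s \<noteq> 0 \<longrightarrow> x s = conv f g s - (\<Sum>l<n. \<zeta> l s * K 0 0 \<gamma> l s))" for N
  proof -
    \<comment> \<open>As \<alpha>, \<beta> and \<gamma> exceed -1, their doubles lower the degree by
      less than 2, and three extra degrees compensate for this.\<close>
    define M where "M = N + 3"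
    have M: "real N < real M + 2 * \<alpha>" "real N < real M + 2 * \<beta>" "real N < real M + 2 * \<gamma>"
      using \<alpha> \<beta> by (auto simp: M_def \<gamma>)
    obtain r1 where r1_eq: "\<And>z. \<theta> z * K 0 0 \<alpha> j z = (\<Sum>d<M. \<Sum>a\<le>d. t d a * (\<rho> z * K a (d - a) \<alpha> j z)) + r1 z"
      and r1: "Cn N r1" "bdd_supp r1" "L1_sing r1"
      by (rule taylor_split[OF t \<rho>\<theta> sm bs M(1) \<alpha>, of j]) (rule that)
    have f_eq: "f z = (\<Sum>D<M. \<Sum>a\<le>D. t D a * A a (D - a) \<alpha> j z) + r1 z" for z
      unfolding f_def A_def by (rule r1_eq)
    obtain r2 where r2_eq: "\<And>z. \<eta> z * K 0 0 \<beta> k z = (\<Sum>d<M. \<Sum>a\<le>d. u d a * (\<rho> z * K a (d - a) \<beta> k z)) + r2 z"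
      and r2: "Cn N r2" "bdd_supp r2" "L1_sing r2"
      by (rule taylor_split[OF u \<rho>\<eta> sm bs M(2) \<beta>, of k]) (rule that)
    have g_eq: "g z = (\<Sum>e<M. \<Sum>c\<le>e. u e c * A c (e - c) \<beta> k z) + r2 z" for z
      unfolding g_def A_def by (rule r2_eq)
    define fp where "fp z = (\<Sum>D<M. \<Sum>a\<le>D. t D a * A a (D - a) \<alpha> j z)" for z
    define gp where "gp z = (\<Sum>e<M. \<Sum>c\<le>e. u e c * A c (e - c) \<beta> k z)" for z
    have fp_L1: "L1_sing fp" unfolding fp_def[abs_def] by (intro L1_sing_sum L1_sing_cmult A_L1_sing \<alpha>) auto
    have gp_L1: "L1_sing gp" unfolding gp_def[abs_def] by (intro L1_sing_sum L1_sing_cmult A_L1_sing \<beta>) auto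
    \<comment> \<open>Every product involving a remainder has one C^N factor of bounded support and
      one integrable factor.\<close>
    define x1 where "x1 s = conv r1 g s + conv r2 fp s" for s
    have x1: "Cn N x1"
      unfolding x1_def[abs_def] by (intro Cn_add Cn_conv r1 r2 L1_sing_integrable g_L1 fp_L1)
    have fg: "conv f g s = conv fp gp s + x1 s" if s: "s \<noteq> 0" for s
    proof -
      have "f = (\<lambda>z. fp z + r1 z)" "g = (\<lambda>z. gp z + r2 z)" using f_eq g_eq by (auto simp: fp_def gp_def)
      then have "conv f g s = conv fp g s + conv r1 g s" "conv fp g s = conv fp gp s + conv fp r2 s"
        using conv_add_left[OF fp_L1 r1(3) g_L1 s] conv_add_right[OF fp_L1 gp_L1 r2(3) s] by simp_all
      then show ?thesis
        using conv_commute[OF L1_sing_measurable[OF fp_L1] L1_sing_measurable[OF r2(3)], of s] by (simp add: x1_def)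
    qed
    define x2 where "x2 s = (\<Sum>D<M. \<Sum>e<M. \<Sum>a\<le>D. \<Sum>c\<le>e. t D a * u e c * X a (D - a) c (e - c) s)" for s
    have x2: "Cn N x2"
      unfolding x2_def[abs_def] by (intro Cn_sum Cn_cmult smooth_Cn[OF X])
    have pp: "conv fp gp s = (\<Sum>l<n. \<Sum>D<M. \<Sum>e<M. Y l D e s) + x2 s" if s: "s \<noteq> 0" for s
    proof -
      have "conv fp gp s = (\<Sum>D<M. \<Sum>a\<le>D. \<Sum>e<M. \<Sum>c\<le>e. t D a * (u e c * H a (D - a) \<alpha> j c (e - c) \<beta> k s))"
        unfolding fp_def[abs_def] gp_def[abs_def] H_def using s \<alpha> \<beta>
        by (simp add: conv_sum_left conv_sum_right conv_cmult_left conv_cmult_right L1_sing_sum L1_sing_cmult A_L1_sing sum_distrib_left)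
      also have "\<dots> = (\<Sum>D<M. \<Sum>e<M. \<Sum>a\<le>D. \<Sum>c\<le>e. t D a * (u e c * H a (D - a) \<alpha> j c (e - c) \<beta> k s))"
        by (rule sum.cong[OF refl], rule sum.swap)
      also have "\<dots> = (\<Sum>D<M. \<Sum>e<M. \<Sum>a\<le>D. \<Sum>c\<le>e. (\<Sum>l<n. W l D e a c s)
           + t D a * u e c * X a (D - a) c (e - c) s)"
        unfolding HC[OF s] W_def by (intro sum.cong refl) (simp add: distrib_left sum_distrib_left mult.assoc)
      also have "\<dots> = (\<Sum>D<M. \<Sum>e<M. \<Sum>a\<le>D. \<Sum>c\<le>e. \<Sum>l<n. W l D e a c s) + x2 s"
        by (simp only: sum.distrib x2_def)
      also have "(\<Sum>D<M. \<Sum>e<M. \<Sum>a\<le>D. \<Sum>c\<le>e. \<Sum>l<n. W l D e a c s)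
         = (\<Sum>l<n. \<Sum>D<M. \<Sum>e<M. Y l D e s)"
        unfolding Y_def by (rule sum_pull_out)
      finally show ?thesis .
    qed
    \<comment> \<open>The double sum over the square \<open>D, e < M\<close> overshoots the Taylor
      components of \<open>\<zeta> l\<close> below degree \<open>M\<close> by exactly these
      pairs.\<close>
    define S where "S = {(D, e). D < M \<and> e < M \<and> M \<le> D + e}"
    define x3 where "x3 l s = (\<Sum>(D, e)\<in>S. Y l D e s)" for l s
    have x3: "Cn N (x3 l)" for l
    proof -
      have "Cn N (\<lambda>s. Y l D e s)" if "M \<le> D + e" for D e
        unfolding Y_def W_def
      proof (intro Cn_sum Cn_cmult Cn_K)
        fix a c assume "a \<in> {..D}" "c \<in> {..e}"
        then have "real (a + c) + real (D - a + (e - c)) = real (D + e)" by (simp add: of_nat_diff)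
        then show "real N < real (a + c) + real (D - a + (e - c)) + 2 * \<gamma>" using M(3) that by linarith
      qed
      then show ?thesis
        unfolding x3_def[abs_def] by (intro Cn_sum) (auto simp: S_def split: prod.splits)
    qed
    have "\<exists>q. (\<forall>a. smooth (q a)) \<and> (\<forall>s. \<zeta> l s = (\<Sum>d<M. hpoly d (Z l d) s) + (\<Sum>a\<le>M. q a s * (s ^ a * cnj s ^ (M - a))))" for l
      using \<zeta>(3) unfolding has_taylor_def by blast
    then obtain q where q: "\<And>l a. smooth (q l a)"
      and \<zeta>_eq: "\<And>l s. \<zeta> l s = (\<Sum>d<M. hpoly d (Z l d) s) + (\<Sum>a\<le>M. q l a s * (s ^ a * cnj s ^ (M - a)))"
      by metis
    \<comment> \<open>The Taylor remainder of \<open>\<zeta> l\<close> times its kernel, of degree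
      \<open>M + 2\<gamma>\<close>.\<close>
    define x4 where "x4 l s = (\<Sum>a\<le>M. q l a s * K a (M - a) \<gamma> l s)" for l s
    have x4: "Cn N (x4 l)" for l
      unfolding x4_def[abs_def] using M(3) by (intro Cn_sum Cn_mult smooth_Cn[OF q] Cn_K) auto
    have \<zeta>K: "\<zeta> l s * K 0 0 \<gamma> l s = (\<Sum>D<M. \<Sum>e<M. Y l D e s) - x3 l s + x4 l s" for l s
    proof -
      have "\<zeta> l s * K 0 0 \<gamma> l s = (\<Sum>d<M. hpoly d (Z l d) s * K 0 0 \<gamma> l s) + (\<Sum>a\<le>M. q l a s * (s ^ a * cnj s ^ (M - a) * K 0 0 \<gamma> l s))"
        unfolding \<zeta>_eq by (simp add: distrib_right sum_distrib_right mult.assoc)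
      also have "(\<Sum>a\<le>M. q l a s * (s ^ a * cnj s ^ (M - a) * K 0 0 \<gamma> l s)) = x4 l s"
        unfolding K_mult_monom x4_def by simp
      also have "(\<Sum>d<M. hpoly d (Z l d) s * K 0 0 \<gamma> l s) = (\<Sum>D<M. \<Sum>e<M. Y l D e s) - x3 l s"
        unfolding ZY x3_def S_def square_split_sum by simp
      finally show ?thesis .
    qed
    have "Cn N (\<lambda>s. x2 s + x1 s + (\<Sum>l<n. x3 l s - x4 l s))"
      by (intro Cn_add Cn_sum Cn_diff x1 x2 x3 x4)
    moreover have "x2 s + x1 s + (\<Sum>l<n. x3 l s - x4 l s) = conv f g s - (\<Sum>l<n. \<zeta> l s * K 0 0 \<gamma> l s)" if "s \<noteq> 0" for s
      unfolding fg[OF that] pp[OF that] \<zeta>K by (simp add: sum.distrib sum_subtractf)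
    ultimately show ?thesis by (intro exI[of _ "\<lambda>s. x2 s + x1 s + (\<Sum>l<n. x3 l s - x4 l s)"]) blast
  qed
  obtain \<xi> where \<xi>: "smooth \<xi>" "\<And>s. s \<noteq> 0 \<Longrightarrow> \<xi> s = conv f g s - (\<Sum>l<n. \<zeta> l s * K 0 0 \<gamma> l s)"
    using smooth_glue[OF key] by blast
  \<comment> \<open>Gluing gives no support information; it comes from the convolution and the
    finitely many \<open>\<zeta> l\<close> all vanishing far out.\<close>
  have \<xi>_bs: "bdd_supp \<xi>"
  proof -
    have "\<exists>S. \<forall>s. S < cmod s \<longrightarrow> \<zeta> l s = 0" for l using \<zeta>(2)[of l] unfolding bdd_supp_def .
    then obtain S where S: "\<And>l s. S l < cmod s \<Longrightarrow> \<zeta> l s = 0" by metis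
    have "\<xi> s = 0" if s: "2 * R + (\<Sum>l<n. \<bar>S l\<bar>) < cmod s" for s
    proof -
      have nn: "(\<Sum>l<n. \<bar>S l\<bar>) \<ge> 0" by (intro sum_nonneg) auto
      then have sR: "2 * R < cmod s" using s by linarith
      have "\<zeta> l s = 0" if "l < n" for l
      proof (rule S)
        have "S l \<le> (\<Sum>l<n. \<bar>S l\<bar>)"
          using member_le_sum[of l "{..<n}" "\<lambda>l. \<bar>S l\<bar>"] that by auto
        then show "S l < cmod s" using s R by linarith
      qed
      moreover have "conv f g s = 0"
        by (rule conv_bdd_supp[where R = R]) (use sR \<theta>(2) \<eta>(2) in \<open>auto simp: f_def g_def\<close>)
      moreover have "s \<noteq> 0" using sR R by auto
      ultimately show ?thesis using \<xi>(2) by simp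
    qed
    then show ?thesis unfolding bdd_supp_def by blast
  qed
  let ?c = "- complex_of_real (1 / pi)"
  have set_eq: "{l. int l \<le> int n - 1} = {..<n}" by auto
  show ?thesis
    unfolding has_log_expansion_def
  proof (intro exI[of _ "\<lambda>l s. ?c * \<zeta> l s"] exI[of _ "\<lambda>s. ?c * \<xi> s"] conjI allI impI)
    show "(\<lambda>s. ?c * \<zeta> l s) \<in> Cinf_compact" for l
      unfolding Cinf_compact_iff by (intro conjI smooth_intros \<zeta> bdd_supp_mult(2))
    show "(\<lambda>s. ?c * \<xi> s) \<in> Cinf_compact"
      unfolding Cinf_compact_iff by (intro conjI smooth_intros \<xi> \<xi>_bs bdd_supp_mult(2))
    fix s :: complex assume s: "s \<noteq> 0"
    have "F_conv \<theta> \<eta> \<alpha> \<beta> j k s = ?c * conv f g s"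
      unfolding F_conv_eq_conv f_def g_def ..
    also have "conv f g s = (\<Sum>l<n. \<zeta> l s * K 0 0 \<gamma> l s) + \<xi> s"
      using \<xi>(2)[OF s] by simp
    also have "?c * \<dots> = (\<Sum>l<n. ?c * \<zeta> l s * K 0 0 \<gamma> l s) + ?c * \<xi> s"
      by (simp only: distrib_left sum_distrib_left mult.assoc)
    finally show "F_conv \<theta> \<eta> \<alpha> \<beta> j k s = (\<Sum>l | int l \<le> int n - 1. ?c * \<zeta> l s *
                    complex_of_real (cmod s powr (2 * \<gamma>) * ln ((cmod s)\<^sup>2) ^ l)) + ?c * \<xi> s"
      unfolding set_eq K_def by simp
  qed
qed

lemma Ints_gt_minus_one_Nats:
  assumes "(x::real) \<in> \<int>" "x > -1"
  shows "x \<in> \<nat>"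
proof -
  obtain i where i: "x = of_int i" using assms(1) by (auto elim: Ints_cases)
  then have "i \<ge> 0" using assms(2) by linarith
  then have "x = real (nat i)" using i by simp
  then show ?thesis by simp
qed

theorem mainTheorem5:
  fixes \<alpha> \<beta> :: real and j k :: nat and \<theta> \<eta> :: "complex \<Rightarrow> complex"
  assumes "\<alpha> > -1" and "\<beta> > -1"
    and "\<theta> \<in> Cinf_compact" and "\<eta> \<in> Cinf_compact"
  shows "(\<alpha> \<notin> \<nat> \<and> \<beta> \<notin> \<nat> \<and> \<alpha> + \<beta> + 1 \<notin> \<nat> \<longrightarrow>
            has_log_expansion (F_conv \<theta> \<eta> \<alpha> \<beta> j k) (\<alpha> + \<beta> + 1) (int j + int k))
       \<and> (\<alpha> \<notin> \<nat> \<and> \<beta> \<notin> \<nat> \<and> \<alpha> + \<beta> + 1 \<in> \<nat> \<longrightarrow>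
            has_log_expansion (F_conv \<theta> \<eta> \<alpha> \<beta> j k) (\<alpha> + \<beta> + 1) (int j + int k + 1))
       \<and> (\<alpha> \<in> \<int> \<or> \<beta> \<in> \<int> \<longrightarrow>
            has_log_expansion (F_conv \<theta> \<eta> \<alpha> \<beta> j k) (\<alpha> + \<beta> + 1) (int j + int k - 1))
       \<and> ((\<alpha> \<in> \<nat> \<and> j = 0) \<or> (\<beta> \<in> \<nat> \<and> k = 0) \<longrightarrow>
            has_log_expansion (F_conv \<theta> \<eta> \<alpha> \<beta> j k) (\<alpha> + \<beta> + 1) (-1))"
proof -
  have \<theta>: "smooth \<theta>" "bdd_supp \<theta>" and \<eta>: "smooth \<eta>" "bdd_supp \<eta>"
    using assms(3,4) by (auto simp: Cinf_compact_iff)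
  obtain R where pos: "R > 0" and zero: "\<And>z. R < cmod z \<Longrightarrow> \<theta> z = 0" "\<And>z. R < cmod z \<Longrightarrow> \<eta> z = 0"
    using bdd_supp_common_radius[OF \<theta>(2) \<eta>(2)] by blast
  obtain \<rho> where \<rho>: "smooth \<rho>" "\<And>z. cmod z \<le> R \<Longrightarrow> \<rho> z = 1" "\<And>z. cmod z \<ge> 2 * R \<Longrightarrow> \<rho> z = 0"
    "\<And>z \<omega>. cmod \<omega> = 1 \<Longrightarrow> \<rho> (\<omega> * z) = \<rho> z"
    using cutoff_exists[OF pos] by metis
  interpret radial_cutoff \<rho> R
    by unfold_locales (use pos \<rho> in \<open>auto simp: bdd_supp_def intro!: exI[of _ "2 * R"]\<close>)
  let ?\<gamma> = "\<alpha> + \<beta> + 1"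
  let ?E = "has_log_expansion (F_conv \<theta> \<eta> \<alpha> \<beta> j k) ?\<gamma>"
  have main: "?E (int n - 1)"
    if "\<And>a b c d. K_expansion (a + c) (b + d) ?\<gamma> n (H a b \<alpha> j c d \<beta> k)" for n
    using log_expansion_from_model[OF assms(1,2) refl \<theta>(1) zero(1) \<eta>(1) zero(2) that] .
  note model = H_expansion[OF assms(1,2) refl]
  show ?thesis
  proof (intro conjI impI)
    assume a: "\<alpha> \<notin> \<nat> \<and> \<beta> \<notin> \<nat> \<and> ?\<gamma> \<notin> \<nat>"
    \<comment> \<open>The count of terms is \<open>L + 1\<close> in each case. Without integers each
      step of the induction adds one term, starting from one.\<close>
    have "?E (int (j + k + 1) - 1)"
      by (rule main, rule model[of "\<lambda>j k. j + k + 1"]) (use a in auto)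
    then show "?E (int j + int k)" by simp
  next
    assume a: "\<alpha> \<notin> \<nat> \<and> \<beta> \<notin> \<nat> \<and> ?\<gamma> \<in> \<nat>"
    \<comment> \<open>The start at two terms leaves room for the resonant logarithm.\<close>
    have "?E (int (j + k + 2) - 1)"
      by (rule main, rule model[of "\<lambda>j k. j + k + 2"]) auto
    then show "?E (int j + int k + 1)" by (simp add: algebra_simps)
  next
    assume a: "\<alpha> \<in> \<int> \<or> \<beta> \<in> \<int>"
    have N: "\<alpha> \<in> \<nat> \<or> \<beta> \<in> \<nat>" using a Ints_gt_minus_one_Nats assms(1,2) by blast
    \<comment> \<open>Under resonance an integer \<alpha> forces an integer \<beta> and conversely.
      Then a model not already smooth has \<open>j, k \<ge> 1\<close>, so the required two terms fit
      into \<open>j + k\<close>.\<close>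
    have both: "\<alpha> \<in> \<nat> \<and> \<beta> \<in> \<nat>" if "?\<gamma> \<in> \<nat>"
    proof -
      have g: "?\<gamma> \<in> \<int>" using that Nats_subset_Ints by blast
      have "\<beta> = ?\<gamma> - \<alpha> - 1" "\<alpha> = ?\<gamma> - \<beta> - 1" by simp_all
      then have "\<alpha> \<in> \<int> \<longrightarrow> \<beta> \<in> \<int>" "\<beta> \<in> \<int> \<longrightarrow> \<alpha> \<in> \<int>" using g Ints_diff Ints_1 by metis+
      then show ?thesis using a Ints_gt_minus_one_Nats assms(1,2) by blast
    qed
    have "?E (int (j + k) - 1)"
    proof (rule main, rule model[of "\<lambda>j k. j + k"])
      fix j k :: nat
      show "((\<alpha> \<in> \<nat> \<and> j = 0) \<or> (\<beta> \<in> \<nat> \<and> k = 0)) \<or>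
        (j + k \<ge> 1 \<and> (?\<gamma> \<in> \<nat> \<longrightarrow> j + k \<ge> 2) \<and> (j > 0 \<longrightarrow> j - 1 + k < j + k) \<and> (k > 0 \<longrightarrow> j + (k - 1) < j + k))"
        using N both by (cases "j = 0"; cases "k = 0") auto
    qed
    then show "?E (int j + int k - 1)" by simp
  next
    assume a: "(\<alpha> \<in> \<nat> \<and> j = 0) \<or> (\<beta> \<in> \<nat> \<and> k = 0)"
    \<comment> \<open>One factor of every model is smooth here, so no radial equation is solved and
      no term appears.\<close>
    have "K_expansion (a + c) (b + d) ?\<gamma> 0 (H a b \<alpha> j c d \<beta> k)" for a b c d
      using a
    proof
      assume "\<alpha> \<in> \<nat> \<and> j = 0"
      then show ?thesis using H_smooth_left[OF assms(1,2)] K_expansion_smooth by blast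
    next
      assume "\<beta> \<in> \<nat> \<and> k = 0"
      then show ?thesis using H_smooth_left[OF assms(2,1)] K_expansion_smooth H_commute[OF assms(1,2)] by metis
    qed
    from main[OF this] show "?E (-1)" by simp
  qed
qed

end
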